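(* Let $V:\mathbb{R}^3\to\mathbb{C}$ belong to the Rollnik class $R(\mathbb{R}^3)$. Then $$\sigma_{\mathrm p}(H_V)\subset\left\{\lambda\in\mathbb{C}:\ |\lambda|\le\frac12\,\frac{\|V\|_{R(\mathbb{R}^3)}^2}{(4\pi)^2}\right\},$$ where $H_V=\Delta^2\dot{+}V$ in $L^2(\mathbb{R}^3)$.
   Context: The Rollnik class $R(\mathbb{R}^3)$ consists of all complex-valued $V\in L^1_{\mathrm{loc}}(\mathbb{R}^3)$ such that $\|V\|_{R(\mathbb{R}^3)}^2:=\iint_{\mathbb{R}^3\times\mathbb{R}^3}\frac{|V(x)||V(y)|}{|x-y|^2}\,dx\,dy<\infty$. Every $V\in R(\mathbb{R}^3)$ satisfies the following: there exist $a\in(0,1)$ and $b\in\mathbb{R}$ with $\int_{\mathbb{R}^3}|V||\psi|^2\le a\int_{\mathbb{R}^3}|\Delta\psi|^2+b\int_{\mathbb{R}^3}|\psi|^2$ for all $\psi\in H^2(\mathbb{R}^3)$. Under this condition the operator $H_V=\Delta^2\dot{+}V$ is the m-sectorial operator in $L^2(\mathbb{R}^3)$ associated, via the representation theorem, with the closed sectorial form $h_V(\varphi,\psi)=\int_{\mathbb{R}^3}\overline{\Delta\varphi}\,\Delta\psi+\int_{\mathbb{R}^3}V\,\overline{\varphi}\,\psi$ with form domain $H^2(\mathbb{R}^3)$. That is, $\psi\in H^2(\mathbb{R}^3)$ belongs to the domain of $H_V$ with $H_V\psi=f\in L^2(\mathbb{R}^3)$ if and only if $h_V(\varphi,\psi)=\int_{\mathbb{R}^3}\overline{\varphi}f$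 for all $\varphi\in H^2(\mathbb{R}^3)$. The point spectrum $\sigma_{\mathrm p}(H_V)$ is the set of all eigenvalues $\lambda\in\mathbb{C}$ of $H_V$ (including those lying in $[0,+\infty)$). *)

theory Defs
  imports "HOL-Analysis.Analysis"
begin

text \<open>
  Function spaces are rendered by functions rather than by classes modulo equality almost
  everywhere; measurability and integration refer to the Lebesgue measure. Only the test
  functions and their derivatives are understood pointwise; membership in the function spaces,
  the forms and the operator are invariant under changes on null sets.
\<close>

definition locally_integrable :: "(real^'n \<Rightarrow> complex) \<Rightarrow> bool" where
  "locally_integrable f \<longleftrightarrow> (\<forall>K. compact K \<longrightarrow> f absolutely_integrable_on K)"

definition L2 :: "(real^'n \<Rightarrow> complex) set" where
  "L2 = {f \<in> borel_measurable lebesgue. integrable lebesgue (\<lambda>x. (norm (f x))\<^sup>2)}"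

definition partial_deriv :: "'n \<Rightarrow> (real^'n \<Rightarrow> complex) \<Rightarrow> real^'n \<Rightarrow> complex" where
  "partial_deriv i f x = frechet_derivative f (at x) (axis i 1)"

text \<open>
  A list of indices \<open>[i\<^sub>1, \<dots>, i\<^sub>k]\<close> stands for the differential operator
  \<open>\<partial>\<^sub>i\<^sub>1 \<dots> \<partial>\<^sub>i\<^sub>k\<close>.
\<close>

definition partial_derivs :: "'n list \<Rightarrow> (real^'n \<Rightarrow> complex) \<Rightarrow> real^'n \<Rightarrow> complex" where
  "partial_derivs \<alpha> f = foldr partial_deriv \<alpha> f"

text \<open>
  Requiring every iterated partial derivative to be Frechet differentiable makes each of them
  continuous, so that this is the class \<open>C\<^sup>\<infinity>\<close>.
\<close>

definition smooth :: "(real^'n \<Rightarrow> complex) \<Rightarrow> bool" where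
  "smooth f \<longleftrightarrow> (\<forall>\<alpha>. partial_derivs \<alpha> f differentiable_on UNIV)"

definition test_functions :: "(real^'n \<Rightarrow> complex) set" where
  "test_functions = {\<phi>. smooth \<phi> \<and> compact (closure {x. \<phi> x \<noteq> 0})}"

definition has_weak_deriv ::
    "'n list \<Rightarrow> (real^'n \<Rightarrow> complex) \<Rightarrow> (real^'n \<Rightarrow> complex) \<Rightarrow> bool" where
  "has_weak_deriv \<alpha> f g \<longleftrightarrow> locally_integrable f \<and> locally_integrable g \<and>
     (\<forall>\<phi>\<in>test_functions.
        (\<integral>x. f x * partial_derivs \<alpha> \<phi> x \<partial>lebesgue)
          = (-1) ^ length \<alpha> * (\<integral>x. g x * \<phi> x \<partial>lebesgue))"

text \<open>The choice is immaterial: a weak derivative is unique up to a null set.\<close>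

definition weak_deriv :: "'n list \<Rightarrow> (real^'n \<Rightarrow> complex) \<Rightarrow> real^'n \<Rightarrow> complex" where
  "weak_deriv \<alpha> f = (SOME g. has_weak_deriv \<alpha> f g)"

definition sobolev_H2 :: "(real^'n \<Rightarrow> complex) set" where
  "sobolev_H2 = {\<psi> \<in> L2. \<forall>\<alpha>. length \<alpha> \<le> 2 \<longrightarrow> (\<exists>g\<in>L2. has_weak_deriv \<alpha> \<psi> g)}"

definition weak_laplacian :: "(real^'n \<Rightarrow> complex) \<Rightarrow> real^'n \<Rightarrow> complex" where
  "weak_laplacian \<psi> x = (\<Sum>i\<in>UNIV. weak_deriv [i, i] \<psi> x)"

text \<open>
  The integrand is singular on the diagonal, a null set, where division by zero yields 0.
\<close>

definition rollnik_integral :: "(real^3 \<Rightarrow> complex) \<Rightarrow> ennreal" where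
  "rollnik_integral V =
     (\<integral>\<^sup>+x. (\<integral>\<^sup>+y. ennreal (norm (V x) * norm (V y) / (norm (x - y))\<^sup>2) \<partial>lebesgue) \<partial>lebesgue)"

definition rollnik_class :: "(real^3 \<Rightarrow> complex) set" where
  "rollnik_class = {V. locally_integrable V \<and> rollnik_integral V < \<infinity>}"

definition rollnik_norm :: "(real^3 \<Rightarrow> complex) \<Rightarrow> real" where
  "rollnik_norm V = sqrt (enn2real (rollnik_integral V))"

text \<open>
  The form \<open>h\<^sub>V\<close>, conjugate linear in the first argument. For \<open>V\<close> in the Rollnik class
  both integrands are integrable for all arguments in the form domain \<open>H\<^sup>2\<close>.
\<close>

definition schroedinger_form ::
    "(real^3 \<Rightarrow> complex) \<Rightarrow> (real^3 \<Rightarrow> complex) \<Rightarrow> (real^3 \<Rightarrow> complex) \<Rightarrow> complex" where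
  "schroedinger_form V \<phi> \<psi> =
     (\<integral>x. cnj (weak_laplacian \<phi> x) * weak_laplacian \<psi> x \<partial>lebesgue)
     + (\<integral>x. V x * cnj (\<phi> x) * \<psi> x \<partial>lebesgue)"

text \<open>
  The operator \<open>H\<^sub>V\<close> associated with the form, given by its graph: the pairs \<open>(\<psi>, f)\<close> with
  \<open>\<psi>\<close> in the domain of \<open>H\<^sub>V\<close> and \<open>H\<^sub>V \<psi> = f\<close>.
\<close>

definition schroedinger_operator ::
    "(real^3 \<Rightarrow> complex) \<Rightarrow> ((real^3 \<Rightarrow> complex) \<times> (real^3 \<Rightarrow> complex)) set" where
  "schroedinger_operator V = {(\<psi>, f). \<psi> \<in> sobolev_H2 \<and> f \<in> L2 \<and>
     (\<forall>\<phi>\<in>sobolev_H2. schroedinger_form V \<phi> \<psi> = (\<integral>x. cnj (\<phi> x) * f x \<partial>lebesgue))}"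

definition point_spectrum ::
    "((real^'n \<Rightarrow> complex) \<times> (real^'n \<Rightarrow> complex)) set \<Rightarrow> complex set" where
  "point_spectrum T =
     {\<mu>. \<exists>\<psi>. (\<psi>, \<lambda>x. \<mu> * \<psi> x) \<in> T \<and> \<not> (AE x in lebesgue. \<psi> x = 0)}"

end

theory Submission
  imports Defs "HOL-Computational_Algebra.Polynomial"
begin

text \<open>
  The bound is a Birman-Schwinger estimate with the explicit resolvent kernel of \<open>\<Delta>\<^sup>2\<close>,
  arranged so that eigenvalues inside \<open>[0, \<infinity>)\<close> need no separate treatment.

  Let \<open>H\<^sub>V \<psi> = \<mu> \<psi>\<close> with \<open>\<mu> \<noteq> 0\<close> and let \<open>\<kappa>\<^sup>2 = \<mu>\<close>. The operator factors as
  \<open>\<Delta>\<^sup>2 - \<mu> = (\<Delta> - \<kappa>) (\<Delta> + \<kappa>)\<close>. Since \<open>\<Delta>\<psi>\<close> is square integrable, the two functions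
  \<open>\<Delta>\<psi> \<plusminus> \<kappa>\<psi>\<close> are square integrable too, and in the sense of distributions each of them solves a
  Helmholtz equation \<open>(w\<^sup>2 - \<Delta>) f = V\<psi>\<close> with \<open>w\<^sup>2 = \<plusminus>\<kappa>\<close>, \<open>Re w \<ge> 0\<close>. A square integrable
  solution is necessarily the convolution of the right-hand side with \<open>exp (- w r) / (4 \<pi> r)\<close>
  (\<open>helmholtz_representation\<close>), even on the boundary \<open>Re w = 0\<close> where the kernel does not decay:
  test the equation with the kernel, cut off at distances \<open>1 / N\<close> and \<open>N\<close> from a Lebesgue point of
  \<open>f\<close>. The inner cutoff produces an approximate delta function, and the outer one an error whose
  square integral is of order \<open>1 / N\<close>.

  Subtracting the two representations gives \<open>\<psi>\<close> as an integral of \<open>V\<psi>\<close> against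
  \<open>(exp (- w r) - exp (- z r)) / (8 \<pi> \<kappa> r)\<close>, where \<open>z\<^sup>2 = - w\<^sup>2\<close>. The numerator is at most \<open>\<surd>2\<close> in
  modulus (\<open>norm_exp_diff_le_sqrt2\<close>), so that \<open>|\<psi>(y)| \<le> c \<integral> |V\<psi>|(x) / |x - y| dx\<close> almost
  everywhere, with \<open>c = \<surd>2 / (8 \<pi> |\<kappa>|)\<close>. Multiply by \<open>|V\<psi>|(y)\<close>, integrate, and apply
  Cauchy-Schwarz with respect to \<open>|V(x)| |V(y)| dx dy\<close> (\<open>rollnik_form_le\<close>): the number
  \<open>I = \<integral> |V| |\<psi>|\<^sup>2\<close> satisfies \<open>I \<le> c \<parallel>V\<parallel> I\<close> with the Rollnik norm of \<open>V\<close>. If \<open>0 < I < \<infinity>\<close> this is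
  \<open>1 \<le> c\<^sup>2 \<parallel>V\<parallel>\<^sup>2\<close>, which is the claim; if \<open>I = 0\<close>, the pointwise bound gives \<open>\<psi> = 0\<close>.

  That \<open>I\<close> is finite is the relative form boundedness of \<open>V\<close>. It comes from the same
  representation theorem with \<open>w = 1\<close>: \<open>\<psi>\<close> is the Yukawa potential of the square integrable
  function \<open>\<psi> - \<Delta>\<psi>\<close>, and duality reduces the weighted estimate to the convolution square of the
  Yukawa kernel, which is dominated by a multiple of \<open>1 / |x - y|\<close> (\<open>weighted_square_finite\<close>).
\<close>

section \<open>Smooth functions of one real variable\<close>

definition smooth_real :: "(real \<Rightarrow> 'a::real_normed_field) \<Rightarrow> bool" where
  "smooth_real f \<longleftrightarrow>
     (\<exists>D. D 0 = f \<and> (\<forall>n x. (D n has_vector_derivative D (Suc n) x) (at x)))"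

text \<open>
  Smoothness is always proved by exhibiting a set of functions that is closed under
  differentiation; no Leibniz or chain rule for higher derivatives is then ever needed.
\<close>

lemma smooth_real_coinduct:
  assumes "f \<in> A"
    and step: "\<And>g. g \<in> A \<Longrightarrow> \<exists>g'\<in>A. \<forall>x. (g has_vector_derivative g' x) (at x)"
  shows "smooth_real f"
proof -
  define d where "d g = (SOME g'. g' \<in> A \<and> (\<forall>x. (g has_vector_derivative g' x) (at x)))" for g
  have d: "d g \<in> A \<and> (\<forall>x. (g has_vector_derivative d g x) (at x))" if "g \<in> A" for g
  proof -
    from step[OF that] have "\<exists>g'. g' \<in> A \<and> (\<forall>x. (g has_vector_derivative g' x) (at x))"
      by blast
    then show ?thesis
      unfolding d_def by (rule someI_ex)
  qed
  define D where "D n = (d ^^ n) f" for n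
  have "D n \<in> A" for n
    by (induction n) (simp_all add: D_def assms(1) d)
  moreover have "D (Suc n) = d (D n)" for n
    by (simp add: D_def)
  ultimately have "(D n has_vector_derivative D (Suc n) x) (at x)" for n x
    using d by simp
  then show ?thesis
    unfolding smooth_real_def by (intro exI[of _ D]) (simp add: D_def)
qed

lemma smooth_real_has_derivative:
  assumes "smooth_real f"
  obtains f' where "smooth_real f'" "\<And>x. (f has_vector_derivative f' x) (at x)"
proof -
  from assms obtain D where D: "D 0 = f" "\<And>n x. (D n has_vector_derivative D (Suc n) x) (at x)"
    unfolding smooth_real_def by blast
  have "smooth_real (D (Suc 0))"
    unfolding smooth_real_def
    by (rule exI[of _ "\<lambda>n. D (Suc n)"]) (simp add: D(2))
  then show ?thesis
    using that D(2)[of 0] D(1) by auto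
qed

text \<open>
  Coinduction needs a set that is visibly closed under differentiation. Products of two smooth
  functions do not form one, but the algebra generated by all smooth functions does.
\<close>

inductive_set smooth_algebra :: "(real \<Rightarrow> 'a::real_normed_field) set" where
  base: "smooth_real f \<Longrightarrow> f \<in> smooth_algebra"
| add: "f \<in> smooth_algebra \<Longrightarrow> g \<in> smooth_algebra \<Longrightarrow> (\<lambda>x. f x + g x) \<in> smooth_algebra"
| mult: "f \<in> smooth_algebra \<Longrightarrow> g \<in> smooth_algebra \<Longrightarrow> (\<lambda>x. f x * g x) \<in> smooth_algebra"
| inverse: "f \<in> smooth_algebra \<Longrightarrow> (\<And>x. f x \<noteq> 0) \<Longrightarrow> (\<lambda>x. inverse (f x)) \<in> smooth_algebra"

lemma smooth_real_const: "smooth_real (\<lambda>_. c)"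
proof (rule smooth_real_coinduct[of _ "range (\<lambda>c _. c)"])
  fix g :: "real \<Rightarrow> 'a" assume "g \<in> range (\<lambda>c _. c)"
  then show "\<exists>g'\<in>range (\<lambda>c _. c). \<forall>x. (g has_vector_derivative g' x) (at x)"
    by (intro bexI[of _ "\<lambda>_. 0"]) auto
qed simp

lemma smooth_algebra_imp_smooth:
  assumes "f \<in> smooth_algebra"
  shows "smooth_real f"
proof (rule smooth_real_coinduct[OF assms])
  fix g :: "real \<Rightarrow> 'a"
  assume "g \<in> smooth_algebra"
  then show "\<exists>g'\<in>smooth_algebra. \<forall>x. (g has_vector_derivative g' x) (at x)"
  proof induction
    case (base f)
    then obtain f' where "smooth_real f'" "\<And>x. (f has_vector_derivative f' x) (at x)"
      by (rule smooth_real_has_derivative) blast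
    then show ?case
      by (intro bexI[of _ f'] smooth_algebra.base) auto
  next
    case (add f g)
    then obtain f' g' where "f' \<in> smooth_algebra" "g' \<in> smooth_algebra"
      "\<And>x. (f has_vector_derivative f' x) (at x)" "\<And>x. (g has_vector_derivative g' x) (at x)"
      by blast
    then show ?case
      by (intro bexI[of _ "\<lambda>x. f' x + g' x"])
        (auto intro: smooth_algebra.add has_vector_derivative_add)
  next
    case (mult f g)
    then obtain f' g' where "f' \<in> smooth_algebra" "g' \<in> smooth_algebra"
      "\<And>x. (f has_vector_derivative f' x) (at x)" "\<And>x. (g has_vector_derivative g' x) (at x)"
      by blast
    with mult show ?case
      by (intro bexI[of _ "\<lambda>x. f x * g' x + f' x * g x"])
        (auto intro!: smooth_algebra.add smooth_algebra.mult has_vector_derivative_mult)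
  next
    case (inverse f)
    then obtain f' where f': "f' \<in> smooth_algebra"
      "\<And>x. (f has_vector_derivative f' x) (at x)"
      by blast
    have "((\<lambda>x. inverse (f x)) has_vector_derivative
            (-1) * (inverse (f x) * (f' x * inverse (f x)))) (at x)" for x
      using Deriv.has_derivative_inverse[OF inverse(2) f'(2)[of x, unfolded has_vector_derivative_def]]
      unfolding has_vector_derivative_def by (rule has_derivative_eq_rhs) (auto simp: fun_eq_iff)
    moreover have "(\<lambda>x. (-1) * (inverse (f x) * (f' x * inverse (f x)))) \<in> smooth_algebra"
      by (intro smooth_algebra.mult smooth_algebra.inverse inverse(1,2) f'(1)
          smooth_algebra.base[OF smooth_real_const])
    ultimately show ?case
      by (intro bexI[of _ "\<lambda>x. (-1) * (inverse (f x) * (f' x * inverse (f x)))"]) simp_all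
  qed
qed

lemma smooth_real_add: "smooth_real f \<Longrightarrow> smooth_real g \<Longrightarrow> smooth_real (\<lambda>x. f x + g x)"
  by (rule smooth_algebra_imp_smooth[OF smooth_algebra.add[OF smooth_algebra.base smooth_algebra.base]])

lemma smooth_real_mult: "smooth_real f \<Longrightarrow> smooth_real g \<Longrightarrow> smooth_real (\<lambda>x. f x * g x)"
  by (rule smooth_algebra_imp_smooth[OF smooth_algebra.mult[OF smooth_algebra.base smooth_algebra.base]])

lemma smooth_real_inverse: "smooth_real f \<Longrightarrow> (\<And>x. f x \<noteq> 0) \<Longrightarrow> smooth_real (\<lambda>x. inverse (f x))"
  by (rule smooth_algebra_imp_smooth[OF smooth_algebra.inverse[OF smooth_algebra.base]])

lemma smooth_real_diff: "smooth_real f \<Longrightarrow> smooth_real g \<Longrightarrow> smooth_real (\<lambda>x. f x - g x)"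
proof -
  assume "smooth_real f" "smooth_real g"
  then have "smooth_real (\<lambda>x. f x + (-1) * g x)"
    by (rule smooth_real_add[OF _ smooth_real_mult[OF smooth_real_const]])
  then show ?thesis
    by simp
qed

lemma smooth_real_affine:
  assumes "smooth_real f"
  shows "smooth_real (\<lambda>x. f (a * x + b))"
proof (rule smooth_real_coinduct[of _ "{\<lambda>x. c * f (a * x + b) |c f. smooth_real f}"])
  show "(\<lambda>x. f (a * x + b)) \<in> {\<lambda>x. c * f (a * x + b) |c f. smooth_real f}"
    using assms by (auto intro!: exI[of _ 1])
next
  fix g assume "g \<in> {\<lambda>x. c * (f::real \<Rightarrow> 'a) (a * x + b) |c f. smooth_real f}"
  then obtain c f where g: "g = (\<lambda>x. c * f (a * x + b))" and f: "smooth_real f"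
    by blast
  from f obtain f' where f': "smooth_real f'" "\<And>x. (f has_vector_derivative f' x) (at x)"
    by (rule smooth_real_has_derivative) blast
  have "((\<lambda>x. a * x + b) has_vector_derivative a) (at x)" for x
    by (auto intro!: derivative_eq_intros)
  from vector_diff_chain_at[OF this f'(2)]
  have "((\<lambda>x. f (a * x + b)) has_vector_derivative a *\<^sub>R f' (a * x + b)) (at x)" for x
    by (simp add: o_def)
  from has_vector_derivative_mult_right[OF this, of c]
  have "(g has_vector_derivative (c * of_real a) * f' (a * x + b)) (at x)" for x
    by (simp add: g scaleR_conv_of_real mult.assoc)
  then show "\<exists>g'\<in>{\<lambda>x. c * f (a * x + b) |c f. smooth_real f}.
      \<forall>x. (g has_vector_derivative g' x) (at x)"
    by (intro bexI[of _ "\<lambda>x. (c * of_real a) * f' (a * x + b)"]) (use f'(1) in auto)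
qed

lemma smooth_real_ident: "smooth_real (\<lambda>x. of_real x)"
proof (rule smooth_real_coinduct[of _ "insert (\<lambda>x. of_real x) (range (\<lambda>c _. c))"])
  fix g :: "real \<Rightarrow> 'a" assume "g \<in> insert (\<lambda>x. of_real x) (range (\<lambda>c _. c))"
  moreover have "((\<lambda>x. of_real x :: 'a) has_vector_derivative 1) (at x)" for x
    using has_vector_derivative_of_real[OF DERIV_ident] by simp
  moreover have "((\<lambda>x. k :: 'a) has_vector_derivative 0) (at x)" for k and x :: real
    by (rule has_vector_derivative_const)
  ultimately obtain c where "\<forall>x. (g has_vector_derivative c) (at x)"
    by blast
  then show "\<exists>g'\<in>insert (\<lambda>x. of_real x) (range (\<lambda>c _. c)).
      \<forall>x. (g has_vector_derivative g' x) (at x)"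
    by (intro bexI[of _ "\<lambda>_. c"]) auto
qed simp

lemma smooth_real_exp: "smooth_real (\<lambda>x. exp (c * of_real x) :: complex)"
proof (rule smooth_real_coinduct[of _ "range (\<lambda>k x. k * exp (c * of_real x))"])
  show "(\<lambda>x. exp (c * of_real x)) \<in> range (\<lambda>k x. k * exp (c * of_real x))"
    by (auto intro!: image_eqI[of _ _ 1])
next
  fix g assume "g \<in> range (\<lambda>k x. k * exp (c * complex_of_real x))"
  then obtain k where g: "g = (\<lambda>x. k * exp (c * of_real x))"
    by blast
  have "((\<lambda>z. k * exp (c * z)) has_field_derivative (k * c) * exp (c * of_real x)) (at (of_real x))" for x
    by (auto intro!: derivative_eq_intros)
  from has_vector_derivative_real_field[OF this]
  have "(g has_vector_derivative (k * c) * exp (c * of_real x)) (at x)" for x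
    by (simp add: g)
  then show "\<exists>g'\<in>range (\<lambda>k x. k * exp (c * of_real x)). \<forall>x. (g has_vector_derivative g' x) (at x)"
    by (intro bexI[of _ "\<lambda>x. (k * c) * exp (c * of_real x)"]) auto
qed

lemma smooth_real_of_real:
  assumes "smooth_real f"
  shows "smooth_real (\<lambda>x. of_real (f x))"
proof (rule smooth_real_coinduct[of _ "{\<lambda>x. of_real (f x) |f. smooth_real f}"])
  show "(\<lambda>x. of_real (f x)) \<in> {\<lambda>x. of_real (f x) |f. smooth_real f}"
    using assms by blast
next
  fix g assume "g \<in> {\<lambda>x. of_real (f x) :: 'a |f. smooth_real f}"
  then obtain f where g: "g = (\<lambda>x. of_real (f x))" and f: "smooth_real f"
    by blast
  from f obtain f' where f': "smooth_real f'" "\<And>x. (f has_vector_derivative f' x) (at x)"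
    by (rule smooth_real_has_derivative) blast
  have "(g has_vector_derivative of_real (f' x)) (at x)" for x
    unfolding g using f'(2)[of x]
    by (intro has_vector_derivative_of_real) (simp add: has_real_derivative_iff_has_vector_derivative)
  then show "\<exists>g'\<in>{\<lambda>x. of_real (f x) :: 'a |f. smooth_real f}.
      \<forall>x. (g has_vector_derivative g' x) (at x)"
    by (intro bexI[of _ "\<lambda>x. of_real (f' x)"]) (use f'(1) in auto)
qed

subsection \<open>A smooth step\<close>

definition flat_exp :: "real \<Rightarrow> real" where
  "flat_exp x = (if x > 0 then exp (- (1 / x)) else 0)"

lemma poly_times_exp_minus_tendsto_0: "((\<lambda>t::real. poly p t * exp (- t)) \<longlongrightarrow> 0) at_top"
proof -
  have "((\<lambda>t. \<Sum>i\<le>degree p. coeff p i * (t ^ i / exp t)) \<longlongrightarrow> (\<Sum>i\<le>degree p. coeff p i * 0)) at_top"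
    by (intro tendsto_intros tendsto_power_div_exp_0)
  then show ?thesis
    by (simp add: poly_altdef exp_minus sum_distrib_right sum_divide_distrib divide_inverse mult.assoc)
qed

text \<open>
  Every derivative of \<open>flat_exp\<close> is a polynomial in \<open>1 / x\<close> times \<open>exp (- 1 / x)\<close> on the
  positive half line, and exponential decay beats the polynomial at the origin.
\<close>

lemma smooth_flat_exp: "smooth_real flat_exp"
proof -
  define F where "F p x = (if x > 0 then poly p (1 / x) * exp (- (1 / x)) else 0)" for p and x :: real
  have "(F p has_vector_derivative F ([:0, 0, 1:] * (p - pderiv p)) x) (at x)" for p x
  proof -
    consider "x > 0" | "x < 0" | "x = 0"
      by linarith
    then show ?thesis
    proof cases
      case 1
      have "((\<lambda>x. poly p (1 / x) * exp (- (1 / x))) has_real_derivative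
          F ([:0, 0, 1:] * (p - pderiv p)) x) (at x)"
        using 1 by (auto intro!: derivative_eq_intros simp: F_def field_simps power2_eq_square)
      moreover have "eventually (\<lambda>y. y > 0) (nhds x)"
        unfolding eventually_nhds using 1 by (intro exI[of _ "{0<..}"]) auto
      then have "eventually (\<lambda>y. F p y = poly p (1 / y) * exp (- (1 / y))) (nhds x)"
        by eventually_elim (simp add: F_def)
      ultimately show ?thesis
        by (simp add: DERIV_cong_ev has_real_derivative_iff_has_vector_derivative[symmetric])
    next
      case 2
      have "eventually (\<lambda>y. y < 0) (nhds x)"
        unfolding eventually_nhds using 2 by (intro exI[of _ "{..<0}"]) auto
      then have "eventually (\<lambda>y. F p y = 0) (nhds x)"
        by eventually_elim (simp add: F_def)
      with 2 show ?thesis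
        by (simp add: F_def DERIV_cong_ev has_real_derivative_iff_has_vector_derivative[symmetric])
    next
      case 3
      have "((\<lambda>y. F p y / y) \<longlongrightarrow> 0) (at 0)"
      proof (rule filterlim_split_at)
        show "((\<lambda>y. F p y / y) \<longlongrightarrow> 0) (at_left 0)"
          by (rule Lim_transform_eventually[OF tendsto_const])
            (auto simp: eventually_at_filter F_def)
        have "((\<lambda>y. poly ([:0, 1:] * p) (1 / y) * exp (- (1 / y))) \<longlongrightarrow> 0) (at_right 0)"
          using filterlim_compose[OF poly_times_exp_minus_tendsto_0[of "[:0, 1:] * p"]
              filterlim_inverse_at_top_right]
          by (simp add: inverse_eq_divide)
        then show "((\<lambda>y. F p y / y) \<longlongrightarrow> 0) (at_right 0)"
          by (rule Lim_transform_eventually) (auto simp: eventually_at_filter F_def)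
      qed
      with 3 show ?thesis
        by (simp add: F_def has_real_derivative_iff_has_vector_derivative[symmetric]
            has_field_derivative_iff)
    qed
  qed
  then have "smooth_real (F [:1:])"
    by (intro smooth_real_coinduct[of "F [:1:]" "range F"] rangeI) (metis imageE rangeI)
  moreover have "F [:1:] = flat_exp"
    by (auto simp: F_def flat_exp_def)
  ultimately show ?thesis
    by simp
qed

text \<open>
  One of the two arguments of \<open>flat_exp\<close> in the denominator is always positive, so the denominator
  never vanishes and the step inherits smoothness.
\<close>

definition smooth_step :: "real \<Rightarrow> real" where
  "smooth_step x = flat_exp (x - 1/2) / (flat_exp (x - 1/2) + flat_exp (1 - x))"

lemma flat_exp_nonneg: "flat_exp x \<ge> 0"
  by (simp add: flat_exp_def)

lemma flat_exp_sum_pos: "flat_exp (x - 1/2) + flat_exp (1 - x) > 0"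
proof (cases "x > 1/2")
  case True
  then have "flat_exp (x - 1/2) > 0"
    by (simp add: flat_exp_def)
  then show ?thesis
    using flat_exp_nonneg[of "1 - x"] by linarith
next
  case False
  then have "flat_exp (1 - x) > 0"
    by (simp add: flat_exp_def)
  then show ?thesis
    using flat_exp_nonneg[of "x - 1/2"] by linarith
qed

lemma smooth_smooth_step: "smooth_real smooth_step"
proof -
  have 1: "smooth_real (\<lambda>x. flat_exp (x - 1/2))" "smooth_real (\<lambda>x. flat_exp (1 - x))"
    using smooth_real_affine[OF smooth_flat_exp, of 1 "-1/2"]
      smooth_real_affine[OF smooth_flat_exp, of "-1" 1] by simp_all
  have "smooth_real (\<lambda>x. flat_exp (x - 1/2) * inverse (flat_exp (x - 1/2) + flat_exp (1 - x)))"
    by (intro smooth_real_mult smooth_real_inverse smooth_real_add 1)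
      (use flat_exp_sum_pos in \<open>metis less_irrefl\<close>)
  then show ?thesis
    unfolding smooth_step_def[abs_def] by (subst divide_inverse)
qed

lemma smooth_step_nonneg: "smooth_step x \<ge> 0"
  and smooth_step_le_1: "smooth_step x \<le> 1"
  and smooth_step_eq_0: "x \<le> 1/2 \<Longrightarrow> smooth_step x = 0"
  and smooth_step_eq_1: "x \<ge> 1 \<Longrightarrow> smooth_step x = 1"
proof -
  show "smooth_step x \<ge> 0" "smooth_step x \<le> 1"
    using flat_exp_sum_pos[of x] flat_exp_nonneg[of "x - 1/2"] flat_exp_nonneg[of "1 - x"]
    by (auto simp: smooth_step_def)
  show "x \<le> 1/2 \<Longrightarrow> smooth_step x = 0" "x \<ge> 1 \<Longrightarrow> smooth_step x = 1"
    using flat_exp_sum_pos[of x] by (auto simp: smooth_step_def flat_exp_def)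
qed

definition smooth_step' :: "real \<Rightarrow> real" where "smooth_step' = deriv smooth_step"
definition smooth_step'' :: "real \<Rightarrow> real" where "smooth_step'' = deriv smooth_step'"

lemma smooth_step_derivatives:
  "(smooth_step has_real_derivative smooth_step' x) (at x)"
  "(smooth_step' has_real_derivative smooth_step'' x) (at x)"
  "continuous_on UNIV smooth_step'" "continuous_on UNIV smooth_step''"
proof -
  have *: "smooth_real (deriv f) \<and> (\<forall>x. (f has_real_derivative deriv f x) (at x)) \<and>
      continuous_on UNIV f"
    if "smooth_real f" for f :: "real \<Rightarrow> real"
  proof -
    from that obtain f' where f': "smooth_real f'" "\<And>x. (f has_vector_derivative f' x) (at x)"
      by (rule smooth_real_has_derivative) blast
    then have "\<And>x. (f has_real_derivative f' x) (at x)"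
      by (simp add: has_real_derivative_iff_has_vector_derivative)
    moreover from this have "f' = deriv f"
      by (intro ext) (metis DERIV_imp_deriv)
    moreover from calculation have "continuous_on UNIV f"
      using DERIV_isCont by (intro continuous_at_imp_continuous_on ballI) blast
    ultimately show ?thesis
      using f'(1) by simp
  qed
  have 1: "smooth_real smooth_step'" "\<And>x. (smooth_step has_real_derivative smooth_step' x) (at x)"
    unfolding smooth_step'_def using *[OF smooth_smooth_step] by blast+
  have 2: "smooth_real smooth_step''" "\<And>x. (smooth_step' has_real_derivative smooth_step'' x) (at x)"
    unfolding smooth_step''_def using *[OF 1(1)] by blast+
  show "(smooth_step has_real_derivative smooth_step' x) (at x)"
    "(smooth_step' has_real_derivative smooth_step'' x) (at x)"
    using 1 2 by auto
  show "continuous_on UNIV smooth_step'" "continuous_on UNIV smooth_step''"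
    using *[OF 1(1)] *[OF 2(1)] by simp_all
qed

lemma smooth_step_derivatives_eq_0:
  assumes "x < 1/2 \<or> x > 1"
  shows "smooth_step' x = 0" "smooth_step'' x = 0"
proof -
  have "open ({..<1/2} \<union> {1<..} :: real set)"
    by (intro open_Un open_lessThan open_greaterThan)
  then have "eventually (\<lambda>y. y \<in> {..<1/2} \<union> {1<..}) (nhds x)"
    by (rule eventually_nhds_in_open) (use assms in simp)
  then have ev: "eventually (\<lambda>y. y < 1/2 \<or> y > 1) (nhds x)"
    by simp
  have 1: "smooth_step' y = 0" if y: "y < 1/2 \<or> y > 1" for y
  proof -
    have "eventually (\<lambda>z. smooth_step z = smooth_step y) (nhds y)"
    proof (cases "y < 1/2")
      case True
      then show ?thesis
        using eventually_nhds_in_open[of "{..<1/2}" y]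
        by (auto elim!: eventually_mono simp: smooth_step_eq_0)
    next
      case False
      with y show ?thesis
        using eventually_nhds_in_open[of "{1<..}" y]
        by (auto elim!: eventually_mono simp: smooth_step_eq_1)
    qed
    then have "(smooth_step has_real_derivative 0) (at y)"
      by (subst DERIV_cong_ev[OF refl _ refl, of _ "\<lambda>_. smooth_step y"]) auto
    then show ?thesis
      using DERIV_unique smooth_step_derivatives(1) by blast
  qed
  show "smooth_step' x = 0"
    using 1 assms .
  have "eventually (\<lambda>z. smooth_step' z = 0) (nhds x)"
    using ev by eventually_elim (rule 1)
  then have "(smooth_step' has_real_derivative 0) (at x)"
    by (subst DERIV_cong_ev[OF refl _ refl, of _ "\<lambda>_. 0"]) auto
  then show "smooth_step'' x = 0"
    using DERIV_unique smooth_step_derivatives(2) by blast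
qed

lemma smooth_step_derivatives_bounded:
  obtains M where "M > 0" "\<And>x. \<bar>smooth_step' x\<bar> \<le> M" "\<And>x. \<bar>smooth_step'' x\<bar> \<le> M"
proof -
  have *: "\<exists>M>0. \<forall>x. \<bar>f x\<bar> \<le> M"
    if "continuous_on UNIV f" "\<And>x. x < 1/2 \<or> x > 1 \<Longrightarrow> f x = 0" for f :: "real \<Rightarrow> real"
  proof -
    have "compact (f ` {1/2..1})"
      by (intro compact_continuous_image continuous_on_subset[OF that(1)]) auto
    then obtain B where B: "B > 0" "\<And>x. x \<in> {1/2..1} \<Longrightarrow> \<bar>f x\<bar> \<le> B"
      using compact_imp_bounded bounded_pos by (metis imageI real_norm_def)
    have "\<bar>f x\<bar> \<le> B" for x
      using B(1) B(2)[of x] that(2)[of x] by (cases "x < 1/2 \<or> x > 1") simp_all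
    with B(1) show ?thesis by blast
  qed
  obtain M1 where "M1 > 0" "\<And>x. \<bar>smooth_step' x\<bar> \<le> M1"
    using *[OF smooth_step_derivatives(3) smooth_step_derivatives_eq_0(1)] by blast
  moreover obtain M2 where "M2 > 0" "\<And>x. \<bar>smooth_step'' x\<bar> \<le> M2"
    using *[OF smooth_step_derivatives(4) smooth_step_derivatives_eq_0(2)] by blast
  ultimately show ?thesis
    by (intro that[of "max M1 M2"]) (auto simp: le_max_iff_disj)
qed

section \<open>Radial test functions\<close>

lemma partial_derivs_Nil [simp]: "partial_derivs [] f = f"
  and partial_derivs_Cons [simp]: "partial_derivs (i # \<alpha>) f = partial_deriv i (partial_derivs \<alpha> f)"
  by (simp_all add: partial_derivs_def)

lemma partial_deriv_eq:
  assumes "\<And>x. (f has_derivative f' x) (at x)"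
  shows "partial_deriv i f = (\<lambda>x. f' x (axis i 1))"
  using frechet_derivative_at[OF assms] by (auto simp: partial_deriv_def fun_eq_iff)

lemma smooth_coinduct:
  fixes f :: "real^'n \<Rightarrow> complex"
  assumes "f \<in> A"
    and step: "\<And>g. g \<in> A \<Longrightarrow> \<exists>g'. (\<forall>x. (g has_derivative g' x) (at x)) \<and>
      (\<forall>i. (\<lambda>x. g' x (axis i 1)) \<in> A)"
  shows "smooth f"
proof -
  have "partial_derivs \<alpha> f \<in> A" for \<alpha>
  proof (induction \<alpha>)
    case (Cons i \<alpha>)
    from step[OF Cons.IH] obtain g' where
      "\<And>x. (partial_derivs \<alpha> f has_derivative g' x) (at x)" "\<And>i. (\<lambda>x. g' x (axis i 1)) \<in> A"
      by blast
    then show ?case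
      by (simp add: partial_deriv_eq[of "partial_derivs \<alpha> f" g'])
  qed (simp add: assms(1))
  then have "partial_derivs \<alpha> f differentiable_on UNIV" for \<alpha>
    using step[of "partial_derivs \<alpha> f"] unfolding differentiable_on_def differentiable_def
    by (meson has_derivative_at_withinI)
  then show ?thesis
    by (simp add: smooth_def)
qed

text \<open>
  The norm is not differentiable at the centre, but a profile vanishing below \<open>a\<close> makes the
  function zero near \<open>y\<close>, in agreement with the factor \<open>x - y\<close> of the general formula.
\<close>

lemma has_derivative_radial:
  fixes k :: "real \<Rightarrow> complex" and y :: "'a::euclidean_space"
  assumes "a > 0" and k': "\<And>r. r > 0 \<Longrightarrow> (k has_vector_derivative k' r) (at r)"
    and k0: "\<And>r. r < a \<Longrightarrow> k r = 0"
  shows "((\<lambda>x. k (norm (x - y))) has_derivative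
           (\<lambda>h. of_real (h \<bullet> (x - y)) * (k' (norm (x - y)) / of_real (norm (x - y))))) (at x)"
proof (cases "x = y")
  case False
  have 1: "((\<lambda>x. norm (x - y)) has_derivative (\<lambda>h. h \<bullet> sgn (x - y))) (at x)"
  proof -
    have "((\<lambda>x. x - y) has_derivative (\<lambda>h. h)) (at x)"
      by (auto intro!: derivative_eq_intros)
    from has_derivative_compose[OF this has_derivative_norm] False show ?thesis
      by simp
  qed
  have "(k has_derivative (\<lambda>t. t *\<^sub>R k' (norm (x - y)))) (at (norm (x - y)))"
    using k'[of "norm (x - y)"] False by (simp add: has_vector_derivative_def)
  from has_derivative_compose[OF 1 this] show ?thesis
    by (rule has_derivative_eq_rhs)
      (simp add: fun_eq_iff sgn_div_norm scaleR_conv_of_real divide_inverse mult_ac)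
next
  case True
  have "eventually (\<lambda>z. z \<in> ball y a) (nhds y)"
    using assms(1) by (intro eventually_nhds_in_open) auto
  then have "eventually (\<lambda>z. 0 = k (norm (z - y))) (nhds y)"
    by eventually_elim (simp add: k0 dist_norm norm_minus_commute)
  then have "((\<lambda>x. k (norm (x - y))) has_derivative (\<lambda>h. 0)) (at y)"
    by (intro has_derivative_transform_eventually[OF has_derivative_const])
      (auto simp: eventually_at_filter k0 assms(1) elim: eventually_mono)
  with True show ?thesis
    by simp
qed

lemma vector_derivative_eq_0:
  assumes "r < a" "\<And>r. r < a \<Longrightarrow> k r = 0" "(k has_vector_derivative k') (at r)"
  shows "k' = (0 :: 'a::real_normed_vector)"
proof -
  have "eventually (\<lambda>z. 0 = k z) (at r)"
    using eventually_nhds_in_open[of "{..<a}" r] assms(1,2)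
    by (auto simp: eventually_at_filter elim!: eventually_mono)
  then have "(k has_vector_derivative 0) (at r)"
    unfolding has_vector_derivative_def
    by (rule has_derivative_transform_eventually[rotated]) (use assms in auto)
  then show ?thesis
    using assms(3) vector_derivative_unique_at by blast
qed

text \<open>
  Division by the radius preserves smoothness of functions that vanish near the origin, because
  there the reciprocal may be replaced by a globally smooth function.
\<close>

lemma smooth_reciprocal:
  assumes "a > 0"
  obtains m :: "real \<Rightarrow> complex" where "smooth_real m" "\<And>r. r \<ge> a \<Longrightarrow> m r = 1 / of_real r"
proof
  define s where "s r = smooth_step (r / a)" for r
  have s: "smooth_real s"
    using smooth_real_affine[OF smooth_smooth_step, of "1 / a" 0] by (simp add: s_def[abs_def])
  have 1: "s r * r + (1 - s r) \<noteq> 0" for r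
  proof (cases "r \<le> a / 2")
    case True
    with assms have "s r = 0"
      by (simp add: s_def smooth_step_eq_0 field_simps)
    then show ?thesis
      by simp
  next
    case False
    with assms have r: "r > 0"
      by linarith
    have "0 \<le> s r" "s r \<le> 1"
      by (simp_all add: s_def smooth_step_nonneg smooth_step_le_1)
    with r have "s r * r + (1 - s r) > 0"
      by (cases "s r = 0") (auto intro: add_pos_nonneg)
    then show ?thesis
      by simp
  qed
  let ?d = "\<lambda>r. of_real (s r) * of_real r + (1 - of_real (s r)) :: complex"
  have 2: "?d r \<noteq> 0" for r
  proof -
    have "?d r = of_real (s r * r + (1 - s r))"
      by simp
    then show ?thesis
      using 1[of r] by (simp only: of_real_eq_0_iff not_False_eq_True)
  qed
  show "smooth_real (\<lambda>r. inverse (?d r))"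
    by (intro smooth_real_inverse smooth_real_add smooth_real_mult smooth_real_diff
        smooth_real_of_real smooth_real_ident smooth_real_const s 2)
  show "inverse (?d r) = 1 / of_real r" if "r \<ge> a" for r
  proof -
    have "s r = 1"
      using that assms by (simp add: s_def smooth_step_eq_1)
    then show ?thesis
      by (simp add: inverse_eq_divide)
  qed
qed

text \<open>
  The partial derivatives of \<open>k(r)\<close> are \<open>(k'(r) / r) (x\<^sub>i - y\<^sub>i)\<close>, again a radial function times
  a coordinate; hence this algebra is closed under partial derivatives.
\<close>

inductive_set radial_algebra :: "real^'n \<Rightarrow> real \<Rightarrow> (real^'n \<Rightarrow> complex) set" for y a where
  radial: "smooth_real k \<Longrightarrow> (\<And>r. r < a \<Longrightarrow> k r = 0) \<Longrightarrow> (\<lambda>x. k (norm (x - y))) \<in> radial_algebra y a"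
| coord: "(\<lambda>x. of_real (x $ i - y $ i)) \<in> radial_algebra y a"
| const: "(\<lambda>_. c) \<in> radial_algebra y a"
| add: "f \<in> radial_algebra y a \<Longrightarrow> g \<in> radial_algebra y a \<Longrightarrow> (\<lambda>x. f x + g x) \<in> radial_algebra y a"
| mult: "f \<in> radial_algebra y a \<Longrightarrow> g \<in> radial_algebra y a \<Longrightarrow> (\<lambda>x. f x * g x) \<in> radial_algebra y a"

lemma axis_inner: "axis i 1 \<bullet> v = (v $ i :: real)"
  by (simp add: inner_axis inner_commute)

lemma radial_algebra_smooth:
  assumes "f \<in> radial_algebra y a" "a > 0"
  shows "smooth f"
proof (rule smooth_coinduct[OF assms(1)])
  fix g assume "g \<in> radial_algebra y a"
  then show "\<exists>g'. (\<forall>x. (g has_derivative g' x) (at x)) \<and>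
      (\<forall>i. (\<lambda>x. g' x (axis i 1)) \<in> radial_algebra y a)"
  proof induction
    case (radial k)
    from radial(1) obtain k' where k': "smooth_real k'" "\<And>r. (k has_vector_derivative k' r) (at r)"
      by (rule smooth_real_has_derivative) blast
    have k'0: "k' r = 0" if "r < a" for r
      using vector_derivative_eq_0[OF that radial(2) k'(2)] .
    obtain m :: "real \<Rightarrow> complex" where m: "smooth_real m" "\<And>r. r \<ge> a \<Longrightarrow> m r = 1 / of_real r"
      using smooth_reciprocal[OF assms(2)] by blast
    have q: "k' r / of_real r = k' r * m r" for r
      by (cases "r < a") (simp_all add: k'0 m(2))
    have q': "(\<lambda>x. k' (norm (x - y)) * m (norm (x - y))) \<in> radial_algebra y a"
      by (rule radial_algebra.radial[of "\<lambda>r. k' r * m r"])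
        (simp_all add: k'0 smooth_real_mult k'(1) m(1))
    show ?case
      by (intro exI[of _ "\<lambda>x h. of_real (h \<bullet> (x - y)) * (k' (norm (x - y)) / of_real (norm (x - y)))"]
          conjI allI has_derivative_radial[OF assms(2) k'(2) radial(2)])
        (simp_all add: axis_inner q radial_algebra.mult[OF radial_algebra.coord q', simplified])
  next
    case (coord i)
    have "((\<lambda>x. of_real (x $ i - y $ i) :: complex) has_derivative (\<lambda>h. of_real (h $ i))) (at x)" for x
      by (rule has_derivative_of_real)
        (auto intro!: derivative_eq_intros bounded_linear.has_derivative[OF bounded_linear_vec_nth])
    then show ?case
      by (intro exI[of _ "\<lambda>x h. of_real (h $ i)"]) (simp add: radial_algebra.const)
  next
    case (const c)
    show ?case
      by (intro exI[of _ "\<lambda>x h. 0"]) (simp add: radial_algebra.const)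
  next
    case (add f g)
    then obtain f' g' where "\<And>x. (f has_derivative f' x) (at x)" "\<And>x. (g has_derivative g' x) (at x)"
      "\<And>i. (\<lambda>x. f' x (axis i 1)) \<in> radial_algebra y a" "\<And>i. (\<lambda>x. g' x (axis i 1)) \<in> radial_algebra y a"
      by blast
    then show ?case
      by (intro exI[of _ "\<lambda>x h. f' x h + g' x h"]) (auto intro: has_derivative_add radial_algebra.add)
  next
    case (mult f g)
    then obtain f' g' where *: "\<And>x. (f has_derivative f' x) (at x)" "\<And>x. (g has_derivative g' x) (at x)"
      "\<And>i. (\<lambda>x. f' x (axis i 1)) \<in> radial_algebra y a" "\<And>i. (\<lambda>x. g' x (axis i 1)) \<in> radial_algebra y a"
      by blast
    have "((\<lambda>x. f x * g x) has_derivative (\<lambda>h. f x * g' x h + f' x h * g x)) (at x)" for x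
      by (rule has_derivative_mult) (rule *)+
    moreover have "(\<lambda>x. f x * g' x (axis i 1) + f' x (axis i 1) * g x) \<in> radial_algebra y a" for i
      by (rule radial_algebra.add; rule radial_algebra.mult) (use mult * in auto)
    ultimately show ?case
      by (intro exI[of _ "\<lambda>x h. f x * g' x h + f' x h * g x"]) simp
  qed
qed

definition laplacian :: "(real^'n \<Rightarrow> complex) \<Rightarrow> real^'n \<Rightarrow> complex" where
  "laplacian \<phi> x = (\<Sum>i\<in>UNIV. partial_derivs [i, i] \<phi> x)"

definition radial_quotient :: "(real \<Rightarrow> complex) \<Rightarrow> real^3 \<Rightarrow> real^3 \<Rightarrow> complex" where
  "radial_quotient g y x = g (norm (x - y)) / of_real (norm (x - y))"

lemma radial_quotient_test_function:
  assumes "a > 0" "smooth_real g" "\<And>r. r < a \<Longrightarrow> g r = 0" "\<And>r. r > b \<Longrightarrow> g r = 0"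
  shows "radial_quotient g y \<in> test_functions"
proof -
  obtain m :: "real \<Rightarrow> complex" where m: "smooth_real m" "\<And>r. r \<ge> a \<Longrightarrow> m r = 1 / of_real r"
    using smooth_reciprocal[OF assms(1)] by blast
  have q: "g r / of_real r = g r * m r" for r
    by (cases "r < a") (simp_all add: assms(3) m(2))
  have "(\<lambda>x. g (norm (x - y)) * m (norm (x - y))) \<in> radial_algebra y a"
    by (rule radial_algebra.radial[of "\<lambda>r. g r * m r"])
      (simp_all add: assms smooth_real_mult m(1))
  then have "smooth (radial_quotient g y)"
    using radial_algebra_smooth[OF _ assms(1)] by (simp add: radial_quotient_def[abs_def] q)
  moreover have "{x. radial_quotient g y x \<noteq> 0} \<subseteq> cball y b"
    using assms(4) by (force simp: radial_quotient_def dist_norm norm_minus_commute)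
  then have "compact (closure {x. radial_quotient g y x \<noteq> 0})"
    unfolding compact_closure using bounded_cball bounded_subset by blast
  ultimately show ?thesis
    by (simp add: test_functions_def)
qed

text \<open>
  In three dimensions the substitution \<open>\<phi> = g / r\<close> turns the radial Laplacian into the
  ordinary second derivative of \<open>g\<close>.
\<close>

lemma laplacian_radial_quotient:
  assumes a: "a > 0" "\<And>r. r < a \<Longrightarrow> g r = 0"
    and g': "\<And>r. (g has_vector_derivative g' r) (at r)"
    and g'': "\<And>r. (g' has_vector_derivative g'' r) (at r)"
  shows "laplacian (radial_quotient g y) x = radial_quotient g'' y x"
proof -
  define q where "q r = g' r / of_real r ^ 2 - g r / of_real r ^ 3" for r
  define q' where "q' r = g'' r / of_real r ^ 2 - 3 * g' r / of_real r ^ 3 + 3 * g r / of_real r ^ 4" for r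
  have g'0: "g' r = 0" if "r < a" for r
    using vector_derivative_eq_0[OF that a(2) g'] .
  have g''0: "g'' r = 0" if "r < a" for r
    using vector_derivative_eq_0[OF that g'0 g''] .
  have inv: "((\<lambda>r. inverse (of_real r) ^ n :: complex) has_vector_derivative
      - of_nat n * inverse (of_real r) ^ (n + 1)) (at r)" if "r > 0" for r n
  proof -
    have "((\<lambda>z::complex. inverse z ^ n) has_field_derivative - of_nat n * inverse (of_real r) ^ (n + 1))
        (at (of_real r))"
    proof (cases n)
      case (Suc m)
      have "((\<lambda>z::complex. inverse z ^ Suc m) has_field_derivative
          (1 + of_nat m) * (- (inverse (of_real r) ^ Suc (Suc 0)) * inverse (of_real r) ^ m))
          (at (of_real r))"
        using that by (intro DERIV_power_Suc DERIV_inverse) auto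
      moreover have "(1 + of_nat m) * (- (inverse (of_real r) ^ Suc (Suc 0)) * inverse (of_real r) ^ m) =
          - of_nat n * inverse (complex_of_real r) ^ (n + 1)"
        by (simp add: Suc algebra_simps)
      ultimately show ?thesis
        by (simp only: Suc)
    qed simp
    from has_vector_derivative_real_field[OF this] show ?thesis .
  qed
  have d1: "((\<lambda>r. g r / of_real r) has_vector_derivative of_real r * q r) (at r)" if "r > 0" for r
  proof -
    have "((\<lambda>r. g r * inverse (of_real r) ^ 1) has_vector_derivative
        g r * (- of_nat 1 * inverse (of_real r) ^ (1 + 1)) + g' r * inverse (of_real r) ^ 1) (at r)"
      by (rule has_vector_derivative_mult[OF g' inv[OF that]])
    also have "g r * (- of_nat 1 * inverse (of_real r) ^ (1 + 1)) + g' r * inverse (of_real r) ^ 1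
        = of_real r * q r"
      using that by (simp add: q_def field_simps power2_eq_square power3_eq_cube)
    finally show ?thesis
      by (simp add: divide_inverse)
  qed
  have d2: "(q has_vector_derivative q' r) (at r)" if "r > 0" for r
  proof -
    have "((\<lambda>r. g' r * inverse (of_real r) ^ 2 - g r * inverse (of_real r) ^ 3) has_vector_derivative
        (g' r * (- of_nat 2 * inverse (of_real r) ^ (2 + 1)) + g'' r * inverse (of_real r) ^ 2) -
        (g r * (- of_nat 3 * inverse (of_real r) ^ (3 + 1)) + g' r * inverse (of_real r) ^ 3)) (at r)"
      by (intro has_vector_derivative_diff has_vector_derivative_mult g' g'' inv that)
    also have "(g' r * (- of_nat 2 * inverse (of_real r) ^ (2 + 1)) + g'' r * inverse (of_real r) ^ 2) -
        (g r * (- of_nat 3 * inverse (of_real r) ^ (3 + 1)) + g' r * inverse (of_real r) ^ 3) = q' r"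
      using that by (simp add: q'_def field_simps eval_nat_numeral)
    finally show ?thesis
      by (simp add: q_def[abs_def] divide_inverse power_inverse)
  qed
  let ?r = "\<lambda>x. norm (x - y)"
  have "radial_quotient g y = (\<lambda>x. (\<lambda>r. g r / of_real r) (norm (x - y)))"
    by (simp add: radial_quotient_def[abs_def])
  moreover have "((\<lambda>x. (\<lambda>r. g r / of_real r) (norm (x - y))) has_derivative
           (\<lambda>h. of_real (h \<bullet> (x - y)) * ((of_real (?r x) * q (?r x)) / of_real (?r x)))) (at x)" for x
    by (rule has_derivative_radial[OF a(1) d1]) (simp_all add: a)
  ultimately have "(radial_quotient g y has_derivative
      (\<lambda>h. of_real (h \<bullet> (x - y)) * ((of_real (?r x) * q (?r x)) / of_real (?r x)))) (at x)" for x
    by simp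
  from partial_deriv_eq[OF this] have p0: "partial_deriv i (radial_quotient g y) x =
      of_real (x $ i - y $ i) * ((of_real (?r x) * q (?r x)) / of_real (?r x))" for i x
    by (simp add: axis_inner)
  have "partial_deriv i (radial_quotient g y) x = of_real (x $ i - y $ i) * q (?r x)" for i x
    by (cases "x = y") (simp_all add: p0)
  then have p1: "partial_deriv i (radial_quotient g y) = (\<lambda>x. of_real (x $ i - y $ i) * q (?r x))" for i
    by (rule ext)
  have hq: "((\<lambda>x. q (?r x)) has_derivative (\<lambda>h. of_real (h \<bullet> (x - y)) * (q' (?r x) / of_real (?r x)))) (at x)" for x
    by (rule has_derivative_radial[OF a(1) d2]) (simp_all add: a g'0 q_def)
  have "((\<lambda>x. of_real (x $ i - y $ i) :: complex) has_derivative (\<lambda>h. of_real (h $ i))) (at x)" for x i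
    by (rule has_derivative_of_real)
      (auto intro!: derivative_eq_intros bounded_linear.has_derivative[OF bounded_linear_vec_nth])
  note hc = has_derivative_mult[OF this hq]
  have p2: "partial_derivs [i, i] (radial_quotient g y) x =
      of_real (x $ i - y $ i) ^ 2 * (q' (?r x) / of_real (?r x)) + q (?r x)" for i
    unfolding partial_derivs_Cons partial_derivs_Nil p1 partial_deriv_eq[OF hc]
    by (simp add: axis_inner power2_eq_square)
  have "(\<Sum>i\<in>UNIV. of_real (x $ i - y $ i) ^ 2) = (of_real (?r x) ^ 2 :: complex)"
  proof -
    have "(\<Sum>i\<in>UNIV. (x $ i - y $ i) ^ 2) = ?r x ^ 2"
      by (simp add: norm_eq_sqrt_inner inner_vec_def power2_eq_square sum_nonneg)
    then show ?thesis
      by (metis (no_types, lifting) of_real_power of_real_sum sum.cong)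
  qed
  then have "laplacian (radial_quotient g y) x =
      of_real (?r x) ^ 2 * (q' (?r x) / of_real (?r x)) + 3 * q (?r x)"
    unfolding laplacian_def p2 sum.distrib sum_distrib_right[symmetric] by simp
  also have "\<dots> = radial_quotient g'' y x"
  proof (cases "?r x < a")
    case True
    then show ?thesis
      by (simp add: radial_quotient_def q_def q'_def a g'0 g''0)
  next
    case False
    with a have "of_real (?r x) \<noteq> (0 :: complex)"
      by auto
    then show ?thesis
      unfolding radial_quotient_def q_def q'_def
      by (simp add: divide_simps) (simp add: algebra_simps eval_nat_numeral)
  qed
  finally show ?thesis .
qed

section \<open>Integration in three dimensions\<close>

text \<open>Polar coordinates for radial functions: balls determine the distribution of the radius.\<close>

lemma distr_lborel_norm:
  "distr lborel borel (norm :: real^3 \<Rightarrow> real) = density lborel (\<lambda>r. ennreal (4 * pi * r\<^sup>2) * indicator {0..} r)"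
    (is "?M = ?N")
proof (rule measure_eqI_generator_eq[where E = "range (\<lambda>a::real. {..a})" and \<Omega> = UNIV and A = "\<lambda>i. {..real i}"])
  show "Int_stable (range (\<lambda>a::real. {..a}))"
    by (auto simp: Int_stable_def Int_atMost)
  show "(\<Union>i. {..real i}) = UNIV"
    using real_arch_simple by (auto simp: set_eq_iff)
  have M: "emeasure ?M {..a} = ennreal (if a \<ge> 0 then 4/3 * pi * a ^ 3 else 0)" for a
  proof (cases "a \<ge> 0")
    case True
    have "emeasure ?M {..a} = emeasure lborel (cball (0::real^3) a)"
      by (subst emeasure_distr) (auto intro!: arg_cong[where f = "emeasure lborel"])
    also have "\<dots> = ennreal (4/3 * pi * a ^ 3)"
      using True by (subst emeasure_cball) (auto simp: unit_ball_vol_3)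
    finally show ?thesis
      using True by simp
  next
    case False
    then have "(norm :: real^3 \<Rightarrow> real) -` {..a} = {}"
      by (auto simp: set_eq_iff not_le intro: less_le_trans[OF _ norm_ge_zero])
    with False show ?thesis
      by (simp add: emeasure_distr)
  qed
  show "emeasure ?M {..real i} \<noteq> \<infinity>" for i
    by (simp add: M)
  show "emeasure ?M X = emeasure ?N X" if "X \<in> range (\<lambda>a::real. {..a})" for X
  proof -
    from that obtain a where X: "X = {..a}"
      by blast
    have "emeasure ?N X = (\<integral>\<^sup>+r. ennreal (4 * pi * r\<^sup>2) * indicator {0..a} r \<partial>lborel)"
      unfolding X by (subst emeasure_density) (auto intro!: nn_integral_cong simp: indicator_def)
    also have "\<dots> = ennreal (if a \<ge> 0 then 4/3 * pi * a ^ 3 else 0)"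
    proof (cases "a \<ge> 0")
      case True
      have "(\<integral>\<^sup>+r. ennreal (4 * pi * r\<^sup>2) * indicator {0..a} r \<partial>lborel) =
          ennreal (4/3 * pi * a ^ 3 - 4/3 * pi * 0 ^ 3)"
        using True by (intro nn_integral_FTC_Icc) (auto intro!: derivative_eq_intros)
      with True show ?thesis
        by simp
    qed simp
    finally show ?thesis
      by (simp add: X M)
  qed
qed (auto simp: borel_eq_atMost)

lemma nn_integral_radial:
  assumes [measurable]: "q \<in> borel_measurable borel"
  shows "(\<integral>\<^sup>+x. q (norm (x :: real^3)) \<partial>lborel) = (\<integral>\<^sup>+r. ennreal (4 * pi * r\<^sup>2) * indicator {0..} r * q r \<partial>lborel)"
proof -
  have "(\<integral>\<^sup>+x. q (norm (x :: real^3)) \<partial>lborel) = (\<integral>\<^sup>+r. q r \<partial>distr lborel borel (norm :: real^3 \<Rightarrow> real))"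
    by (subst nn_integral_distr) auto
  also have "\<dots> = (\<integral>\<^sup>+r. ennreal (4 * pi * r\<^sup>2) * indicator {0..} r * q r \<partial>lborel)"
    unfolding distr_lborel_norm by (subst nn_integral_density) auto
  finally show ?thesis .
qed

lemma integral_radial:
  fixes q :: "real \<Rightarrow> real"
  assumes [measurable]: "q \<in> borel_measurable borel"
  shows "(\<integral>x. q (norm (x :: real^3)) \<partial>lborel) = (\<integral>r. (4 * pi * r\<^sup>2 * indicator {0..} r) * q r \<partial>lborel)"
proof -
  have "(\<integral>x. q (norm (x :: real^3)) \<partial>lborel) = (\<integral>r. q r \<partial>distr lborel borel (norm :: real^3 \<Rightarrow> real))"
    by (subst integral_distr) auto
  also have "distr lborel borel (norm :: real^3 \<Rightarrow> real) =
      density lborel (\<lambda>r. ennreal (4 * pi * r\<^sup>2 * indicator {0..} r))"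
    unfolding distr_lborel_norm by (intro density_cong) (auto simp: indicator_def)
  also have "(\<integral>r. q r \<partial>\<dots>) = (\<integral>r. (4 * pi * r\<^sup>2 * indicator {0..} r) * q r \<partial>lborel)"
    by (subst integral_real_density) auto
  finally show ?thesis .
qed

lemma nn_integral_lborel_shift:
  fixes y :: "'a::euclidean_space"
  assumes [measurable]: "f \<in> borel_measurable borel"
  shows "(\<integral>\<^sup>+x. f (x - y) \<partial>lborel) = (\<integral>\<^sup>+x. f x \<partial>lborel)"
proof -
  have "(\<integral>\<^sup>+x. f x \<partial>lborel) = (\<integral>\<^sup>+x. f x \<partial>distr lborel borel ((+) (- y)))"
    by (simp add: lborel_distr_plus)
  also have "\<dots> = (\<integral>\<^sup>+x. f (x - y) \<partial>lborel)"
    by (subst nn_integral_distr) (auto simp: add.commute)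
  finally show ?thesis ..
qed

lemma integral_lborel_shift:
  fixes y :: "'a::euclidean_space" and f :: "'a \<Rightarrow> 'b::{banach, second_countable_topology}"
  assumes [measurable]: "f \<in> borel_measurable borel"
  shows "(\<integral>x. f (x - y) \<partial>lborel) = (\<integral>x. f x \<partial>lborel)"
proof -
  have "(\<integral>x. f x \<partial>lborel) = (\<integral>x. f x \<partial>distr lborel borel ((+) (- y)))"
    by (simp add: lborel_distr_plus)
  also have "\<dots> = (\<integral>x. f (x - y) \<partial>lborel)"
    by (subst integral_distr) (auto simp: add.commute)
  finally show ?thesis ..
qed

subsection \<open>Lebesgue points\<close>

lemma cball_borel [measurable]: "cball z r \<in> sets borel"
  and cbox_borel [measurable]: "cbox a b \<in> sets borel"
  by simp_all

text \<open>
  The counterpart of local integrability for the uncompleted measure, on which Fubini's theorem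
  and translations work without measurability problems.
\<close>

definition locally_summable :: "('a::euclidean_space \<Rightarrow> 'b::euclidean_space) \<Rightarrow> bool" where
  "locally_summable f \<longleftrightarrow> f \<in> borel_measurable borel \<and>
     (\<forall>R. (\<integral>\<^sup>+x. ennreal (norm (f x)) * indicator (cball 0 R) x \<partial>lborel) < \<infinity>)"

lemma locally_summable_set_integrable:
  fixes f :: "'a::euclidean_space \<Rightarrow> 'b::euclidean_space"
  assumes f: "locally_summable f" and "bounded A" and [measurable]: "A \<in> sets borel"
  shows "set_integrable lborel A (\<lambda>x. norm (f x - c))"
proof -
  have [measurable]: "f \<in> borel_measurable borel"
    using f by (simp add: locally_summable_def)
  from \<open>bounded A\<close> obtain R where R: "A \<subseteq> cball 0 R"
    by (auto simp: bounded_iff subset_iff)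
  have "(\<integral>\<^sup>+x. ennreal (norm (f x)) * indicator (cball 0 R) x \<partial>lborel) < \<infinity>"
    using f by (simp add: locally_summable_def)
  moreover have "(\<integral>\<^sup>+x. ennreal (norm c) * indicator (cball (0::'a) R) x \<partial>lborel) < \<infinity>"
    using emeasure_lborel_cball_finite[of "0 :: 'a" R]
    by (subst nn_integral_cmult_indicator) (auto simp: ennreal_mult_less_top)
  ultimately have "(\<integral>\<^sup>+x. ennreal (norm (f x)) * indicator (cball 0 R) x +
      ennreal (norm c) * indicator (cball 0 R) x \<partial>lborel) < \<infinity>"
    by (subst nn_integral_add) auto
  moreover have "(\<integral>\<^sup>+x. ennreal (norm (indicator A x *\<^sub>R norm (f x - c))) \<partial>lborel) \<le>
      (\<integral>\<^sup>+x. ennreal (norm (f x)) * indicator (cball 0 R) x +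
      ennreal (norm c) * indicator (cball 0 R) x \<partial>lborel)"
    using R by (intro nn_integral_mono)
      (auto simp: indicator_def norm_triangle_ineq4 simp flip: ennreal_plus)
  ultimately show ?thesis
    unfolding set_integrable_def integrable_iff_bounded by (auto simp: less_top[symmetric] top_unique)
qed

text \<open>
  Differentiation of the integral of \<open>|f - q|\<close> for all \<open>q\<close> in a countable dense set gives
  Lebesgue points with respect to cubes having the point as their lowest corner.
\<close>

lemma Lebesgue_points_corner:
  fixes f :: "'a::euclidean_space \<Rightarrow> 'b::euclidean_space"
  assumes f: "locally_summable f"
  shows "AE y in lborel. (\<lambda>n. ennreal (real (Suc n) ^ DIM('a)) *
    (\<integral>\<^sup>+x. ennreal (norm (f x - f y)) * indicator (cbox y (y + (1 / real (Suc n)) *\<^sub>R One)) x \<partial>lborel))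
      \<longlonglongrightarrow> 0"
proof -
  obtain D :: "'b set" where D: "countable D" "\<And>X. open X \<Longrightarrow> X \<noteq> {} \<Longrightarrow> \<exists>d\<in>D. d \<in> X"
    by (rule countable_dense_setE) blast
  have int: "(\<lambda>x. norm (f x - q)) integrable_on cbox a b" for q a b
    using locally_summable_set_integrable[OF f, of "cbox a b" q] set_borel_integral_eq_integral(1)
    by (auto simp: bounded_cbox)
  have "\<exists>N. negligible N \<and> (\<forall>y e. y \<notin> N \<longrightarrow> 0 < e \<longrightarrow> (\<exists>d>0. \<forall>h. 0 < h \<and> h < d \<longrightarrow>
      norm (integral (cbox y (y + h *\<^sub>R One)) (\<lambda>x. norm (f x - q)) /\<^sub>R h ^ DIM('a) - norm (f y - q)) < e))" for q
    by (rule integrable_ccontinuous_explicit[of "\<lambda>x. norm (f x - q)", OF int]) blast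
  then obtain N where N: "\<And>q. negligible (N q)"
    "\<And>q y e. y \<notin> N q \<Longrightarrow> 0 < e \<Longrightarrow> \<exists>d>0. \<forall>h. 0 < h \<and> h < d \<longrightarrow>
      norm (integral (cbox y (y + h *\<^sub>R One)) (\<lambda>x. norm (f x - q)) /\<^sub>R h ^ DIM('a) - norm (f y - q)) < e"
    by metis
  have "AE y in lborel. \<forall>q\<in>D. y \<notin> N q"
    using N(1) D(1) by (auto simp: AE_ball_countable negligible_iff_null_sets AE_completion_iff
        intro!: AE_not_in[of _ lebesgue, unfolded AE_completion_iff])
  then show ?thesis
  proof eventually_elim
    case (elim y)
    let ?Q = "\<lambda>n. cbox y (y + (1 / real (Suc n)) *\<^sub>R One)"
    have eq: "(\<integral>\<^sup>+x. ennreal (norm (f x - f y)) * indicator (?Q n) x \<partial>lborel) =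
        ennreal (integral (?Q n) (\<lambda>x. norm (f x - f y)))" for n
    proof -
      have si: "set_integrable lborel (?Q n) (\<lambda>x. norm (f x - f y))"
        by (intro locally_summable_set_integrable[OF f] bounded_cbox) auto
      have "(\<integral>\<^sup>+x. ennreal (norm (f x - f y)) * indicator (?Q n) x \<partial>lborel) =
          (\<integral>\<^sup>+x. ennreal (indicator (?Q n) x *\<^sub>R norm (f x - f y)) \<partial>lborel)"
        by (intro nn_integral_cong) (auto simp: indicator_def)
      also have "\<dots> = ennreal (LINT x:?Q n|lborel. norm (f x - f y))"
        unfolding set_lebesgue_integral_def using si unfolding set_integrable_def
        by (intro nn_integral_eq_integral) auto
      finally show ?thesis
        using set_borel_integral_eq_integral(2)[OF si] by simp
    qed
    have "(\<lambda>n. real (Suc n) ^ DIM('a) * integral (?Q n) (\<lambda>x. norm (f x - f y))) \<longlonglongrightarrow> 0"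
    proof (rule LIMSEQ_I)
      fix e :: real assume "e > 0"
      then obtain q where q: "q \<in> D" "norm (f y - q) < e / 3"
        using D(2)[of "ball (f y) (e / 3)"] by (auto simp: dist_norm)
      from N(2)[of y q "e / 3"] elim q(1) \<open>e > 0\<close> obtain d where d: "d > 0"
        "\<And>h. 0 < h \<Longrightarrow> h < d \<Longrightarrow>
          norm (integral (cbox y (y + h *\<^sub>R One)) (\<lambda>x. norm (f x - q)) /\<^sub>R h ^ DIM('a) - norm (f y - q)) < e / 3"
        by auto
      obtain n0 where n0: "1 / real (Suc n0) < d"
        using d(1) nat_approx_posE by (metis inverse_eq_divide)
      have "norm (real (Suc n) ^ DIM('a) * integral (?Q n) (\<lambda>x. norm (f x - f y))) < e" if "n \<ge> n0" for n
      proof -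
        define h where "h = 1 / real (Suc n)"
        have "h \<le> 1 / real (Suc n0)"
          unfolding h_def using that by (intro frac_le) auto
        with n0 have h: "h > 0" "h < d"
          by (simp_all add: h_def)
        have hn: "real (Suc n) ^ DIM('a) = inverse (h ^ DIM('a))"
          by (simp add: h_def power_one_over)
        have vol: "integral (?Q n) (\<lambda>x. norm (q - f y)) = norm (q - f y) * h ^ DIM('a)"
        proof -
          have "measure lborel (cbox y (y + h *\<^sub>R One)) = (\<Prod>i\<in>(Basis :: 'a set). h)"
            using h(1) by (subst content_cbox) (auto simp: inner_add_left)
          then show ?thesis
            unfolding h_def[symmetric] by simp
        qed
        have "integral (?Q n) (\<lambda>x. norm (f x - f y)) \<le> integral (?Q n) (\<lambda>x. norm (f x - q) + norm (q - f y))"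
        proof (rule integral_le)
          show "(\<lambda>x. norm (f x - q) + norm (q - f y)) integrable_on ?Q n"
            by (rule integrable_add[OF int integrable_const])
          show "norm (f x - f y) \<le> norm (f x - q) + norm (q - f y)" for x
            using norm_triangle_ineq[of "f x - q" "q - f y"] by simp
        qed (rule int)
        also have "\<dots> = integral (?Q n) (\<lambda>x. norm (f x - q)) + norm (q - f y) * h ^ DIM('a)"
          unfolding vol[symmetric] by (rule integral_add[OF int integrable_const])
        finally have "real (Suc n) ^ DIM('a) * integral (?Q n) (\<lambda>x. norm (f x - f y)) \<le>
            integral (?Q n) (\<lambda>x. norm (f x - q)) /\<^sub>R h ^ DIM('a) + norm (q - f y)"
          unfolding hn using h(1) by (simp add: field_simps)
        also have "\<dots> < e"
          using d(2)[OF h] q(2)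
          unfolding h_def[symmetric] norm_minus_commute[of q "f y"] real_norm_def abs_less_iff by linarith
        finally show ?thesis
          by (simp add: integral_nonneg int)
      qed
      then show "\<exists>n0. \<forall>n\<ge>n0. norm (real (Suc n) ^ DIM('a) * integral (?Q n) (\<lambda>x. norm (f x - f y)) - 0) < e"
        by auto
    qed
    then have "(\<lambda>n. ennreal (real (Suc n) ^ DIM('a) * integral (?Q n) (\<lambda>x. norm (f x - f y)))) \<longlonglongrightarrow> ennreal 0"
      by (rule tendsto_ennrealI)
    then show ?case
      unfolding eq by (simp add: ennreal_mult' del: of_nat_Suc)
  qed
qed

definition flip_signs :: "('n \<Rightarrow> bool) \<Rightarrow> real^'n \<Rightarrow> real^'n" where
  "flip_signs s x = (\<chi> i. if s i then x $ i else - x $ i)"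

lemma flip_signs_flip_signs [simp]: "flip_signs s (flip_signs s x) = x"
  by (auto simp: flip_signs_def vec_eq_iff)

lemma norm_flip_signs [simp]: "norm (flip_signs s x) = norm x"
  by (auto simp: norm_eq_sqrt_inner inner_vec_def flip_signs_def intro!: sum.cong)

lemma measurable_flip_signs [measurable]:
  fixes s :: "'n::finite \<Rightarrow> bool"
  shows "flip_signs s \<in> borel \<rightarrow>\<^sub>M borel"
proof -
  have "continuous_on UNIV (\<lambda>x::real^'n. if s i then x $ i else - (x $ i))" for i
  proof -
    have "continuous_on UNIV (\<lambda>x::real^'n. x $ i)"
      by (intro continuous_intros)
    from this continuous_on_minus[OF this] show ?thesis
      by (cases "s i") simp_all
  qed
  then show ?thesis
    unfolding flip_signs_def[abs_def]
    by (intro borel_measurable_continuous_onI continuous_on_vec_lambda)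
qed

lemma distr_flip_signs: "distr lborel borel (flip_signs s) = (lborel :: (real^'n) measure)"
proof -
  define c :: "real^'n \<Rightarrow> real" where "c b = (if s (SOME i. b = axis i 1) then 1 else - 1)" for b
  have c: "c (axis i 1) = (if s i then 1 else -1)" for i
    by (simp add: c_def axis_eq_axis)
  have *: "0 + (\<Sum>j\<in>Basis. (c j * (x \<bullet> j)) *\<^sub>R j) = flip_signs s x" for x
  proof (rule euclidean_eqI)
    fix b :: "real^'n" assume b: "b \<in> Basis"
    then obtain i where i: "b = axis i 1"
      by (auto simp: Basis_vec_def)
    from b have "(0 + (\<Sum>j\<in>Basis. (c j * (x \<bullet> j)) *\<^sub>R j)) \<bullet> b = c b * (x \<bullet> b)"
      by (simp add: inner_sum_left_Basis)
    also have "\<dots> = flip_signs s x \<bullet> b"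
      by (simp add: i c inner_axis flip_signs_def)
    finally show "(0 + (\<Sum>j\<in>Basis. (c j * (x \<bullet> j)) *\<^sub>R j)) \<bullet> b = flip_signs s x \<bullet> b" .
  qed
  have abs: "\<bar>c j\<bar> = 1" for j
    by (simp add: c_def)
  have "(lborel :: (real^'n) measure) = density (distr lborel borel (flip_signs s)) (\<lambda>_. \<Prod>j\<in>(Basis :: (real^'n) set). \<bar>c j\<bar>)"
    unfolding *[symmetric] by (rule lborel_affine_euclidean) (auto simp: c_def)
  then show ?thesis
    by (simp add: abs density_1)
qed

lemma nn_integral_flip_signs:
  assumes [measurable]: "g \<in> borel_measurable borel"
  shows "(\<integral>\<^sup>+x. g (flip_signs s x) \<partial>lborel) = (\<integral>\<^sup>+x. g x \<partial>lborel)"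
  by (subst (2) distr_flip_signs[symmetric, of s], subst nn_integral_distr) auto

lemma ball_subset_flipped_cubes:
  fixes x y :: "real^'n"
  assumes "dist y x \<le> h"
  shows "\<exists>s. flip_signs s x \<in> cbox (flip_signs s y) (flip_signs s y + h *\<^sub>R One)"
proof (intro exI[of _ "\<lambda>i. y $ i \<le> x $ i"])
  have "\<bar>y $ i - x $ i\<bar> \<le> h" for i
    using assms component_le_norm_cart[of "y - x" i] by (simp add: dist_norm)
  then have "y $ i \<le> x $ i + h" "x $ i \<le> y $ i + h" "- x $ i \<le> h - y $ i" for i
    by (simp_all add: abs_le_iff algebra_simps)
  moreover have "(One :: real^'n) $ i = 1" for i
  proof -
    have "(One :: real^'n) \<bullet> axis i 1 = 1"
      using inner_sum_left_Basis[of "axis i 1 :: real^'n" "\<lambda>_. 1"] by (simp add: axis_in_Basis_iff)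
    then show ?thesis
      by (simp only: inner_axis inner_real_def mult_1_right)
  qed
  ultimately show "flip_signs (\<lambda>i. y $ i \<le> x $ i) x \<in> cbox (flip_signs (\<lambda>i. y $ i \<le> x $ i) y)
      (flip_signs (\<lambda>i. y $ i \<le> x $ i) y + h *\<^sub>R One)"
    unfolding mem_box_cart by (simp add: flip_signs_def del: sum_component)
qed

definition Lebesgue_point :: "(real^'n \<Rightarrow> 'b::euclidean_space) \<Rightarrow> real^'n \<Rightarrow> bool" where
  "Lebesgue_point f y \<longleftrightarrow> (\<lambda>n. ennreal (real (Suc n) ^ CARD('n)) *
    (\<integral>\<^sup>+x. ennreal (norm (f x - f y)) * indicator (cball y (1 / real (Suc n))) x \<partial>lborel))
      \<longlonglongrightarrow> 0"

text \<open>
  A ball is covered by cubes which become corner cubes after flipping the signs of coordinates,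
  and flipping signs preserves the measure.
\<close>

lemma AE_Lebesgue_point:
  fixes f :: "real^'n \<Rightarrow> 'b::euclidean_space"
  assumes f: "locally_summable f"
  shows "AE y in lborel. Lebesgue_point f y"
proof -
  have [measurable]: "f \<in> borel_measurable borel"
    using f by (simp add: locally_summable_def)
  define g where "g s x = f (flip_signs s x)" for s x
  have g [measurable]: "g s \<in> borel_measurable borel" for s
    unfolding g_def by measurable
  let ?Q = "\<lambda>n y. cbox y (y + (1 / real (Suc n)) *\<^sub>R One) :: (real^'n) set"
  define P where "P s n y = ennreal (real (Suc n) ^ CARD('n)) *
    (\<integral>\<^sup>+x. ennreal (norm (g s x - g s y)) * indicator (?Q n y) x \<partial>lborel)" for s n y
  have "AE y in lborel. (\<lambda>n. P s n (flip_signs s y)) \<longlonglongrightarrow> 0" for s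
  proof -
    have "(\<integral>\<^sup>+x. ennreal (norm (g s x)) * indicator (cball 0 R) x \<partial>lborel) =
        (\<integral>\<^sup>+x. (\<lambda>x. ennreal (norm (f x)) * indicator (cball 0 R) x) (flip_signs s x) \<partial>lborel)" for R
      by (intro nn_integral_cong) (auto simp: g_def indicator_def)
    also have "\<dots> R = (\<integral>\<^sup>+x. ennreal (norm (f x)) * indicator (cball 0 R) x \<partial>lborel)" for R
      by (rule nn_integral_flip_signs) measurable
    finally have "locally_summable (g s)"
      using f by (simp add: locally_summable_def)
    from Lebesgue_points_corner[OF this]
    have "AE y in lborel. (\<lambda>n. P s n y) \<longlonglongrightarrow> 0"
      by (simp add: P_def)
    then have "AE y in distr lborel borel (flip_signs s). (\<lambda>n. P s n y) \<longlonglongrightarrow> 0"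
      unfolding distr_flip_signs .
    then show ?thesis
      by (rule AE_distrD[rotated]) measurable
  qed
  then have "AE y in lborel. \<forall>s. (\<lambda>n. P s n (flip_signs s y)) \<longlonglongrightarrow> 0"
    by (subst AE_all_countable) auto
  then show ?thesis
  proof eventually_elim
    case (elim y)
    have "(\<lambda>n. \<Sum>s\<in>UNIV. P s n (flip_signs s y)) \<longlonglongrightarrow> (\<Sum>s\<in>(UNIV :: ('n \<Rightarrow> bool) set). 0)"
      using elim by (intro tendsto_sum) auto
    then have lim: "(\<lambda>n. \<Sum>s\<in>UNIV. P s n (flip_signs s y)) \<longlonglongrightarrow> 0"
      by simp
    have "ennreal (real (Suc n) ^ CARD('n)) *
        (\<integral>\<^sup>+x. ennreal (norm (f x - f y)) * indicator (cball y (1 / real (Suc n))) x \<partial>lborel)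
      \<le> (\<Sum>s\<in>UNIV. P s n (flip_signs s y))" for n
    proof -
      let ?F = "\<lambda>s x. ennreal (norm (g s x - g s (flip_signs s y))) * indicator (?Q n (flip_signs s y)) x"
      have "(\<integral>\<^sup>+x. ennreal (norm (f x - f y)) * indicator (cball y (1 / real (Suc n))) x \<partial>lborel)
        \<le> (\<integral>\<^sup>+x. (\<Sum>s\<in>UNIV. ?F s (flip_signs s x)) \<partial>lborel)"
      proof (rule nn_integral_mono)
        fix x
        show "ennreal (norm (f x - f y)) * indicator (cball y (1 / real (Suc n))) x
          \<le> (\<Sum>s\<in>UNIV. ?F s (flip_signs s x))"
        proof (cases "x \<in> cball y (1 / real (Suc n))")
          case True
          then obtain s where s: "flip_signs s x \<in> ?Q n (flip_signs s y)"
            using ball_subset_flipped_cubes[of y x "1 / real (Suc n)"] by auto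
          then have "ennreal (norm (f x - f y)) = ?F s (flip_signs s x)"
            by (simp add: g_def)
          also have "\<dots> \<le> (\<Sum>s\<in>UNIV. ?F s (flip_signs s x))"
            by (rule member_le_sum[of s UNIV "\<lambda>s. ?F s (flip_signs s x)"]) auto
          finally show ?thesis
            using True by simp
        qed simp
      qed
      also have "\<dots> = (\<Sum>s\<in>UNIV. \<integral>\<^sup>+x. ?F s (flip_signs s x) \<partial>lborel)"
        by (rule nn_integral_sum) measurable
      also have "\<dots> = (\<Sum>s\<in>UNIV. \<integral>\<^sup>+x. ?F s x \<partial>lborel)"
        by (intro sum.cong refl nn_integral_flip_signs) measurable
      finally show ?thesis
        unfolding P_def sum_distrib_left[symmetric] by (rule mult_left_mono) simp
    qed
    then show ?case
      unfolding Lebesgue_point_def by (intro tendsto_sandwich[OF _ _ tendsto_const lim]) auto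
  qed
qed

section \<open>The fundamental solution of the Helmholtz operator\<close>

lemma integrable_times_radial:
  fixes f :: "real^3 \<Rightarrow> complex" and K :: "real \<Rightarrow> complex"
  assumes f: "locally_summable f" and [measurable]: "K \<in> borel_measurable borel"
    and bound: "\<And>r. r \<ge> 0 \<Longrightarrow> norm (K r) \<le> B" and supp: "\<And>r. r > R \<Longrightarrow> K r = 0"
  shows "integrable lborel (\<lambda>x. (f x - c) * K (norm (x - y)))"
proof (rule Bochner_Integration.integrable_bound)
  have [measurable]: "f \<in> borel_measurable borel"
    using f by (simp add: locally_summable_def)
  have B: "B \<ge> 0"
    using order_trans[OF norm_ge_zero bound[of 0]] by simp
  have "set_integrable lborel (cball y R) (\<lambda>x. norm (f x - c))"
    by (rule locally_summable_set_integrable[OF f]) auto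
  then show "integrable lborel (\<lambda>x. B * (norm (f x - c) * indicator (cball y R) x))"
    unfolding set_integrable_def by (auto simp: mult.commute)
  show "AE x in lborel. norm ((f x - c) * K (norm (x - y))) \<le>
      norm (B * (norm (f x - c) * indicator (cball y R) x))"
  proof (rule AE_I2)
    fix x
    show "norm ((f x - c) * K (norm (x - y))) \<le> norm (B * (norm (f x - c) * indicator (cball y R) x))"
    proof (cases "x \<in> cball y R")
      case True
      then show ?thesis
        using mult_right_mono[OF bound[of "norm (x - y)"], of "norm (f x - c)"] B
        by (simp add: norm_mult abs_mult mult.commute)
    next
      case False
      then have "K (norm (x - y)) = 0"
        by (intro supp) (simp add: dist_norm norm_minus_commute)
      then show ?thesis
        by simp
    qed
  qed
  show "(\<lambda>x. (f x - c) * K (norm (x - y))) \<in> borel_measurable lborel"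
    by measurable
qed

lemma locally_summable_const: "locally_summable (\<lambda>_ :: 'a::euclidean_space. c)"
  unfolding locally_summable_def
proof (intro conjI allI)
  fix R
  have "(\<integral>\<^sup>+x. ennreal (norm c) * indicator (cball (0::'a) R) x \<partial>lborel) =
      ennreal (norm c) * emeasure lborel (cball (0::'a) R)"
    by (rule nn_integral_cmult_indicator) simp
  also have "\<dots> < \<infinity>"
    using emeasure_lborel_cball_finite[of "0::'a" R] by (simp add: ennreal_mult_less_top)
  finally show "(\<integral>\<^sup>+x. ennreal (norm c) * indicator (cball (0::'a) R) x \<partial>lborel) < \<infinity>" .
qed simp

text \<open>
  A kernel of size \<open>N\<^sup>3\<close> on a ball of radius \<open>1 / N\<close> integrates \<open>f - f(y)\<close> to at most a multiple of
  its mean oscillation near \<open>y\<close>.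
\<close>

lemma mollification_at_Lebesgue_point:
  fixes f :: "real^3 \<Rightarrow> complex" and K :: "nat \<Rightarrow> real \<Rightarrow> complex"
  assumes f: "locally_summable f"
    and [measurable]: "\<And>n. K n \<in> borel_measurable borel"
    and K_bound: "\<And>n r. r \<ge> 0 \<Longrightarrow> norm (K n r) \<le> C * real (Suc n) ^ 3"
    and K_supp: "\<And>n r. r > 1 / real (Suc n) \<Longrightarrow> K n r = 0"
    and K_mass: "(\<lambda>n. \<integral>x. K n (norm (x :: real^3)) \<partial>lborel) \<longlonglongrightarrow> 1"
    and y: "Lebesgue_point f y"
  shows "integrable lborel (\<lambda>x. f x * K n (norm (x - y)))"
    and "(\<lambda>n. \<integral>x. f x * K n (norm (x - y)) \<partial>lborel) \<longlonglongrightarrow> f y"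
proof -
  have [measurable]: "f \<in> borel_measurable borel"
    using f by (simp add: locally_summable_def)
  have C: "C \<ge> 0"
    using order_trans[OF norm_ge_zero K_bound[of 0 0]] by simp
  have bound: "norm (g x * K n (norm (x - y))) \<le>
      C * real (Suc n) ^ 3 * (norm (g x) * indicator (cball y (1 / real (Suc n))) x)"
    for g :: "real^3 \<Rightarrow> complex" and x n
  proof (cases "x \<in> cball y (1 / real (Suc n))")
    case True
    then show ?thesis
      using mult_right_mono[OF K_bound[of "norm (x - y)" n], of "norm (g x)"]
      by (simp add: norm_mult mult.commute mult.left_commute)
  next
    case False
    then have "K n (norm (x - y)) = 0"
      by (intro K_supp) (simp add: dist_norm norm_minus_commute)
    with False show ?thesis
      by simp
  qed
  have int: "integrable lborel (\<lambda>x. (f x - c) * K n (norm (x - y)))" for c n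
    by (rule integrable_times_radial[OF f _ K_bound K_supp]) auto
  show "integrable lborel (\<lambda>x. f x * K n (norm (x - y)))"
    using int[of 0] by simp
  let ?A = "\<lambda>n. \<integral>\<^sup>+x. ennreal (norm (f x - f y)) * indicator (cball y (1 / real (Suc n))) x \<partial>lborel"
  have est: "ennreal (norm (\<integral>x. (f x - f y) * K n (norm (x - y)) \<partial>lborel)) \<le>
      ennreal C * (ennreal (real (Suc n) ^ 3) * ?A n)" for n
  proof -
    have "ennreal (norm (\<integral>x. (f x - f y) * K n (norm (x - y)) \<partial>lborel)) \<le>
        (\<integral>\<^sup>+x. norm ((f x - f y) * K n (norm (x - y))) \<partial>lborel)"
      by (rule integral_norm_bound_ennreal[OF int])
    also have "\<dots> \<le> (\<integral>\<^sup>+x. ennreal (C * real (Suc n) ^ 3) *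
        (ennreal (norm (f x - f y)) * indicator (cball y (1 / real (Suc n))) x) \<partial>lborel)"
    proof (rule nn_integral_mono)
      fix x
      have "ennreal (norm ((f x - f y) * K n (norm (x - y)))) \<le> ennreal (C * real (Suc n) ^ 3 *
        (norm (f x - f y) * indicator (cball y (1 / real (Suc n))) x))"
        by (rule ennreal_leI) (rule bound[of "\<lambda>x. f x - f y"])
      also have "\<dots> = ennreal (C * real (Suc n) ^ 3) *
        (ennreal (norm (f x - f y)) * indicator (cball y (1 / real (Suc n))) x)"
        using ennreal_mult[of "C * real (Suc n) ^ 3" "norm (f x - f y)"] C
        by (simp add: indicator_def del: of_nat_Suc)
      finally show "ennreal (norm ((f x - f y) * K n (norm (x - y)))) \<le> \<dots>" .
    qed
    also have "\<dots> = ennreal C * (ennreal (real (Suc n) ^ 3) * ?A n)"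
      using C by (subst nn_integral_cmult) (auto simp: ennreal_mult mult.assoc)
    finally show ?thesis .
  qed
  have lim: "(\<lambda>n. ennreal C * (ennreal (real (Suc n) ^ 3) * ?A n)) \<longlonglongrightarrow> 0"
    using ennreal_tendsto_cmult[OF ennreal_less_top y[unfolded Lebesgue_point_def], of C] by simp
  have "(\<lambda>n. ennreal (norm (\<integral>x. (f x - f y) * K n (norm (x - y)) \<partial>lborel))) \<longlonglongrightarrow> 0"
    by (rule tendsto_sandwich[OF _ _ tendsto_const lim]) (simp_all add: est del: of_nat_Suc)
  then have "(\<lambda>n. ennreal (norm (\<integral>x. (f x - f y) * K n (norm (x - y)) \<partial>lborel))) \<longlonglongrightarrow> ennreal 0"
    by simp
  then have "(\<lambda>n. norm (\<integral>x. (f x - f y) * K n (norm (x - y)) \<partial>lborel)) \<longlonglongrightarrow> 0"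
    by (rule tendsto_ennrealD) auto
  then have lim0: "(\<lambda>n. \<integral>x. (f x - f y) * K n (norm (x - y)) \<partial>lborel) \<longlonglongrightarrow> 0"
    by (rule tendsto_norm_zero_cancel)
  have K_int: "integrable lborel (\<lambda>x. K n (norm (x - y)))" for n
    using integrable_times_radial[OF locally_summable_const[of 1], of "K n" "C * real (Suc n) ^ 3"
        "1 / real (Suc n)" 0 y] K_bound K_supp by simp
  have split: "(\<integral>x. f x * K n (norm (x - y)) \<partial>lborel) =
      (\<integral>x. (f x - f y) * K n (norm (x - y)) \<partial>lborel) + f y * (\<integral>x. K n (norm (x :: real^3)) \<partial>lborel)" for n
  proof -
    have "(\<integral>x. f x * K n (norm (x - y)) \<partial>lborel) =
        (\<integral>x. (f x - f y) * K n (norm (x - y)) + f y * K n (norm (x - y)) \<partial>lborel)"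
      by (intro Bochner_Integration.integral_cong) (auto simp: algebra_simps)
    also have "\<dots> = (\<integral>x. (f x - f y) * K n (norm (x - y)) \<partial>lborel) +
        f y * (\<integral>x. K n (norm (x - y)) \<partial>lborel)"
      by (subst Bochner_Integration.integral_add) (auto intro: int K_int integrable_mult_right)
    also have "(\<integral>x. K n (norm (x - y)) \<partial>lborel) = (\<integral>x. K n (norm (x :: real^3)) \<partial>lborel)"
      by (rule integral_lborel_shift[of "\<lambda>x. K n (norm x)"]) measurable
    finally show ?thesis .
  qed
  have "(\<lambda>n. (\<integral>x. (f x - f y) * K n (norm (x - y)) \<partial>lborel) +
      f y * (\<integral>x. K n (norm (x :: real^3)) \<partial>lborel)) \<longlonglongrightarrow> 0 + f y * 1"
    by (intro tendsto_intros lim0 K_mass)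
  then show "(\<lambda>n. \<integral>x. f x * K n (norm (x - y)) \<partial>lborel) \<longlonglongrightarrow> f y"
    by (simp add: split)
qed

lemma measurable_smooth_step [measurable]:
  "smooth_step \<in> borel_measurable borel" "smooth_step' \<in> borel_measurable borel"
  "smooth_step'' \<in> borel_measurable borel"
proof -
  have "continuous_on UNIV smooth_step"
    using smooth_step_derivatives(1) by (intro continuous_at_imp_continuous_on ballI) (rule DERIV_isCont)
  then show "smooth_step \<in> borel_measurable borel" "smooth_step' \<in> borel_measurable borel"
    "smooth_step'' \<in> borel_measurable borel"
    using smooth_step_derivatives(3,4) by (auto intro!: borel_measurable_continuous_onI)
qed

text \<open>
  As a function of the distance this is \<open>- \<Delta>\<close> applied to \<open>smooth_step (N r) / (4 \<pi> r)\<close>, a smoothed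
  Newton potential.
\<close>

definition mollifier :: "real \<Rightarrow> real \<Rightarrow> real" where
  "mollifier N r = - (N\<^sup>2 * smooth_step'' (N * r) / (4 * pi * r))"

lemma measurable_mollifier [measurable]: "mollifier N \<in> borel_measurable borel"
  unfolding mollifier_def[abs_def] by measurable

lemma mollifier_eq_0: "N > 0 \<Longrightarrow> r < 1 / (2 * N) \<or> r > 1 / N \<Longrightarrow> mollifier N r = 0"
  using smooth_step_derivatives_eq_0(2)[of "N * r"] by (simp add: mollifier_def field_simps)

lemma mollifier_bound:
  assumes "N > 0" "\<And>x. \<bar>smooth_step'' x\<bar> \<le> M"
  shows "\<bar>mollifier N r\<bar> \<le> M / (2 * pi) * N ^ 3"
proof (cases "r < 1 / (2 * N)")
  case True
  have "M \<ge> 0"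
    using assms(2)[of 0] by linarith
  with True assms(1) show ?thesis
    by (simp add: mollifier_eq_0)
next
  case False
  with assms(1) have r: "r \<ge> 1 / (2 * N)" "r > 0"
    by (auto simp: not_less intro: less_le_trans[of 0 "1 / (2 * N)"])
  have "\<bar>mollifier N r\<bar> = (N\<^sup>2 / (4 * pi)) * (\<bar>smooth_step'' (N * r)\<bar> * (1 / r))"
    using assms(1) r by (simp add: mollifier_def abs_mult)
  also have "\<dots> \<le> (N\<^sup>2 / (4 * pi)) * (M * (2 * N))"
  proof (intro mult_left_mono mult_mono)
    show "1 / r \<le> 2 * N"
      using r assms(1) by (simp add: field_simps)
  qed (use assms r in \<open>auto intro: order_trans[OF abs_ge_zero]\<close>)
  also have "\<dots> = M / (2 * pi) * N ^ 3"
    by (simp add: power2_eq_square power3_eq_cube)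
  finally show ?thesis .
qed

text \<open>
  In polar coordinates the mass of the mollifier is \<open>- \<integral> s \<zeta>''(s) ds\<close> with \<open>\<zeta>\<close> the smooth
  step, and \<open>\<zeta> - s \<zeta>'\<close> is an antiderivative of the integrand.
\<close>

lemma integral_mollifier:
  assumes "N > 0"
  shows "(\<integral>x. mollifier N (norm (x :: real^3)) \<partial>lborel) = 1"
proof -
  let ?F = "\<lambda>r. smooth_step (N * r) - N * r * smooth_step' (N * r)"
  let ?F' = "\<lambda>r. - (N\<^sup>2 * r * smooth_step'' (N * r))"
  have "(\<integral>x. mollifier N (norm (x :: real^3)) \<partial>lborel) =
      (\<integral>r. (4 * pi * r\<^sup>2 * indicator {0..} r) * mollifier N r \<partial>lborel)"
    by (rule integral_radial) measurable
  also have "\<dots> = (\<integral>r. ?F' r * indicator {0..2 / N} r \<partial>lborel)"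
  proof (rule Bochner_Integration.integral_cong[OF refl])
    fix r
    show "(4 * pi * r\<^sup>2 * indicator {0..} r) * mollifier N r = ?F' r * indicator {0..2 / N} r"
    proof (cases "r > 1 / N")
      case True
      with assms have "N * r > 1"
        by (simp add: field_simps)
      with True show ?thesis
        using assms by (simp add: mollifier_eq_0 smooth_step_derivatives_eq_0)
    next
      case False
      moreover have "1 / N \<le> 2 / N"
        using assms by (simp add: divide_right_mono)
      ultimately show ?thesis
        by (cases "r = 0") (auto simp: mollifier_def indicator_def power2_eq_square)
    qed
  qed
  also have "\<dots> = ?F (2 / N) - ?F 0"
  proof (rule integral_FTC_Icc_real)
    have "((\<lambda>r. smooth_step (N * r)) has_real_derivative smooth_step' (N * r) * N) (at r)" for r
      by (rule DERIV_chain2[OF smooth_step_derivatives(1)]) (auto intro!: derivative_eq_intros)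
    moreover have "((\<lambda>r. smooth_step' (N * r)) has_real_derivative smooth_step'' (N * r) * N) (at r)" for r
      by (rule DERIV_chain2[OF smooth_step_derivatives(2)]) (auto intro!: derivative_eq_intros)
    ultimately show "(?F has_real_derivative ?F' r) (at r)" for r
      by (auto intro!: derivative_eq_intros simp: power2_eq_square algebra_simps)
    show "isCont ?F' r" if "0 \<le> r" "r \<le> 2 / N" for r
    proof -
      have "isCont smooth_step'' (N * r)"
        using smooth_step_derivatives(4) by (simp add: continuous_on_eq_continuous_at)
      then have "isCont (\<lambda>r. smooth_step'' (N * r)) r"
        by (rule isCont_o2[rotated]) (intro continuous_intros)
      then show ?thesis
        by (intro continuous_intros)
    qed
  qed (use assms in auto)
  also have "\<dots> = 1"
    using assms by (simp add: smooth_step_eq_1 smooth_step_eq_0 smooth_step_derivatives_eq_0)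
  finally show ?thesis .
qed

lemma smooth_smooth_step'': "smooth_real smooth_step''"
proof -
  have *: "smooth_real f'" if "smooth_real f" "\<And>x. (f has_real_derivative f' x) (at x)" for f f' :: "real \<Rightarrow> real"
  proof -
    from that(1) obtain g where g: "smooth_real g" "\<And>x. (f has_vector_derivative g x) (at x)"
      by (rule smooth_real_has_derivative) blast
    have "g = f'"
      using g(2) that(2) by (intro ext) (metis has_real_derivative_iff_has_vector_derivative DERIV_unique)
    with g(1) show ?thesis by simp
  qed
  show ?thesis
    using *[OF *[OF smooth_smooth_step smooth_step_derivatives(1)] smooth_step_derivatives(2)] .
qed

text \<open>
  The mollifiers are test functions with mass 1, so a locally summable function that
  annihilates all test functions vanishes at each of its Lebesgue points.
\<close>

lemma du_Bois_Reymond: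
  fixes f :: "real^3 \<Rightarrow> complex"
  assumes f: "locally_summable f"
    and zero: "\<And>\<phi>. \<phi> \<in> test_functions \<Longrightarrow> (\<integral>x. f x * \<phi> x \<partial>lborel) = 0"
  shows "AE x in lborel. f x = 0"
  using AE_Lebesgue_point[OF f]
proof eventually_elim
  case (elim y)
  obtain M where M: "\<And>x. \<bar>smooth_step'' x\<bar> \<le> M"
    by (rule smooth_step_derivatives_bounded) blast
  let ?K = "\<lambda>n r. complex_of_real (mollifier (real (Suc n)) r)"
  have "(\<lambda>n. \<integral>x. f x * ?K n (norm (x - y)) \<partial>lborel) \<longlonglongrightarrow> f y"
  proof (rule mollification_at_Lebesgue_point(2)[OF f])
    show "norm (?K n r) \<le> M / (2 * pi) * real (Suc n) ^ 3" for n r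
      using mollifier_bound[of "real (Suc n)" M r] M by simp
    show "?K n r = 0" if "r > 1 / real (Suc n)" for n r
      using that mollifier_eq_0[of "real (Suc n)" r] by simp
    show "(\<lambda>n. \<integral>x. ?K n (norm (x :: real^3)) \<partial>lborel) \<longlonglongrightarrow> 1"
      by (simp add: integral_mollifier del: of_nat_Suc)
  qed (use elim in simp_all)
  moreover have "(\<integral>x. f x * ?K n (norm (x - y)) \<partial>lborel) = 0" for n
  proof -
    define N where "N = real (Suc n)"
    have N: "N > 0" by (simp add: N_def)
    define g where "g r = of_real (- (N\<^sup>2 / (4 * pi))) * complex_of_real (smooth_step'' (N * r))" for r
    have "radial_quotient g y \<in> test_functions"
    proof (rule radial_quotient_test_function)
      show "smooth_real g"
        unfolding g_def using smooth_real_affine[OF smooth_smooth_step'', of N 0]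
        by (intro smooth_real_mult smooth_real_const smooth_real_of_real) simp
      show "0 < 1 / (2 * N)"
        using N by simp
      show "g r = 0" if "r < 1 / (2 * N)" for r
        using that N smooth_step_derivatives_eq_0(2)[of "N * r"] by (simp add: g_def field_simps)
      show "g r = 0" if "r > 1 / N" for r
        using that N smooth_step_derivatives_eq_0(2)[of "N * r"] by (simp add: g_def field_simps)
    qed
    from zero[OF this] show ?thesis
      by (simp add: radial_quotient_def g_def mollifier_def N_def[symmetric] del: of_nat_Suc)
  qed
  ultimately have "(\<lambda>n. 0) \<longlonglongrightarrow> f y"
    by simp
  then show ?case
    by (simp add: LIMSEQ_const_iff)
qed


definition square_summable :: "('a::euclidean_space \<Rightarrow> complex) \<Rightarrow> bool" where
  "square_summable f \<longleftrightarrow> f \<in> borel_measurable borel \<and>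
     (\<integral>\<^sup>+x. ennreal ((norm (f x))\<^sup>2) \<partial>lborel) < \<infinity>"

lemma square_summable_imp_locally_summable:
  assumes "square_summable f"
  shows "locally_summable f"
  unfolding locally_summable_def
proof (intro conjI allI)
  show [measurable]: "f \<in> borel_measurable borel"
    using assms by (simp add: square_summable_def)
  fix R
  have "(\<integral>\<^sup>+x. ennreal (norm (f x)) * indicator (cball 0 R) x \<partial>lborel) \<le>
      (\<integral>\<^sup>+x. indicator (cball 0 R) x + ennreal ((norm (f x))\<^sup>2) \<partial>lborel)"
  proof (rule nn_integral_mono)
    fix x
    have "norm (f x) \<le> 1 + (norm (f x))\<^sup>2"
      using sum_squares_ge_zero[of "norm (f x) - 1" 0] by (simp add: power2_eq_square algebra_simps)
        (smt (verit) norm_ge_zero mult_nonneg_nonneg)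
    then have "ennreal (norm (f x)) \<le> 1 + ennreal ((norm (f x))\<^sup>2)"
      by (simp flip: ennreal_plus ennreal_1 add: ennreal_leI)
    then show "ennreal (norm (f x)) * indicator (cball 0 R) x \<le>
        indicator (cball 0 R) x + ennreal ((norm (f x))\<^sup>2)"
      by (simp add: indicator_def)
  qed
  also have "\<dots> = emeasure lborel (cball (0::'a) R) + (\<integral>\<^sup>+x. ennreal ((norm (f x))\<^sup>2) \<partial>lborel)"
    by (subst nn_integral_add) auto
  also have "\<dots> < \<infinity>"
    using assms emeasure_lborel_cball_finite[of "0::'a" R] by (simp add: square_summable_def)
  finally show "(\<integral>\<^sup>+x. ennreal (norm (f x)) * indicator (cball 0 R) x \<partial>lborel) < \<infinity>" .
qed

definition yukawa :: "complex \<Rightarrow> real \<Rightarrow> complex" where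
  "yukawa w r = exp (- (w * of_real r)) / of_real (4 * pi * r)"

lemma measurable_yukawa [measurable]: "yukawa w \<in> borel_measurable borel"
  unfolding yukawa_def[abs_def] by measurable

lemma norm_exp_le_1: "Re w \<ge> 0 \<Longrightarrow> r \<ge> 0 \<Longrightarrow> norm (exp (- (w * complex_of_real r))) \<le> 1"
  by simp

text \<open>
  For \<open>N \<ge> 1\<close> both steps vanish close to the origin and both equal 1 far away, so the difference
  is supported where \<open>1 / (2 N) \<le> r \<le> N\<close>. Unlike a product of two cutoffs it has no mixed terms in its
  derivatives.
\<close>

definition cutoff :: "real \<Rightarrow> real \<Rightarrow> real" where
  "cutoff N r = smooth_step (N * r) - smooth_step (r / N)"

lemma measurable_cutoff [measurable]: "cutoff N \<in> borel_measurable borel"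
  unfolding cutoff_def[abs_def] by measurable

lemma cutoff_bound: "\<bar>cutoff N r\<bar> \<le> 1"
  using smooth_step_nonneg[of "N * r"] smooth_step_nonneg[of "r / N"]
    smooth_step_le_1[of "N * r"] smooth_step_le_1[of "r / N"]
  by (simp add: cutoff_def)

lemma cutoff_eq_0:
  assumes "N \<ge> 1" "r < 1 / (2 * N) \<or> r > N"
  shows "cutoff N r = 0"
  using assms(2)
proof
  assume r: "r < 1 / (2 * N)"
  have "N * r \<le> 1 / 2"
    using r assms(1) by (simp add: field_simps)
  moreover have "r / N \<le> 1 / 2"
  proof (cases "r \<ge> 0")
    case True
    have "r \<le> N * r"
      using True assms(1) mult_right_mono[of 1 N r] by simp
    with calculation have "r \<le> 1 / 2"
      by simp
    with assms(1) show ?thesis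
      by (simp add: field_simps)
  next
    case False
    with assms(1) have "r / N \<le> 0"
      by (simp add: divide_nonpos_nonneg)
    then show ?thesis
      by linarith
  qed
  ultimately show ?thesis
    by (simp add: cutoff_def smooth_step_eq_0)
next
  assume r: "r > N"
  have "1 * 1 \<le> N * r"
    using r assms(1) by (intro mult_mono) auto
  moreover have "r / N \<ge> 1"
    using r assms(1) by (simp add: field_simps)
  ultimately show ?thesis
    by (simp add: cutoff_def smooth_step_eq_1)
qed

text \<open>
  The terms of \<open>w\<^sup>2 \<phi> - \<Delta>\<phi>\<close>, for the cut-off Yukawa kernel \<open>\<phi>\<close>, in which derivatives fall on
  the inner and on the outer step.
\<close>

definition near_kernel :: "real \<Rightarrow> complex \<Rightarrow> real \<Rightarrow> complex" where
  "near_kernel N w r = (2 * w * of_real (N * smooth_step' (N * r)) - of_real (N\<^sup>2 * smooth_step'' (N * r))) *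
     yukawa w r"

definition far_kernel :: "real \<Rightarrow> complex \<Rightarrow> real \<Rightarrow> complex" where
  "far_kernel N w r = (of_real (smooth_step'' (r / N) / N\<^sup>2) - 2 * w * of_real (smooth_step' (r / N) / N)) *
     yukawa w r"

lemma measurable_near_kernel [measurable]: "near_kernel N w \<in> borel_measurable borel"
  unfolding near_kernel_def[abs_def] by measurable

lemma measurable_far_kernel [measurable]: "far_kernel N w \<in> borel_measurable borel"
  unfolding far_kernel_def[abs_def] by measurable

text \<open>
  Cutting off the fundamental solution at distances \<open>1 / N\<close> and \<open>N\<close> gives a test function; the
  Helmholtz operator maps it to an approximate delta function plus an error at distance \<open>N\<close>.
\<close>

lemma helmholtz_cutoff_yukawa:
  fixes y :: "real^3" and w :: complex
  assumes "N \<ge> 1"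
  defines "\<phi> \<equiv> \<lambda>x. of_real (cutoff N (norm (x - y))) * yukawa w (norm (x - y))"
  shows "\<phi> \<in> test_functions"
    and "w\<^sup>2 * \<phi> x - laplacian \<phi> x = near_kernel N w (norm (x - y)) + far_kernel N w (norm (x - y))"
proof -
  let ?e = "\<lambda>r. exp ((- w) * complex_of_real r)"
  define H' where "H' r = N * smooth_step' (N * r) - smooth_step' (r / N) / N" for r
  define H'' where "H'' r = N\<^sup>2 * smooth_step'' (N * r) - smooth_step'' (r / N) / N\<^sup>2" for r
  define g where "g r = of_real (cutoff N r) * ?e r * (1 / of_real (4 * pi))" for r
  define g' where "g' r = (of_real (H' r) - w * of_real (cutoff N r)) * ?e r * (1 / of_real (4 * pi))" for r
  define g'' where "g'' r = (of_real (H'' r) - 2 * w * of_real (H' r) + w\<^sup>2 * of_real (cutoff N r)) *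
    ?e r * (1 / of_real (4 * pi))" for r
  have N: "N > 0"
    using assms(1) by simp
  have \<phi>: "\<phi> = radial_quotient g y"
    by (auto simp: fun_eq_iff \<phi>_def radial_quotient_def g_def yukawa_def)
  have H: "((\<lambda>r. of_real (cutoff N r) :: complex) has_vector_derivative of_real (H' r)) (at r)" for r
  proof (rule has_vector_derivative_of_real)
    have "((\<lambda>r. smooth_step (N * r)) has_real_derivative smooth_step' (N * r) * N) (at r)"
      by (rule DERIV_chain2[OF smooth_step_derivatives(1)]) (auto intro!: derivative_eq_intros)
    moreover have "((\<lambda>r. smooth_step (r / N)) has_real_derivative smooth_step' (r / N) * (1 / N)) (at r)"
      by (rule DERIV_chain2[OF smooth_step_derivatives(1)]) (use N in \<open>auto intro!: derivative_eq_intros\<close>)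
    ultimately show "(cutoff N has_real_derivative H' r) (at r)"
      unfolding cutoff_def[abs_def] H'_def by (auto intro!: derivative_eq_intros)
  qed
  have H': "((\<lambda>r. of_real (H' r) :: complex) has_vector_derivative of_real (H'' r)) (at r)" for r
  proof (rule has_vector_derivative_of_real)
    have "((\<lambda>r. smooth_step' (N * r)) has_real_derivative smooth_step'' (N * r) * N) (at r)"
      by (rule DERIV_chain2[OF smooth_step_derivatives(2)]) (auto intro!: derivative_eq_intros)
    from DERIV_cmult[OF this, of N]
    have 1: "((\<lambda>r. N * smooth_step' (N * r)) has_real_derivative N\<^sup>2 * smooth_step'' (N * r)) (at r)"
      by (simp add: power2_eq_square mult_ac)
    have "((\<lambda>r. smooth_step' (r / N)) has_real_derivative smooth_step'' (r / N) * (1 / N)) (at r)"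
      by (rule DERIV_chain2[OF smooth_step_derivatives(2)]) (use N in \<open>auto intro!: derivative_eq_intros\<close>)
    from DERIV_cdivide[OF this, of N]
    have 2: "((\<lambda>r. smooth_step' (r / N) / N) has_real_derivative smooth_step'' (r / N) / N\<^sup>2) (at r)"
      by (simp add: power2_eq_square)
    show "(H' has_real_derivative H'' r) (at r)"
      unfolding H'_def[abs_def] H''_def by (rule DERIV_diff[OF 1 2])
  qed
  have e: "(?e has_vector_derivative (- w) * ?e r) (at r)" for r
  proof -
    have "((\<lambda>z. exp ((- w) * z)) has_field_derivative (- w) * exp ((- w) * of_real r)) (at (of_real r))"
      by (auto intro!: derivative_eq_intros)
    from has_vector_derivative_real_field[OF this] show ?thesis .
  qed
  have g': "(g has_vector_derivative g' r) (at r)" for r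
    using has_vector_derivative_mult_left[OF has_vector_derivative_mult[OF H e], of "1 / of_real (4 * pi)" r]
    unfolding g_def[abs_def] g'_def by (simp add: algebra_simps)
  have "((\<lambda>r. of_real (H' r) - w * of_real (cutoff N r)) has_vector_derivative
      of_real (H'' r) - w * of_real (H' r)) (at r)" for r
    by (intro has_vector_derivative_diff has_vector_derivative_mult_right H H')
  from has_vector_derivative_mult_left[OF has_vector_derivative_mult[OF this e], of "1 / of_real (4 * pi)"]
  have g'': "(g' has_vector_derivative g'' r) (at r)" for r
    unfolding g'_def[abs_def] g''_def by (simp add: algebra_simps power2_eq_square)
  have a: "0 < 1 / (2 * N)"
    using N by simp
  have g0: "g r = 0" if "r < 1 / (2 * N) \<or> r > N" for r
    using cutoff_eq_0[OF assms(1) that] by (simp add: g_def)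
  show "\<phi> \<in> test_functions"
    unfolding \<phi>
  proof (rule radial_quotient_test_function[OF a])
    have "smooth_real (\<lambda>r. smooth_step (N * r + 0) - smooth_step ((1 / N) * r + 0))"
      by (intro smooth_real_diff smooth_real_affine smooth_smooth_step)
    then have "smooth_real (cutoff N)"
      by (simp add: cutoff_def[abs_def])
    then show "smooth_real g"
      unfolding g_def by (intro smooth_real_mult smooth_real_of_real smooth_real_exp smooth_real_const)
  qed (use g0 in auto)
  have "laplacian \<phi> x = radial_quotient g'' y x"
    unfolding \<phi> by (rule laplacian_radial_quotient[OF a _ g' g'']) (use g0 in auto)
  also have "\<dots> = (of_real (H'' (norm (x - y))) - 2 * w * of_real (H' (norm (x - y))) +
      w\<^sup>2 * of_real (cutoff N (norm (x - y)))) * yukawa w (norm (x - y))"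
    by (simp add: radial_quotient_def g''_def yukawa_def)
  finally show "w\<^sup>2 * \<phi> x - laplacian \<phi> x = near_kernel N w (norm (x - y)) + far_kernel N w (norm (x - y))"
    unfolding \<phi>_def near_kernel_def far_kernel_def H'_def H''_def of_real_diff
    by (simp only: ring_distribs) (simp add: algebra_simps)
qed

lemma norm_yukawa_le:
  assumes "Re w \<ge> 0" "R > 0" "r \<ge> R"
  shows "norm (yukawa w r) \<le> 1 / (4 * pi * R)"
proof -
  have "norm (yukawa w r) = norm (exp (- (w * complex_of_real r))) / (4 * pi * r)"
    using assms by (simp add: yukawa_def norm_divide norm_mult)
  also have "\<dots> \<le> 1 / (4 * pi * R)"
    using assms by (intro frac_le norm_exp_le_1) auto
  finally show ?thesis .
qed

lemma near_kernel_bound: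
  assumes "N \<ge> 1" "Re w \<ge> 0" "\<And>x. \<bar>smooth_step' x\<bar> \<le> M" "\<And>x. \<bar>smooth_step'' x\<bar> \<le> M"
  shows "norm (near_kernel N w r) \<le> (2 * norm w + 1) * M / (2 * pi) * N ^ 3"
proof (cases "r < 1 / (2 * N)")
  case True
  have "M \<ge> 0"
    using assms(3)[of 0] by linarith
  moreover have "N * r < 1 / 2"
    using True assms(1) by (simp add: field_simps)
  ultimately show ?thesis
    using assms(1) by (simp add: near_kernel_def smooth_step_derivatives_eq_0)
next
  case False
  have M: "M \<ge> 0"
    using assms(3)[of 0] by linarith
  have "norm (2 * w * of_real (N * smooth_step' (N * r)) - of_real (N\<^sup>2 * smooth_step'' (N * r))) \<le>
      norm (2 * w * of_real (N * smooth_step' (N * r))) + norm (of_real (N\<^sup>2 * smooth_step'' (N * r)) :: complex)"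
    by (rule norm_triangle_ineq4)
  also have "\<dots> = 2 * norm w * (N * \<bar>smooth_step' (N * r)\<bar>) + N\<^sup>2 * \<bar>smooth_step'' (N * r)\<bar>"
    using assms(1) by (simp only: norm_mult norm_of_real abs_mult) simp
  also have "\<dots> \<le> 2 * norm w * (N\<^sup>2 * M) + N\<^sup>2 * M"
    using assms M self_le_power[of N 2] by (intro add_mono mult_left_mono mult_mono) auto
  also have "\<dots> = (2 * norm w + 1) * M * N\<^sup>2"
    by (simp add: algebra_simps)
  finally have 1: "norm (2 * w * of_real (N * smooth_step' (N * r)) - of_real (N\<^sup>2 * smooth_step'' (N * r))) \<le>
      (2 * norm w + 1) * M * N\<^sup>2" .
  have "norm (yukawa w r) \<le> 1 / (4 * pi * (1 / (2 * N)))"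
    using False assms by (intro norm_yukawa_le) auto
  then have "norm (yukawa w r) \<le> N / (2 * pi)"
    using assms(1) by simp
  with 1 have "norm (near_kernel N w r) \<le> ((2 * norm w + 1) * M * N\<^sup>2) * (N / (2 * pi))"
    unfolding near_kernel_def norm_mult[of _ "yukawa w r"] using M by (intro mult_mono) auto
  then show ?thesis
    by (simp add: power2_eq_square power3_eq_cube mult_ac)
qed

lemma near_kernel_eq_0: "N > 0 \<Longrightarrow> r > 1 / N \<Longrightarrow> near_kernel N w r = 0"
  using smooth_step_derivatives_eq_0[of "N * r"] by (simp add: near_kernel_def field_simps)

lemma far_kernel_bound:
  assumes "N \<ge> 1" "Re w \<ge> 0" "\<And>x. \<bar>smooth_step' x\<bar> \<le> M" "\<And>x. \<bar>smooth_step'' x\<bar> \<le> M"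
  shows "norm (far_kernel N w r) \<le> (2 * norm w + 1) * M / (2 * pi) / N\<^sup>2"
proof (cases "r < N / 2")
  case True
  have "M \<ge> 0"
    using assms(3)[of 0] by linarith
  moreover have "r / N < 1 / 2"
    using True assms(1) by (simp add: field_simps)
  ultimately show ?thesis
    using assms(1) by (simp add: far_kernel_def smooth_step_derivatives_eq_0)
next
  case False
  have M: "M \<ge> 0"
    using assms(3)[of 0] by linarith
  have "norm (of_real (smooth_step'' (r / N) / N\<^sup>2) - 2 * w * of_real (smooth_step' (r / N) / N)) \<le>
      norm (of_real (smooth_step'' (r / N) / N\<^sup>2) :: complex) + norm (2 * w * of_real (smooth_step' (r / N) / N))"
    by (rule norm_triangle_ineq4)
  also have "\<dots> = \<bar>smooth_step'' (r / N)\<bar> / N\<^sup>2 + 2 * norm w * (\<bar>smooth_step' (r / N)\<bar> / N)"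
    using assms(1) by (simp only: norm_mult norm_of_real abs_divide) simp
  also have "\<dots> \<le> M / N + 2 * norm w * (M / N)"
    using assms M self_le_power[of N 2] by (intro add_mono mult_left_mono frac_le) auto
  also have "\<dots> = (2 * norm w + 1) * M / N"
    using assms(1) by (simp add: field_simps)
  finally have 1: "norm (of_real (smooth_step'' (r / N) / N\<^sup>2) - 2 * w * of_real (smooth_step' (r / N) / N)) \<le>
      (2 * norm w + 1) * M / N" .
  have "norm (yukawa w r) \<le> 1 / (4 * pi * (N / 2))"
    using False assms by (intro norm_yukawa_le) auto
  with 1 have "norm (far_kernel N w r) \<le> ((2 * norm w + 1) * M / N) * (1 / (4 * pi * (N / 2)))"
    unfolding far_kernel_def norm_mult[of _ "yukawa w r"] using M assms(1) by (intro mult_mono) auto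
  then show ?thesis
    by (simp add: power2_eq_square mult_ac)
qed

lemma far_kernel_eq_0: "N > 0 \<Longrightarrow> r > N \<Longrightarrow> far_kernel N w r = 0"
  using smooth_step_derivatives_eq_0[of "r / N"] by (simp add: far_kernel_def field_simps)

text \<open>
  Near the origin \<open>exp (- w r)\<close> differs from 1 by \<open>O(r)\<close>, which gains a power of \<open>N\<close>.
\<close>

lemma near_kernel_minus_mollifier:
  assumes "N \<ge> 1" "Re w \<ge> 0" "\<And>x. \<bar>smooth_step' x\<bar> \<le> M" "\<And>x. \<bar>smooth_step'' x\<bar> \<le> M"
  shows "norm (near_kernel N w r - of_real (mollifier N r)) \<le> norm w * M * (1 + exp (norm w)) * N\<^sup>2"
proof (cases "r < 1 / (2 * N) \<or> r > 1 / N")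
  case True
  have "M \<ge> 0"
    using assms(3)[of 0] by linarith
  moreover have "N * r < 1 / 2 \<or> N * r > 1"
    using True assms(1) by (auto simp: field_simps)
  then have "near_kernel N w r = 0" "mollifier N r = 0"
    by (simp_all add: near_kernel_def mollifier_def smooth_step_derivatives_eq_0)
  ultimately show ?thesis
    by simp
next
  case False
  have M: "M \<ge> 0"
    using assms(3)[of 0] by linarith
  have r: "r > 0" "r \<le> 1" "1 / r \<le> 2 * N"
  proof -
    have "0 < 1 / (2 * N)" "1 / N \<le> 1"
      using assms(1) by simp_all
    with False show "r > 0" "r \<le> 1"
      by linarith+
    with False show "1 / r \<le> 2 * N"
      using assms(1) by (simp add: field_simps)
  qed
  let ?e = "exp (- (w * complex_of_real r))"
  have "norm (?e - (\<Sum>k\<le>0. (- (w * complex_of_real r)) ^ k / fact k)) \<le>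
      exp \<bar>Re (- (w * complex_of_real r))\<bar> * norm (- (w * complex_of_real r)) ^ Suc 0 / fact 0"
    by (rule Taylor_exp)
  also have "\<dots> \<le> exp (norm w) * (norm w * r)"
  proof -
    have "\<bar>Re w * r\<bar> \<le> norm w * 1"
      unfolding abs_mult using r abs_Re_le_cmod[of w] by (intro mult_mono) auto
    then show ?thesis
      using r by (simp add: norm_mult mult_right_mono)
  qed
  finally have e: "norm (1 - ?e) \<le> exp (norm w) * (norm w * r)"
    by (simp add: norm_minus_commute)
  have eq: "near_kernel N w r - of_real (mollifier N r) =
      2 * w * of_real (N * smooth_step' (N * r)) * yukawa w r +
      of_real (N\<^sup>2 * smooth_step'' (N * r)) * ((1 - ?e) / of_real (4 * pi * r))"
    by (simp add: near_kernel_def mollifier_def yukawa_def ring_distribs diff_divide_distrib)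
  have "norm (yukawa w r) \<le> 1 / (4 * pi * r)"
    using norm_yukawa_le[OF assms(2) r(1)] by simp
  also have "\<dots> = (1 / r) / (4 * pi)"
    by simp
  also have "\<dots> \<le> 2 * N / 4"
    using r pi_gt3 assms(1) by (intro frac_le) auto
  finally have y: "norm (yukawa w r) \<le> N / 2"
    by simp
  have 1: "norm (2 * w * of_real (N * smooth_step' (N * r)) * yukawa w r) \<le> 2 * norm w * (N * M) * (N / 2)"
    unfolding norm_mult using assms(1,3) M y
    by (intro mult_mono) (auto simp: norm_mult abs_mult intro!: mult_nonneg_nonneg)
  have "norm ((1 - ?e) / of_real (4 * pi * r)) = norm (1 - ?e) / (4 * pi * r)"
    using r by (simp add: norm_divide norm_mult)
  also have "\<dots> \<le> exp (norm w) * (norm w * r) / (4 * pi * r)"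
    using e r by (intro divide_right_mono) auto
  also have "\<dots> = exp (norm w) * norm w / (4 * pi)"
    using r by simp
  also have "\<dots> \<le> exp (norm w) * norm w / 1"
    using pi_gt3 by (intro divide_left_mono) auto
  finally have "norm ((1 - ?e) / of_real (4 * pi * r)) \<le> exp (norm w) * norm w"
    by simp
  then have 2: "norm (of_real (N\<^sup>2 * smooth_step'' (N * r)) * ((1 - ?e) / of_real (4 * pi * r))) \<le>
      N\<^sup>2 * M * (exp (norm w) * norm w)"
    unfolding norm_mult[of _ "(1 - ?e) / of_real (4 * pi * r)"] using assms(4) M
    by (intro mult_mono) (auto simp: abs_mult norm_mult norm_power intro!: mult_left_mono)
  show ?thesis
    unfolding eq using norm_triangle_le[OF add_mono[OF 1 2]]
    by (simp add: power2_eq_square algebra_simps)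
qed

lemma norm_integral_radial_le:
  fixes K :: "real \<Rightarrow> complex"
  assumes [measurable]: "K \<in> borel_measurable borel"
    and "\<And>r. norm (K r) \<le> B" and supp: "\<And>r. r > R \<Longrightarrow> K r = 0" and "R \<ge> 0"
  shows "norm (\<integral>x. K (norm (x :: real^3)) \<partial>lborel) \<le> B * (4 / 3 * pi * R ^ 3)"
proof -
  have int: "integrable lborel (\<lambda>x. K (norm (x :: real^3)))"
    using integrable_times_radial[OF locally_summable_const[of 1], of K B R 0 0] assms by simp
  have "norm (\<integral>x. K (norm (x :: real^3)) \<partial>lborel) \<le> (\<integral>x. norm (K (norm (x :: real^3))) \<partial>lborel)"
    by (rule integral_norm_bound)
  also have "\<dots> \<le> (\<integral>x. B * indicator (cball 0 R) (x :: real^3) \<partial>lborel)"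
  proof (rule integral_mono)
    show "integrable lborel (\<lambda>x. B * indicator (cball 0 R) (x :: real^3))"
      using emeasure_lborel_cball_finite[of "0 :: real^3" R]
      by (intro integrable_mult_right integrable_real_indicator) auto
    show "norm (K (norm x)) \<le> B * indicator (cball 0 R) (x :: real^3)" for x
      using assms(2)[of "norm x"] supp[of "norm x"] by (cases "norm x > R") (auto simp: indicator_def)
  qed (use int in simp)
  also have "\<dots> = B * measure lborel (cball (0 :: real^3) R)"
    by simp
  also have "\<dots> = B * (4 / 3 * pi * R ^ 3)"
    using \<open>R \<ge> 0\<close> by (subst content_cball) (auto simp: unit_ball_vol_3)
  finally show ?thesis .
qed

lemma near_kernel_mass:
  assumes "Re w \<ge> 0"
  shows "(\<lambda>n. \<integral>x. near_kernel (real (Suc n)) w (norm (x :: real^3)) \<partial>lborel) \<longlonglongrightarrow> 1"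
proof -
  obtain M where M: "M > 0" "\<And>x. \<bar>smooth_step' x\<bar> \<le> M" "\<And>x. \<bar>smooth_step'' x\<bar> \<le> M"
    by (rule smooth_step_derivatives_bounded) blast
  define C where "C = norm w * M * (1 + exp (norm w)) * (4 / 3 * pi)"
  have "norm ((\<integral>x. near_kernel N w (norm (x :: real^3)) \<partial>lborel) - 1) \<le> C * (1 / N)" if N: "N \<ge> 1" for N
  proof -
    have supp: "near_kernel N w r = 0" "mollifier N r = 0" if "r > 1 / N" for r
      using that N mollifier_eq_0[of N r] near_kernel_eq_0[of N r w] by auto
    have 1: "integrable lborel (\<lambda>x. near_kernel N w (norm (x :: real^3)))"
      using integrable_times_radial[OF locally_summable_const[of 1], of "near_kernel N w"
          "(2 * norm w + 1) * M / (2 * pi) * N ^ 3" "1 / N" 0 0]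
        near_kernel_bound[OF N assms M(2,3)] supp by simp
    have 2: "integrable lborel (\<lambda>x. complex_of_real (mollifier N (norm (x :: real^3))))"
      using integrable_times_radial[OF locally_summable_const[of 1],
          of "\<lambda>r. complex_of_real (mollifier N r)" "M / (2 * pi) * N ^ 3" "1 / N" 0 0]
        mollifier_bound[of N M] N M(3) supp by simp
    have "(\<integral>x. near_kernel N w (norm (x :: real^3)) \<partial>lborel) - 1 =
        (\<integral>x. near_kernel N w (norm (x :: real^3)) - of_real (mollifier N (norm x)) \<partial>lborel)"
      using N by (subst Bochner_Integration.integral_diff[OF 1 2]) (simp add: integral_mollifier)
    also have "norm \<dots> \<le> norm w * M * (1 + exp (norm w)) * N\<^sup>2 * (4 / 3 * pi * (1 / N) ^ 3)"
      using N by (intro norm_integral_radial_le[of "\<lambda>r. near_kernel N w r - of_real (mollifier N r)"]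
          near_kernel_minus_mollifier[OF N assms M(2,3)]) (auto simp: supp)
    also have "\<dots> = C * (1 / N)"
      using N by (simp add: C_def field_simps eval_nat_numeral)
    finally show ?thesis .
  qed
  then have bound: "norm ((\<integral>x. near_kernel (real (Suc n)) w (norm (x :: real^3)) \<partial>lborel) - 1) \<le>
      C * (1 / real (Suc n))" for n
    by simp
  have "(\<lambda>n. C * (1 / real (Suc n))) \<longlonglongrightarrow> 0"
    using tendsto_mult_right_zero[OF LIMSEQ_inverse_real_of_nat, of C] by (simp add: inverse_eq_divide)
  then have "(\<lambda>n. (\<integral>x. near_kernel (real (Suc n)) w (norm (x :: real^3)) \<partial>lborel) - 1) \<longlonglongrightarrow> 0"
    by (rule Lim_null_comparison[OF always_eventually, rotated]) (use bound in blast)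
  then show ?thesis
    by (simp add: LIM_zero_iff)
qed

text \<open>
  On its support, a ball of radius \<open>N\<close>, the far kernel is \<open>O(N\<^sup>-\<^sup>2)\<close>, so its square
  integral is \<open>O(1 / N)\<close> and it is negligible against square summable functions.
\<close>

lemma far_kernel_tendsto_0:
  fixes f :: "real^3 \<Rightarrow> complex"
  assumes f: "square_summable f" and "Re w \<ge> 0"
  shows "(\<lambda>n. \<integral>x. f x * far_kernel (real (Suc n)) w (norm (x - y)) \<partial>lborel) \<longlonglongrightarrow> 0"
proof -
  obtain M where M: "M > 0" "\<And>x. \<bar>smooth_step' x\<bar> \<le> M" "\<And>x. \<bar>smooth_step'' x\<bar> \<le> M"
    by (rule smooth_step_derivatives_bounded) blast
  have [measurable]: "f \<in> borel_measurable borel"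
    using f by (simp add: square_summable_def)
  define F where "F = enn2real (\<integral>\<^sup>+x. ennreal ((norm (f x))\<^sup>2) \<partial>lborel)"
  have F: "(\<integral>\<^sup>+x. ennreal ((norm (f x))\<^sup>2) \<partial>lborel) = ennreal F" "F \<ge> 0"
    using f by (auto simp: F_def square_summable_def less_top)
  define C where "C = (2 * norm w + 1) * M / (2 * pi)"
  have C: "C \<ge> 0"
    using M(1) by (simp add: C_def)
  define I where "I N = (\<integral>x. f x * far_kernel N w (norm (x - y)) \<partial>lborel)" for N
  have I_bound: "(norm (I N))\<^sup>2 \<le> F * (C\<^sup>2 * (4 / 3 * pi)) * (1 / N)" if N: "N \<ge> 1" for N
  proof -
    have bound: "norm (far_kernel N w r) \<le> C / N\<^sup>2" for r
      using far_kernel_bound[OF N assms(2) M(2,3)] by (simp add: C_def)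
    have int: "integrable lborel (\<lambda>x. f x * far_kernel N w (norm (x - y)))"
      using integrable_times_radial[OF square_summable_imp_locally_summable[OF f], of "far_kernel N w" "C / N\<^sup>2" N 0 y]
        bound far_kernel_eq_0[of N] N by simp
    have "(ennreal (norm (I N)))\<^sup>2 \<le> (\<integral>\<^sup>+x. ennreal (norm (f x)) * ennreal (norm (far_kernel N w (norm (x - y)))) \<partial>lborel)\<^sup>2"
      using integral_norm_bound_ennreal[OF int] unfolding I_def
      by (intro power_mono) (simp_all add: norm_mult ennreal_mult)
    also have "\<dots> \<le> (\<integral>\<^sup>+x. (ennreal (norm (f x)))\<^sup>2 \<partial>lborel) *
        (\<integral>\<^sup>+x. (ennreal (norm (far_kernel N w (norm (x - y)))))\<^sup>2 \<partial>lborel)"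
      by (rule Cauchy_Schwarz_nn_integral) measurable
    also have "\<dots> \<le> ennreal F * (\<integral>\<^sup>+x. ennreal ((C / N\<^sup>2)\<^sup>2) * indicator (cball y N) x \<partial>lborel)"
    proof (intro mult_mono nn_integral_mono)
      show "(\<integral>\<^sup>+x. (ennreal (norm (f x)))\<^sup>2 \<partial>lborel) \<le> ennreal F"
        by (simp add: ennreal_power F)
      fix x
      show "(ennreal (norm (far_kernel N w (norm (x - y)))))\<^sup>2 \<le> ennreal ((C / N\<^sup>2)\<^sup>2) * indicator (cball y N) x"
      proof (cases "x \<in> cball y N")
        case True
        then show ?thesis
          using bound by (simp add: ennreal_power power_mono ennreal_leI del: power_divide)
      next
        case False
        then have "far_kernel N w (norm (x - y)) = 0"
          using N by (intro far_kernel_eq_0) (auto simp: dist_norm norm_minus_commute)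
        then show ?thesis
          by simp
      qed
    qed auto
    also have "\<dots> = ennreal F * (ennreal ((C / N\<^sup>2)\<^sup>2) * ennreal (4 / 3 * pi * N ^ 3))"
      using N by (subst nn_integral_cmult_indicator) (auto simp: emeasure_cball unit_ball_vol_3)
    also have "\<dots> = ennreal (F * ((C / N\<^sup>2)\<^sup>2 * (4 / 3 * pi * N ^ 3)))"
      by (simp only: ennreal_mult'[OF F(2)] ennreal_mult'[OF zero_le_power2])
    also have "F * ((C / N\<^sup>2)\<^sup>2 * (4 / 3 * pi * N ^ 3)) = F * (C\<^sup>2 * (4 / 3 * pi)) * (1 / N)"
      using N by (simp add: field_simps eval_nat_numeral)
    finally show ?thesis
      using F(2) N by (simp add: ennreal_power ennreal_le_iff)
  qed
  have bound: "norm ((norm (I (real (Suc n))))\<^sup>2) \<le> F * (C\<^sup>2 * (4 / 3 * pi)) * (1 / real (Suc n))" for n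
    unfolding real_norm_def abs_power2 by (rule I_bound) simp
  have "(\<lambda>n. F * (C\<^sup>2 * (4 / 3 * pi)) * (1 / real (Suc n))) \<longlonglongrightarrow> 0"
    using tendsto_mult_right_zero[OF LIMSEQ_inverse_real_of_nat, of "F * (C\<^sup>2 * (4 / 3 * pi))"]
    by (simp add: inverse_eq_divide)
  then have "(\<lambda>n. (norm (I (real (Suc n))))\<^sup>2) \<longlonglongrightarrow> 0"
    by (rule Lim_null_comparison[OF always_eventually, rotated]) (use bound in blast)
  then show ?thesis
    by (simp add: power_tendsto_0_iff tendsto_norm_zero_iff I_def)
qed

lemma cutoff_tendsto_1:
  assumes "r > 0"
  shows "(\<lambda>n. cutoff (real (Suc n)) r) \<longlonglongrightarrow> 1"
proof (rule tendsto_eventually)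
  obtain k :: nat where k: "real k \<ge> max (1 / r) (2 * r)"
    using real_arch_simple by blast
  have "cutoff (real (Suc n)) r = 1" if "n \<ge> k" for n
  proof -
    have n: "real (Suc n) \<ge> 1 / r" "real (Suc n) \<ge> 2 * r"
      using k that by auto
    have "real (Suc n) * r \<ge> 1"
      using n(1) assms by (simp add: field_simps del: of_nat_Suc)
    moreover have "r / real (Suc n) \<le> 1 / 2"
      using n(2) by (simp add: field_simps del: of_nat_Suc)
    ultimately show ?thesis
      by (simp add: cutoff_def smooth_step_eq_0 smooth_step_eq_1 del: of_nat_Suc)
  qed
  then show "\<forall>\<^sub>F n in sequentially. cutoff (real (Suc n)) r = 1"
    unfolding eventually_sequentially by blast
qed

text \<open>
  At a Lebesgue point \<open>y\<close> of \<open>f\<close>, test the equation with the Yukawa kernel centred at \<open>y\<close> and cut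
  off: the left-hand side tends to \<open>f(y)\<close>, the right-hand side to the convolution by dominated
  convergence. Square summability of \<open>f\<close> takes the place of a radiation condition when
  \<open>Re w = 0\<close>.
\<close>

theorem helmholtz_representation:
  fixes f F :: "real^3 \<Rightarrow> complex"
  assumes f: "square_summable f" and [measurable]: "F \<in> borel_measurable borel"
    and w: "Re w \<ge> 0"
    and eq: "\<And>\<phi>. \<phi> \<in> test_functions \<Longrightarrow>
      (\<integral>x. f x * (w\<^sup>2 * \<phi> x - laplacian \<phi> x) \<partial>lborel) = (\<integral>x. F x * \<phi> x \<partial>lborel)"
  shows "AE y in lborel. integrable lborel (\<lambda>x. F x * yukawa w (norm (x - y))) \<longrightarrow>
    f y = (\<integral>x. F x * yukawa w (norm (x - y)) \<partial>lborel)"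
proof -
  obtain M where M: "M > 0" "\<And>x. \<bar>smooth_step' x\<bar> \<le> M" "\<And>x. \<bar>smooth_step'' x\<bar> \<le> M"
    by (rule smooth_step_derivatives_bounded) blast
  note fl = square_summable_imp_locally_summable[OF f]
  from AE_Lebesgue_point[OF fl] show ?thesis
  proof (eventually_elim, intro impI)
    fix y
    assume y: "Lebesgue_point f y"
    assume int: "integrable lborel (\<lambda>x. F x * yukawa w (norm (x - y)))"
    define \<phi> where "\<phi> n x = of_real (cutoff (real (Suc n)) (norm (x - y))) * yukawa w (norm (x - y))" for n x
    have near: "integrable lborel (\<lambda>x. f x * near_kernel (real (Suc n)) w (norm (x - y)))"
      "(\<lambda>n. \<integral>x. f x * near_kernel (real (Suc n)) w (norm (x - y)) \<partial>lborel) \<longlonglongrightarrow> f y" for n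
      by (rule mollification_at_Lebesgue_point[OF fl _ _ _ near_kernel_mass[OF w] y, where
            C = "(2 * norm w + 1) * M / (2 * pi)"];
          use near_kernel_bound[OF _ w M(2,3)] near_kernel_eq_0 in simp)+
    have far: "integrable lborel (\<lambda>x. f x * far_kernel (real (Suc n)) w (norm (x - y)))" for n
      using integrable_times_radial[OF fl, of "far_kernel (real (Suc n)) w"
          "(2 * norm w + 1) * M / (2 * pi) / (real (Suc n))\<^sup>2" "real (Suc n)" 0 y]
        far_kernel_bound[OF _ w M(2,3), of "real (Suc n)"] far_kernel_eq_0[of "real (Suc n)"]
      by simp
    have "(\<integral>x. F x * \<phi> n x \<partial>lborel) = (\<integral>x. f x * near_kernel (real (Suc n)) w (norm (x - y)) \<partial>lborel) +
        (\<integral>x. f x * far_kernel (real (Suc n)) w (norm (x - y)) \<partial>lborel)" for n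
    proof -
      have N: "real (Suc n) \<ge> 1"
        by simp
      have "(\<integral>x. F x * \<phi> n x \<partial>lborel) = (\<integral>x. f x * (w\<^sup>2 * \<phi> n x - laplacian (\<phi> n) x) \<partial>lborel)"
        unfolding \<phi>_def by (rule eq[symmetric]) (rule helmholtz_cutoff_yukawa(1)[OF N])
      also have "\<dots> = (\<integral>x. f x * near_kernel (real (Suc n)) w (norm (x - y)) +
          f x * far_kernel (real (Suc n)) w (norm (x - y)) \<partial>lborel)"
        unfolding \<phi>_def helmholtz_cutoff_yukawa(2)[OF N] by (simp add: ring_distribs)
      finally show ?thesis
        using near(1) far by simp
    qed
    moreover have "(\<lambda>n. (\<integral>x. f x * near_kernel (real (Suc n)) w (norm (x - y)) \<partial>lborel) +
        (\<integral>x. f x * far_kernel (real (Suc n)) w (norm (x - y)) \<partial>lborel)) \<longlonglongrightarrow> f y + 0"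
      by (intro tendsto_add near(2) far_kernel_tendsto_0 f w)
    ultimately have 1: "(\<lambda>n. \<integral>x. F x * \<phi> n x \<partial>lborel) \<longlonglongrightarrow> f y"
      by simp
    have "(\<lambda>n. \<integral>x. F x * \<phi> n x \<partial>lborel) \<longlonglongrightarrow> (\<integral>x. F x * yukawa w (norm (x - y)) \<partial>lborel)"
    proof (rule integral_dominated_convergence[where w = "\<lambda>x. norm (F x * yukawa w (norm (x - y)))"])
      show "AE x in lborel. (\<lambda>n. F x * \<phi> n x) \<longlonglongrightarrow> F x * yukawa w (norm (x - y))"
      proof (rule AE_I2)
        fix x
        show "(\<lambda>n. F x * \<phi> n x) \<longlonglongrightarrow> F x * yukawa w (norm (x - y))"
        proof (cases "x = y")
          case True
          then show ?thesis
            by (simp add: \<phi>_def yukawa_def)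
        next
          case False
          then have "(\<lambda>n. F x * \<phi> n x) \<longlonglongrightarrow> F x * (of_real 1 * yukawa w (norm (x - y)))"
            unfolding \<phi>_def by (intro tendsto_intros cutoff_tendsto_1) simp
          then show ?thesis
            by simp
        qed
      qed
      show "AE x in lborel. norm (F x * \<phi> n x) \<le> norm (F x * yukawa w (norm (x - y)))" for n
        unfolding \<phi>_def norm_mult norm_of_real
        using cutoff_bound by (intro AE_I2 mult_left_mono mult_left_le_one_le) auto
      show "(\<lambda>x. F x * \<phi> n x) \<in> borel_measurable lborel" for n
        unfolding \<phi>_def by measurable
      show "(\<lambda>x. F x * yukawa w (norm (x - y))) \<in> borel_measurable lborel"
        by measurable
    qed (use int in simp)
    with 1 show "f y = (\<integral>x. F x * yukawa w (norm (x - y)) \<partial>lborel)"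
      by (rule LIMSEQ_unique)
  qed
qed

section \<open>Weak derivatives\<close>

lemma partial_derivs_append: "partial_derivs (\<alpha> @ \<beta>) f = partial_derivs \<alpha> (partial_derivs \<beta> f)"
  by (simp add: partial_derivs_def)

lemma smooth_partial_derivs: "smooth f \<Longrightarrow> smooth (partial_derivs \<alpha> f)"
  by (simp add: smooth_def partial_derivs_append[symmetric])

lemma smooth_has_derivative:
  assumes "smooth f"
  shows "(f has_derivative frechet_derivative f (at x)) (at x)"
proof -
  have "partial_derivs [] f differentiable_on UNIV"
    using assms unfolding smooth_def by blast
  then show ?thesis
    by (simp add: differentiable_on_def frechet_derivative_works)
qed

lemma smooth_continuous: "smooth f \<Longrightarrow> continuous_on UNIV f"
  by (intro continuous_at_imp_continuous_on ballI)
    (rule has_derivative_continuous[OF smooth_has_derivative])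

lemma test_function_bounded_support:
  assumes "\<phi> \<in> test_functions"
  obtains R where "R > 0" "\<And>x. x \<notin> cball 0 R \<Longrightarrow> \<phi> x = 0"
proof -
  have "bounded {x. \<phi> x \<noteq> 0}"
    using assms by (simp add: test_functions_def compact_closure)
  then obtain R where "R > 0" "\<forall>x\<in>{x. \<phi> x \<noteq> 0}. norm x \<le> R"
    unfolding bounded_pos by blast
  then show ?thesis
    by (intro that[of R]) (auto simp: dist_norm)
qed

lemma test_functionI:
  assumes "smooth \<phi>" "\<And>x. x \<notin> cball 0 R \<Longrightarrow> \<phi> x = 0"
  shows "\<phi> \<in> test_functions"
proof -
  have "{x. \<phi> x \<noteq> 0} \<subseteq> cball 0 R"
    using assms(2) by blast
  then have "bounded {x. \<phi> x \<noteq> 0}"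
    using bounded_cball bounded_subset by blast
  with assms(1) show ?thesis
    by (simp add: test_functions_def compact_closure)
qed

lemma has_derivative_outside_support:
  fixes f :: "'a::euclidean_space \<Rightarrow> 'b::real_normed_vector"
  assumes "\<And>x. x \<notin> cball 0 R \<Longrightarrow> f x = 0" "(f has_derivative f') (at x)" "x \<notin> cball 0 R"
  shows "f' = (\<lambda>_. 0)"
proof -
  have "(f has_derivative (\<lambda>_. 0)) (at x)"
    by (rule has_derivative_transform_within_open[OF has_derivative_const, of "- cball 0 R"])
      (use assms in auto)
  with assms(2) show ?thesis
    by (rule has_derivative_unique)
qed

lemma test_function_partial_deriv:
  assumes "\<phi> \<in> test_functions"
  shows "partial_deriv i \<phi> \<in> test_functions"
proof -
  from assms obtain R where R: "\<And>x. x \<notin> cball 0 R \<Longrightarrow> \<phi> x = 0"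
    by (rule test_function_bounded_support) blast
  have s: "smooth \<phi>"
    using assms by (simp add: test_functions_def)
  show ?thesis
  proof (rule test_functionI)
    show "smooth (partial_deriv i \<phi>)"
      using smooth_partial_derivs[OF s, of "[i]"] by simp
    show "partial_deriv i \<phi> x = 0" if "x \<notin> cball 0 R" for x
      using has_derivative_outside_support[OF R smooth_has_derivative[OF s] that]
      by (simp add: partial_deriv_def)
  qed
qed

lemma test_function_partial_derivs: "\<phi> \<in> test_functions \<Longrightarrow> partial_derivs \<alpha> \<phi> \<in> test_functions"
  by (induction \<alpha>) (simp_all add: test_function_partial_deriv)

lemma integrable_continuous_bounded_support:
  fixes f :: "real^'n \<Rightarrow> complex"
  assumes "continuous_on UNIV f" "\<And>x. x \<notin> cball 0 R \<Longrightarrow> f x = 0"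
  shows "integrable lborel f"
proof -
  have "integrable lborel (\<lambda>x. indicator (cball 0 R) x *\<^sub>R f x)"
    by (rule borel_integrable_compact) (auto intro: continuous_on_subset[OF assms(1)])
  also have "(\<lambda>x. indicator (cball 0 R) x *\<^sub>R f x) = f"
    using assms(2) by (auto simp: fun_eq_iff indicator_def)
  finally show ?thesis .
qed

text \<open>
  The integral of a difference quotient vanishes by translation invariance; dominated
  convergence passes this on to the partial derivative.
\<close>

lemma integral_partial_deriv_eq_0:
  fixes F :: "real^'n \<Rightarrow> complex"
  assumes F': "\<And>x. (F has_derivative F' x) (at x)"
    and supp: "\<And>x. x \<notin> cball 0 R \<Longrightarrow> F x = 0"
    and cont: "continuous_on UNIV (\<lambda>x. F' x (axis i 1))"
  shows "(\<integral>x. F' x (axis i 1) \<partial>lborel) = 0"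
proof -
  let ?e = "axis i 1 :: real^'n"
  let ?G = "\<lambda>x. F' x ?e"
  define h where "h n = inverse (real (Suc n))" for n
  have h: "h n > 0" "h n \<le> 1" for n
    by (simp_all add: h_def inverse_le_1_iff)
  have G0: "?G x = 0" if "x \<notin> cball 0 R" for x
    using has_derivative_outside_support[OF supp F' that] by simp
  have contF: "continuous_on UNIV F"
    using F' has_derivative_continuous continuous_at_imp_continuous_on by blast
  then have [measurable]: "F \<in> borel_measurable borel"
    by (rule borel_measurable_continuous_onI)
  have [measurable]: "?G \<in> borel_measurable borel"
    by (rule borel_measurable_continuous_onI[OF cont])
  have intF: "integrable lborel F"
    by (rule integrable_continuous_bounded_support[OF contF supp])
  have intF': "integrable lborel (\<lambda>x. F (x + c))" for c
  proof -
    have "integrable (distr lborel borel ((+) c)) F"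
      using intF by (simp add: lborel_distr_plus)
    then show ?thesis
      by (subst (asm) integrable_distr_eq) (auto simp: add.commute)
  qed
  obtain B where B: "B \<ge> 0" "\<And>x. norm (?G x) \<le> B"
  proof -
    have "bounded (?G ` cball 0 R)"
      by (intro compact_imp_bounded compact_continuous_image continuous_on_subset[OF cont]) auto
    then obtain B where B: "B > 0" "\<And>x. x \<in> cball 0 R \<Longrightarrow> norm (?G x) \<le> B"
      unfolding bounded_pos by blast
    have "norm (?G x) \<le> B" for x
      using B G0[of x] by (cases "x \<in> cball 0 R") auto
    with B(1) show ?thesis
      by (intro that[of B]) auto
  qed
  have line: "((\<lambda>t. F (x + t *\<^sub>R ?e)) has_vector_derivative ?G (x + t *\<^sub>R ?e)) (at t)" for x t
  proof -
    have "((\<lambda>t. x + t *\<^sub>R ?e) has_derivative (\<lambda>s. s *\<^sub>R ?e)) (at t)"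
      by (auto intro!: derivative_eq_intros)
    from has_derivative_compose[OF this F'] show ?thesis
      unfolding has_vector_derivative_def
      by (rule has_derivative_eq_rhs)
        (use linear_cmul[OF has_derivative_linear[OF F']] in \<open>auto simp: fun_eq_iff\<close>)
  qed
  have lip: "norm (F (x + h n *\<^sub>R ?e) - F x) \<le> B * h n" for x n
  proof -
    have "norm ((\<lambda>t. F (x + t *\<^sub>R ?e)) (h n) - (\<lambda>t. F (x + t *\<^sub>R ?e)) 0) \<le> B * norm (h n - 0)"
    proof (rule differentiable_bound[of UNIV])
      show "((\<lambda>t. F (x + t *\<^sub>R ?e)) has_derivative (\<lambda>s. s *\<^sub>R ?G (x + t *\<^sub>R ?e))) (at t)" for t
        using line by (simp add: has_vector_derivative_def)
      show "onorm (\<lambda>s. s *\<^sub>R ?G (x + t *\<^sub>R ?e)) \<le> B" for t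
        by (rule onorm_le) (use B(2) in \<open>auto simp: mult.commute[of B] intro!: mult_left_mono\<close>)
    qed auto
    then show ?thesis
      using h(1)[of n] by simp
  qed
  let ?D = "\<lambda>n x. (F (x + h n *\<^sub>R ?e) - F x) /\<^sub>R h n"
  have D_int: "(\<integral>x. ?D n x \<partial>lborel) = 0" for n
  proof -
    have "(\<integral>x. F (x + h n *\<^sub>R ?e) \<partial>lborel) = (\<integral>x. F x \<partial>lborel)"
      using integral_lborel_shift[of F "- (h n *\<^sub>R ?e)"] by simp
    then have "(\<integral>x. F (x + h n *\<^sub>R ?e) - F x \<partial>lborel) = 0"
      by (subst Bochner_Integration.integral_diff[OF intF' intF]) simp
    then show ?thesis
      by (simp add: integral_scaleR_right)
  qed
  have "(\<lambda>n. \<integral>x. ?D n x \<partial>lborel) \<longlonglongrightarrow> (\<integral>x. ?G x \<partial>lborel)"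
  proof (rule integral_dominated_convergence[where w = "\<lambda>x. B * indicator (cball 0 (R + 1)) x"])
    show "integrable lborel (\<lambda>x. B * indicator (cball 0 (R + 1)) (x :: real^'n))"
      using emeasure_lborel_cball_finite[of "0 :: real^'n" "R + 1"]
      by (intro integrable_mult_right integrable_real_indicator) auto
    show "AE x in lborel. (\<lambda>n. ?D n x) \<longlonglongrightarrow> ?G x"
    proof (rule AE_I2)
      fix x
      let ?q = "\<lambda>t. (F (x + t *\<^sub>R ?e) - F x) /\<^sub>R t"
      have "((\<lambda>t. (F (x + t *\<^sub>R ?e) - F x - t *\<^sub>R ?G x) /\<^sub>R \<bar>t\<bar>) \<longlongrightarrow> 0) (at 0)"
        using line[of x 0] by (simp add: has_vector_derivative_def has_derivative_within diff_diff_eq inverse_eq_divide)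
      then have "((\<lambda>t. norm ((F (x + t *\<^sub>R ?e) - F x - t *\<^sub>R ?G x) /\<^sub>R \<bar>t\<bar>)) \<longlongrightarrow> 0) (at 0)"
        by (rule tendsto_norm_zero)
      moreover have "norm ((F (x + t *\<^sub>R ?e) - F x - t *\<^sub>R ?G x) /\<^sub>R \<bar>t\<bar>) = norm (?q t - ?G x)"
        if "t \<noteq> 0" for t
      proof -
        have "?q t - ?G x = (F (x + t *\<^sub>R ?e) - F x - t *\<^sub>R ?G x) /\<^sub>R t"
          using that by (simp add: scaleR_diff_right)
        then show ?thesis
          by simp
      qed
      then have "\<forall>\<^sub>F t in at 0. norm ((F (x + t *\<^sub>R ?e) - F x - t *\<^sub>R ?G x) /\<^sub>R \<bar>t\<bar>) = norm (?q t - ?G x)"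
        by (auto simp: eventually_at_filter)
      ultimately have "((\<lambda>t. norm (?q t - ?G x)) \<longlongrightarrow> 0) (at 0)"
        by (rule Lim_transform_eventually)
      then have "(?q \<longlongrightarrow> ?G x) (at 0)"
        unfolding tendsto_norm_zero_iff by (rule LIM_zero_cancel)
      moreover have "filterlim h (at 0) sequentially"
        unfolding filterlim_at using h(1) LIMSEQ_inverse_real_of_nat
        by (auto simp: h_def[abs_def])
      ultimately show "(\<lambda>n. ?D n x) \<longlonglongrightarrow> ?G x"
        by (rule filterlim_compose)
    qed
    show "AE x in lborel. norm (?D n x) \<le> B * indicator (cball 0 (R + 1)) x" for n
    proof (rule AE_I2)
      fix x
      show "norm (?D n x) \<le> B * indicator (cball 0 (R + 1)) x"
      proof (cases "x \<in> cball 0 (R + 1)")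
        case True
        then show ?thesis
        proof -
          have "norm (?D n x) = norm (F (x + h n *\<^sub>R ?e) - F x) / h n"
            using h(1)[of n] by (simp add: divide_inverse mult.commute)
          also have "\<dots> \<le> B"
            using lip[of x n] h(1)[of n] by (simp add: pos_divide_le_eq)
          finally show ?thesis
            using True by simp
        qed
      next
        case False
        have "norm x \<le> norm (x + h n *\<^sub>R ?e) + h n"
          using norm_triangle_ineq4[of "x + h n *\<^sub>R ?e" "h n *\<^sub>R ?e"] h(1)[of n] by simp
        with False h(2)[of n] have out: "x \<notin> cball 0 R" "x + h n *\<^sub>R ?e \<notin> cball 0 R"
          by auto
        from supp[OF out(1)] supp[OF out(2)] show ?thesis
          using B(1) by simp
      qed
    qed
  qed measurable
  then have "(\<lambda>n::nat. 0 :: complex) \<longlonglongrightarrow> (\<integral>x. ?G x \<partial>lborel)"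
    by (simp only: D_int)
  then show ?thesis
    by (simp add: LIMSEQ_const_iff)
qed

lemma integration_by_parts:
  assumes "\<phi> \<in> test_functions" "\<eta> \<in> test_functions"
  shows "(\<integral>x. \<phi> x * partial_deriv i \<eta> x \<partial>lborel) = - (\<integral>x. partial_deriv i \<phi> x * \<eta> x \<partial>lborel)"
proof -
  from assms(1) obtain R where R: "\<And>x. x \<notin> cball 0 R \<Longrightarrow> \<phi> x = 0"
    by (rule test_function_bounded_support) blast
  have s: "smooth \<phi>" "smooth \<eta>" "smooth (partial_deriv i \<phi>)" "smooth (partial_deriv i \<eta>)"
    using assms test_function_partial_deriv by (auto simp: test_functions_def)
  note c = s[THEN smooth_continuous]
  let ?F' = "\<lambda>x h. \<phi> x * frechet_derivative \<eta> (at x) h + frechet_derivative \<phi> (at x) h * \<eta> x"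
  have F': "((\<lambda>x. \<phi> x * \<eta> x) has_derivative ?F' x) (at x)" for x
    by (intro has_derivative_mult smooth_has_derivative s)
  have eq: "?F' x (axis i 1) = \<phi> x * partial_deriv i \<eta> x + partial_deriv i \<phi> x * \<eta> x" for x
    by (simp add: partial_deriv_def)
  have "(\<integral>x. ?F' x (axis i 1) \<partial>lborel) = 0"
    by (rule integral_partial_deriv_eq_0[OF F', of R])
      (use R in \<open>auto simp: eq intro!: continuous_intros c\<close>)
  then have "(\<integral>x. \<phi> x * partial_deriv i \<eta> x + partial_deriv i \<phi> x * \<eta> x \<partial>lborel) = 0"
    by (simp only: eq)
  moreover have "integrable lborel (\<lambda>x. \<phi> x * partial_deriv i \<eta> x)"
    by (rule integrable_continuous_bounded_support[of _ R]) (use R in \<open>auto intro!: continuous_intros c\<close>)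
  moreover have "partial_deriv i \<phi> x = 0" if "x \<notin> cball 0 R" for x
    using has_derivative_outside_support[OF R smooth_has_derivative[OF s(1)] that]
    by (simp add: partial_deriv_def)
  then have "integrable lborel (\<lambda>x. partial_deriv i \<phi> x * \<eta> x)"
    by (intro integrable_continuous_bounded_support[of _ R]) (auto intro!: continuous_intros c)
  ultimately show ?thesis
    by (simp add: eq_neg_iff_add_eq_0)
qed

text \<open>
  Each integration by parts moves the outermost derivative, so the derivatives arrive in
  reverse order.
\<close>

lemma iterated_integration_by_parts:
  assumes "\<phi> \<in> test_functions" "\<eta> \<in> test_functions"
  shows "(\<integral>x. \<phi> x * partial_derivs \<alpha> \<eta> x \<partial>lborel) =
    (-1) ^ length \<alpha> * (\<integral>x. partial_derivs (rev \<alpha>) \<phi> x * \<eta> x \<partial>lborel)"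
  using assms(1)
proof (induction \<alpha> arbitrary: \<phi>)
  case (Cons i \<alpha>)
  show ?case
    using integration_by_parts[OF Cons.prems test_function_partial_derivs[OF assms(2), of \<alpha>], of i]
      Cons.IH[OF test_function_partial_deriv[OF Cons.prems, of i]]
    by (simp add: partial_derivs_append)
next
  case Nil
  show ?case
    by simp
qed

subsection \<open>Borel representatives\<close>

text \<open>
  The definitions use the completed measure; replacing all functions by Borel functions makes
  Fubini arguments available on the product of the uncompleted measures.
\<close>

lemma integral_lebesgue_eq_lborel:
  fixes F G :: "real^'n \<Rightarrow> complex"
  assumes G [measurable]: "G \<in> borel_measurable borel" and "AE x in lborel. F x = G x"
  shows "(\<integral>x. F x \<partial>lebesgue) = (\<integral>x. G x \<partial>lborel)"
proof -
  have AE: "AE x in lebesgue. F x = G x"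
    using assms(2) by (rule AE_completion)
  have Gm: "G \<in> borel_measurable lebesgue"
    using G by (simp add: measurable_completion)
  have "AE x in lebesgue. G x = F x"
    using AE by eventually_elim simp
  from borel_measurable_AE[OF Gm this] have "F \<in> borel_measurable lebesgue" .
  with Gm AE have "(\<integral>x. F x \<partial>lebesgue) = (\<integral>x. G x \<partial>lebesgue)"
    by (intro integral_cong_AE)
  also have "\<dots> = (\<integral>x. G x \<partial>lborel)"
    using G by (intro integral_completion) simp
  finally show ?thesis .
qed

lemma borel_representative:
  fixes f :: "real^'n \<Rightarrow> complex"
  assumes [measurable]: "f \<in> borel_measurable lebesgue"
  obtains g where "g \<in> borel_measurable borel" "AE x in lborel. f x = g x"
proof -
  have "(\<lambda>x. Re (f x)) \<in> borel_measurable lebesgue" "(\<lambda>x. Im (f x)) \<in> borel_measurable lebesgue"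
    by measurable
  from this[THEN completion_ex_borel_measurable_real]
  obtain a b where ab: "a \<in> borel_measurable lborel" "AE x in lborel. Re (f x) = a x"
    "b \<in> borel_measurable lborel" "AE x in lborel. Im (f x) = b x"
    by blast
  have [measurable]: "a \<in> borel_measurable borel" "b \<in> borel_measurable borel"
    using ab(1,3) by simp_all
  show thesis
  proof
    show "(\<lambda>x. Complex (a x) (b x)) \<in> borel_measurable borel"
      unfolding Complex_eq by measurable
    show "AE x in lborel. f x = Complex (a x) (b x)"
      using ab(2,4) by eventually_elim (simp add: complex_eq_iff)
  qed
qed

lemma locally_integrable_measurable:
  fixes f :: "real^'n \<Rightarrow> complex"
  assumes "locally_integrable f"
  shows "f \<in> borel_measurable lebesgue"
proof (rule borel_measurable_LIMSEQ_metric)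
  show "(\<lambda>x. indicator (cball 0 (real n)) x *\<^sub>R f x) \<in> borel_measurable lebesgue" for n
    using assms compact_cball[of "0 :: real^'n" "real n"]
    unfolding locally_integrable_def set_integrable_def by (blast intro: borel_measurable_integrable)
  show "(\<lambda>n. indicator (cball 0 (real n)) x *\<^sub>R f x) \<longlonglongrightarrow> f x" if "x \<in> space lebesgue" for x
  proof (rule tendsto_eventually)
    obtain k :: nat where "norm x \<le> real k"
      using real_arch_simple by blast
    then have "indicator (cball 0 (real n)) x *\<^sub>R f x = f x" if "n \<ge> k" for n
      using that by simp
    then show "\<forall>\<^sub>F n in sequentially. indicator (cball 0 (real n)) x *\<^sub>R f x = f x"
      unfolding eventually_sequentially by blast
  qed
qed

lemma locally_integrable_representative:
  fixes f :: "real^'n \<Rightarrow> complex"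
  assumes "locally_integrable f" and [measurable]: "g \<in> borel_measurable borel"
    and eq: "AE x in lborel. f x = g x"
  shows "locally_summable g"
  unfolding locally_summable_def
proof (intro conjI allI)
  fix R
  have "integrable lebesgue (\<lambda>x. indicator (cball 0 R) x *\<^sub>R f x)"
    using assms(1) compact_cball[of "0 :: real^'n" R]
    unfolding locally_integrable_def set_integrable_def by blast
  then have "(\<integral>\<^sup>+x. ennreal (norm (indicator (cball 0 R) x *\<^sub>R f x)) \<partial>lebesgue) < \<infinity>"
    by (simp add: integrable_iff_bounded)
  also have "(\<integral>\<^sup>+x. ennreal (norm (indicator (cball 0 R) x *\<^sub>R f x)) \<partial>lebesgue) =
      (\<integral>\<^sup>+x. ennreal (norm (g x)) * indicator (cball 0 R) x \<partial>lborel)"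
    unfolding nn_integral_completion
    by (rule nn_integral_cong_AE) (use eq in eventually_elim, simp add: indicator_def)
  finally show "(\<integral>\<^sup>+x. ennreal (norm (g x)) * indicator (cball 0 R) x \<partial>lborel) < \<infinity>" .
qed simp

lemma L2_representative:
  fixes f :: "real^'n \<Rightarrow> complex"
  assumes "f \<in> L2"
  obtains g where "square_summable g" "AE x in lborel. f x = g x"
proof -
  from assms have m: "f \<in> borel_measurable lebesgue" and i: "integrable lebesgue (\<lambda>x. (norm (f x))\<^sup>2)"
    by (simp_all add: L2_def)
  obtain g where g: "g \<in> borel_measurable borel" "AE x in lborel. f x = g x"
    using borel_representative[OF m] .
  have "(\<integral>\<^sup>+x. ennreal ((norm (f x))\<^sup>2) \<partial>lebesgue) < \<infinity>"
    using i by (simp add: integrable_iff_bounded)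
  also have "(\<integral>\<^sup>+x. ennreal ((norm (f x))\<^sup>2) \<partial>lebesgue) = (\<integral>\<^sup>+x. ennreal ((norm (g x))\<^sup>2) \<partial>lborel)"
    unfolding nn_integral_completion
    by (rule nn_integral_cong_AE) (use g(2) in eventually_elim, simp)
  finally have "square_summable g"
    using g(1) by (simp add: square_summable_def)
  with g(2) show thesis
    using that by blast
qed

lemma square_summable_add:
  assumes "square_summable f" "square_summable g"
  shows "square_summable (\<lambda>x. f x + g x)"
proof -
  have [measurable]: "f \<in> borel_measurable borel" "g \<in> borel_measurable borel"
    using assms by (simp_all add: square_summable_def)
  have "(\<integral>\<^sup>+x. ennreal ((norm (f x + g x))\<^sup>2) \<partial>lborel) \<le>
      (\<integral>\<^sup>+x. 2 * ennreal ((norm (f x))\<^sup>2) + 2 * ennreal ((norm (g x))\<^sup>2) \<partial>lborel)"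
  proof (rule nn_integral_mono)
    fix x
    have "(norm (f x + g x))\<^sup>2 \<le> (norm (f x) + norm (g x))\<^sup>2"
      by (intro power_mono norm_triangle_ineq) simp
    also have "\<dots> \<le> 2 * (norm (f x))\<^sup>2 + 2 * (norm (g x))\<^sup>2"
      using zero_le_power2[of "norm (f x) - norm (g x)"] by (simp add: power2_sum power2_diff)
    finally have "ennreal ((norm (f x + g x))\<^sup>2) \<le> ennreal (2 * (norm (f x))\<^sup>2 + 2 * (norm (g x))\<^sup>2)"
      by (rule ennreal_leI)
    then show "ennreal ((norm (f x + g x))\<^sup>2) \<le> 2 * ennreal ((norm (f x))\<^sup>2) + 2 * ennreal ((norm (g x))\<^sup>2)"
      by (simp add: ennreal_plus ennreal_mult)
  qed
  also have "\<dots> = 2 * (\<integral>\<^sup>+x. ennreal ((norm (f x))\<^sup>2) \<partial>lborel) + 2 * (\<integral>\<^sup>+x. ennreal ((norm (g x))\<^sup>2) \<partial>lborel)"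
    by (subst nn_integral_add) (auto simp: nn_integral_cmult)
  also have "\<dots> < \<infinity>"
    using assms by (simp add: square_summable_def ennreal_mult_less_top)
  finally show ?thesis
    by (simp add: square_summable_def)
qed

lemma square_summable_cmult:
  assumes "square_summable f"
  shows "square_summable (\<lambda>x. c * f x)"
proof -
  have [measurable]: "f \<in> borel_measurable borel"
    using assms by (simp add: square_summable_def)
  have "(\<integral>\<^sup>+x. ennreal ((norm (c * f x))\<^sup>2) \<partial>lborel) =
      ennreal ((norm c)\<^sup>2) * (\<integral>\<^sup>+x. ennreal ((norm (f x))\<^sup>2) \<partial>lborel)"
    by (subst nn_integral_cmult[symmetric]) (auto simp: norm_mult power_mult_distrib ennreal_mult)
  also have "\<dots> < \<infinity>"
    using assms by (simp add: square_summable_def ennreal_mult_less_top)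
  finally show ?thesis
    by (simp add: square_summable_def)
qed

lemma square_summable_sum:
  "finite A \<Longrightarrow> (\<And>i. i \<in> A \<Longrightarrow> square_summable (f i)) \<Longrightarrow> square_summable (\<lambda>x. \<Sum>i\<in>A. f i x)"
proof (induction A rule: finite_induct)
  case empty
  show ?case
    by (simp add: square_summable_def)
next
  case (insert a A)
  then show ?case
    by (simp add: square_summable_add)
qed

lemma test_function_continuous: "\<phi> \<in> test_functions \<Longrightarrow> continuous_on UNIV \<phi>"
  by (simp add: test_functions_def smooth_continuous)

lemma test_function_borel: "\<phi> \<in> test_functions \<Longrightarrow> \<phi> \<in> borel_measurable borel"
  by (rule borel_measurable_continuous_onI[OF test_function_continuous])

lemma test_function_laplacian:
  assumes "\<phi> \<in> test_functions"
  shows "laplacian \<phi> \<in> borel_measurable borel"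
  unfolding laplacian_def[abs_def]
  by (intro borel_measurable_sum test_function_borel test_function_partial_derivs assms)

lemma integrable_mult_test_function:
  fixes f :: "real^'n \<Rightarrow> complex"
  assumes f: "locally_summable f" and \<phi>: "\<phi> \<in> test_functions"
  shows "integrable lborel (\<lambda>x. f x * \<phi> x)"
proof -
  have [measurable]: "f \<in> borel_measurable borel" "\<phi> \<in> borel_measurable borel"
    using f \<phi> by (simp_all add: locally_summable_def test_function_borel)
  obtain R where R: "\<And>x. x \<notin> cball 0 R \<Longrightarrow> \<phi> x = 0"
    using \<phi> by (rule test_function_bounded_support) blast
  have "bounded (\<phi> ` cball 0 R)"
    by (intro compact_imp_bounded compact_continuous_image
        continuous_on_subset[OF test_function_continuous[OF \<phi>]]) auto
  then obtain B where B: "B > 0" "\<And>x. x \<in> cball 0 R \<Longrightarrow> norm (\<phi> x) \<le> B"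
    unfolding bounded_pos by blast
  show ?thesis
  proof (rule Bochner_Integration.integrable_bound)
    have "set_integrable lborel (cball 0 R) (\<lambda>x. norm (f x - 0))"
      by (rule locally_summable_set_integrable[OF f]) auto
    then show "integrable lborel (\<lambda>x. B * (norm (f x) * indicator (cball 0 R) x))"
      unfolding set_integrable_def by (auto simp: mult.commute)
    show "AE x in lborel. norm (f x * \<phi> x) \<le> norm (B * (norm (f x) * indicator (cball 0 R) x))"
    proof (rule AE_I2)
      fix x
      show "norm (f x * \<phi> x) \<le> norm (B * (norm (f x) * indicator (cball 0 R) x))"
        using B(1) mult_right_mono[OF B(2)[of x], of "norm (f x)"] R[of x]
        by (cases "x \<in> cball 0 R") (simp_all add: norm_mult abs_mult mult.commute)
    qed
  qed measurable
qed

lemma integrable_mult_laplacian: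
  fixes f :: "real^'n \<Rightarrow> complex"
  assumes "locally_summable f" "\<phi> \<in> test_functions"
  shows "integrable lborel (\<lambda>x. f x * laplacian \<phi> x)"
proof -
  have "integrable lborel (\<lambda>x. f x * partial_derivs [i, i] \<phi> x)" for i
    by (rule integrable_mult_test_function[OF assms(1) test_function_partial_derivs[OF assms(2)]])
  then have "integrable lborel (\<lambda>x. \<Sum>i\<in>UNIV. f x * partial_derivs [i, i] \<phi> x)"
    by (rule Bochner_Integration.integrable_sum)
  then show ?thesis
    by (simp only: laplacian_def sum_distrib_left)
qed

text \<open>
  Together with the next lemmas this makes the choice in \<open>weak_deriv\<close> harmless: whatever function
  is chosen agrees almost everywhere with the classical derivative of a test function, and with a
  square integrable function for an element of \<open>H\<^sup>2\<close>.
\<close>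

lemma weak_derivative_unique:
  fixes f :: "real^3 \<Rightarrow> complex"
  assumes "has_weak_deriv \<alpha> f g" "has_weak_deriv \<alpha> f h"
  shows "AE x in lborel. g x = h x"
proof -
  have li: "locally_integrable g" "locally_integrable h"
    and weak: "\<forall>\<phi>\<in>test_functions. (\<integral>x. f x * partial_derivs \<alpha> \<phi> x \<partial>lebesgue) =
        (-1) ^ length \<alpha> * (\<integral>x. g x * \<phi> x \<partial>lebesgue)"
      "\<forall>\<phi>\<in>test_functions. (\<integral>x. f x * partial_derivs \<alpha> \<phi> x \<partial>lebesgue) =
        (-1) ^ length \<alpha> * (\<integral>x. h x * \<phi> x \<partial>lebesgue)"
    using assms by (simp_all add: has_weak_deriv_def)
  obtain g' where g': "g' \<in> borel_measurable borel" "AE x in lborel. g x = g' x"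
    using borel_representative[OF locally_integrable_measurable[OF li(1)]] .
  obtain h' where h': "h' \<in> borel_measurable borel" "AE x in lborel. h x = h' x"
    using borel_representative[OF locally_integrable_measurable[OF li(2)]] .
  note [measurable] = g'(1) h'(1)
  have ls: "locally_summable g'" "locally_summable h'"
    using locally_integrable_representative li g' h' by blast+
  have "locally_summable (\<lambda>x. g' x - h' x)"
    unfolding locally_summable_def
  proof (intro conjI allI)
    fix R
    have "(\<integral>\<^sup>+x. ennreal (norm (g' x - h' x)) * indicator (cball 0 R) x \<partial>lborel) \<le>
        (\<integral>\<^sup>+x. ennreal (norm (g' x)) * indicator (cball 0 R) x +
          ennreal (norm (h' x)) * indicator (cball 0 R) x \<partial>lborel)"
      by (intro nn_integral_mono)
        (auto simp: indicator_def norm_triangle_ineq4 ennreal_leI simp flip: ennreal_plus)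
    also have "\<dots> < \<infinity>"
      using ls by (subst nn_integral_add) (auto simp: locally_summable_def)
    finally show "(\<integral>\<^sup>+x. ennreal (norm (g' x - h' x)) * indicator (cball 0 R) x \<partial>lborel) < \<infinity>" .
  qed measurable
  moreover have "(\<integral>x. (g' x - h' x) * \<phi> x \<partial>lborel) = 0" if \<phi>: "\<phi> \<in> test_functions" for \<phi>
  proof -
    have [measurable]: "\<phi> \<in> borel_measurable borel"
      using \<phi> by (rule test_function_borel)
    have "(-1) ^ length \<alpha> * (\<integral>x. g x * \<phi> x \<partial>lebesgue) = (-1) ^ length \<alpha> * (\<integral>x. h x * \<phi> x \<partial>lebesgue)"
      using bspec[OF weak(1) \<phi>] bspec[OF weak(2) \<phi>] by simp
    then have "(\<integral>x. g x * \<phi> x \<partial>lebesgue) = (\<integral>x. h x * \<phi> x \<partial>lebesgue)"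
      by simp
    moreover have "(\<integral>x. g x * \<phi> x \<partial>lebesgue) = (\<integral>x. g' x * \<phi> x \<partial>lborel)"
      by (rule integral_lebesgue_eq_lborel) (measurable, use g'(2) in eventually_elim, simp)
    moreover have "(\<integral>x. h x * \<phi> x \<partial>lebesgue) = (\<integral>x. h' x * \<phi> x \<partial>lborel)"
      by (rule integral_lebesgue_eq_lborel) (measurable, use h'(2) in eventually_elim, simp)
    ultimately show ?thesis
      by (simp add: left_diff_distrib integrable_mult_test_function ls \<phi>)
  qed
  ultimately have "AE x in lborel. g' x - h' x = 0"
    by (rule du_Bois_Reymond)
  with g'(2) h'(2) show ?thesis
    by eventually_elim simp
qed

lemma test_function_weak_derivative:
  assumes \<phi>: "\<phi> \<in> test_functions"
  shows "has_weak_deriv \<alpha> \<phi> (partial_derivs (rev \<alpha>) \<phi>)"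
proof -
  have li: "locally_integrable \<eta>" if \<eta>: "\<eta> \<in> test_functions" for \<eta> :: "real^'n \<Rightarrow> complex"
    unfolding locally_integrable_def
  proof (intro allI impI)
    fix K :: "(real^'n) set" assume "compact K"
    have "integrable lborel (\<lambda>x. 1 * \<eta> x)"
      by (rule integrable_mult_test_function[OF locally_summable_const \<eta>])
    then have "integrable lebesgue \<eta>"
      using test_function_borel[OF \<eta>] by (simp add: integrable_completion)
    moreover have "K \<in> sets lebesgue"
      using \<open>compact K\<close> by (simp add: compact_imp_closed borel_closed)
    ultimately show "\<eta> absolutely_integrable_on K"
      unfolding set_integrable_def by (intro integrable_mult_indicator)
  qed
  have eq: "(\<integral>x. f x * g x \<partial>lebesgue) = (\<integral>x. f x * g x \<partial>lborel)"
    if "f \<in> test_functions" "g \<in> test_functions" for f g :: "real^'n \<Rightarrow> complex"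
    using that by (intro integral_lebesgue_eq_lborel borel_measurable_times test_function_borel) auto
  show ?thesis
    unfolding has_weak_deriv_def
    using iterated_integration_by_parts[OF \<phi>]
    by (simp add: li \<phi> test_function_partial_derivs eq)
qed

lemma test_function_sobolev_H2:
  fixes \<phi> :: "real^3 \<Rightarrow> complex"
  assumes \<phi>: "\<phi> \<in> test_functions"
  shows "\<phi> \<in> sobolev_H2" and "AE x in lborel. weak_laplacian \<phi> x = laplacian \<phi> x"
proof -
  have L2: "\<eta> \<in> L2" if \<eta>: "\<eta> \<in> test_functions" for \<eta> :: "real^3 \<Rightarrow> complex"
  proof -
    have m: "\<eta> \<in> borel_measurable borel"
      using \<eta> by (rule test_function_borel)
    then have "locally_summable \<eta>"
      using test_function_weak_derivative[OF \<eta>, of "[]"]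
      by (intro locally_integrable_representative[of \<eta> \<eta>]) (auto simp: has_weak_deriv_def)
    from integrable_norm[OF integrable_mult_test_function[OF this \<eta>]]
    have "integrable lborel (\<lambda>x. (norm (\<eta> x))\<^sup>2)"
      by (simp add: norm_mult power2_eq_square)
    then have "integrable lebesgue (\<lambda>x. (norm (\<eta> x))\<^sup>2)"
      using m by (subst integrable_completion) auto
    then show ?thesis
      using m by (simp add: L2_def measurable_completion)
  qed
  show "\<phi> \<in> sobolev_H2"
    unfolding sobolev_H2_def
    using L2[OF \<phi>] L2[OF test_function_partial_derivs[OF \<phi>]] test_function_weak_derivative[OF \<phi>] by blast
  have "AE x in lborel. weak_deriv [i, i] \<phi> x = partial_derivs [i, i] \<phi> x" for i
  proof (rule weak_derivative_unique)
    show d: "has_weak_deriv [i, i] \<phi> (partial_derivs [i, i] \<phi>)"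
      using test_function_weak_derivative[OF \<phi>, of "[i, i]"] by simp
    show "has_weak_deriv [i, i] \<phi> (weak_deriv [i, i] \<phi>)"
      unfolding weak_deriv_def by (rule someI[of "has_weak_deriv [i, i] \<phi>", OF d])
  qed
  then have "AE x in lborel. \<forall>i\<in>UNIV. weak_deriv [i, i] \<phi> x = partial_derivs [i, i] \<phi> x"
    by (intro AE_finite_allI) auto
  then show "AE x in lborel. weak_laplacian \<phi> x = laplacian \<phi> x"
    by eventually_elim (simp add: weak_laplacian_def laplacian_def)
qed

lemma sobolev_H2_representatives:
  fixes \<psi> :: "real^3 \<Rightarrow> complex"
  assumes "\<psi> \<in> sobolev_H2"
  obtains \<psi>' u where "square_summable \<psi>'" "square_summable u"
    "AE x in lborel. \<psi> x = \<psi>' x" "AE x in lborel. weak_laplacian \<psi> x = u x"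
    "\<And>\<phi>. \<phi> \<in> test_functions \<Longrightarrow> (\<integral>x. \<psi>' x * laplacian \<phi> x \<partial>lborel) = (\<integral>x. u x * \<phi> x \<partial>lborel)"
proof -
  have "\<psi> \<in> L2"
    using assms by (simp add: sobolev_H2_def)
  then obtain \<psi>' where \<psi>': "square_summable \<psi>'" "AE x in lborel. \<psi> x = \<psi>' x"
    by (rule L2_representative)
  have "\<exists>g'. square_summable g' \<and> has_weak_deriv [i, i] \<psi> (weak_deriv [i, i] \<psi>) \<and>
      (AE x in lborel. weak_deriv [i, i] \<psi> x = g' x)" for i
  proof -
    obtain g where g: "g \<in> L2" "has_weak_deriv [i, i] \<psi> g"
    proof -
      have "\<forall>\<alpha>. length \<alpha> \<le> 2 \<longrightarrow> (\<exists>g\<in>L2. has_weak_deriv \<alpha> \<psi> g)"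
        using assms by (simp add: sobolev_H2_def)
      from spec[OF this, of "[i, i]"] show ?thesis
        using that by auto
    qed
    obtain g' where g': "square_summable g'" "AE x in lborel. g x = g' x"
      using g(1) by (rule L2_representative)
    have d: "has_weak_deriv [i, i] \<psi> (weak_deriv [i, i] \<psi>)"
      unfolding weak_deriv_def by (rule someI[of "has_weak_deriv [i, i] \<psi>", OF g(2)])
    have "AE x in lborel. weak_deriv [i, i] \<psi> x = g' x"
      using weak_derivative_unique[OF d g(2)] g'(2) by eventually_elim simp
    with g'(1) d show ?thesis
      by blast
  qed
  then obtain g where g: "\<And>i. square_summable (g i)"
    "\<And>i. has_weak_deriv [i, i] \<psi> (weak_deriv [i, i] \<psi>)"
    "\<And>i. AE x in lborel. weak_deriv [i, i] \<psi> x = g i x"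
    by metis
  have gm: "g i \<in> borel_measurable borel" "\<psi>' \<in> borel_measurable borel" for i
    using g(1)[of i] \<psi>'(1) by (simp_all add: square_summable_def)
  show thesis
  proof
    show "square_summable \<psi>'" "AE x in lborel. \<psi> x = \<psi>' x"
      by (fact \<psi>')+
    show "square_summable (\<lambda>x. \<Sum>i\<in>UNIV. g i x)"
      by (intro square_summable_sum g(1)) simp
    have "AE x in lborel. \<forall>i\<in>UNIV. weak_deriv [i, i] \<psi> x = g i x"
      by (intro AE_finite_allI g(3)) auto
    then show "AE x in lborel. weak_laplacian \<psi> x = (\<Sum>i\<in>UNIV. g i x)"
      by eventually_elim (simp add: weak_laplacian_def)
    fix \<phi> :: "real^3 \<Rightarrow> complex" assume \<phi>: "\<phi> \<in> test_functions"
    have "(\<integral>x. \<psi>' x * partial_derivs [i, i] \<phi> x \<partial>lborel) = (\<integral>x. g i x * \<phi> x \<partial>lborel)" for i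
    proof -
      have "(\<integral>x. \<psi>' x * partial_derivs [i, i] \<phi> x \<partial>lborel) = (\<integral>x. \<psi> x * partial_derivs [i, i] \<phi> x \<partial>lebesgue)"
        by (rule integral_lebesgue_eq_lborel[symmetric])
          (intro borel_measurable_times gm test_function_borel test_function_partial_derivs \<phi>,
           use \<psi>'(2) in eventually_elim, simp)
      also have "\<dots> = (-1) ^ length [i, i] * (\<integral>x. weak_deriv [i, i] \<psi> x * \<phi> x \<partial>lebesgue)"
        using g(2)[of i] \<phi> unfolding has_weak_deriv_def by blast
      also have "\<dots> = (\<integral>x. weak_deriv [i, i] \<psi> x * \<phi> x \<partial>lebesgue)"
        by simp
      also have "\<dots> = (\<integral>x. g i x * \<phi> x \<partial>lborel)"
        by (rule integral_lebesgue_eq_lborel)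
          (intro borel_measurable_times gm test_function_borel \<phi>,
           use g(3)[of i] in eventually_elim, simp)
      finally show ?thesis .
    qed
    moreover have "integrable lborel (\<lambda>x. \<psi>' x * partial_derivs [i, i] \<phi> x)" for i
      by (intro integrable_mult_test_function square_summable_imp_locally_summable \<psi>'(1)
          test_function_partial_derivs \<phi>)
    moreover have "integrable lborel (\<lambda>x. g i x * \<phi> x)" for i
      by (intro integrable_mult_test_function square_summable_imp_locally_summable g(1) \<phi>)
    ultimately show "(\<integral>x. \<psi>' x * laplacian \<phi> x \<partial>lborel) = (\<integral>x. (\<Sum>i\<in>UNIV. g i x) * \<phi> x \<partial>lborel)"
      unfolding laplacian_def sum_distrib_left sum_distrib_right
      by (simp only: Bochner_Integration.integral_sum)
  qed
qed

lemma partial_deriv_cnj: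
  assumes "smooth f"
  shows "partial_deriv i (\<lambda>x. cnj (f x)) = (\<lambda>x. cnj (partial_deriv i f x))"
proof -
  have "((\<lambda>x. cnj (f x)) has_derivative (\<lambda>h. cnj (frechet_derivative f (at x) h))) (at x)" for x
    by (rule bounded_linear.has_derivative[OF bounded_linear_cnj smooth_has_derivative[OF assms]])
  from partial_deriv_eq[OF this] show ?thesis
    by (simp add: partial_deriv_def)
qed

lemma test_function_cnj:
  assumes \<phi>: "\<phi> \<in> test_functions"
  shows "(\<lambda>x. cnj (\<phi> x)) \<in> test_functions"
    and "laplacian (\<lambda>x. cnj (\<phi> x)) = (\<lambda>x. cnj (laplacian \<phi> x))"
proof -
  have s: "smooth \<phi>"
    using \<phi> by (simp add: test_functions_def)
  have pd: "partial_derivs \<alpha> (\<lambda>x. cnj (\<phi> x)) = (\<lambda>x. cnj (partial_derivs \<alpha> \<phi> x))" for \<alpha>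
    by (induction \<alpha>) (simp_all add: partial_deriv_cnj smooth_partial_derivs[OF s])
  have "(\<lambda>x. cnj (partial_derivs \<alpha> \<phi> x)) differentiable_on UNIV" for \<alpha>
  proof -
    have "(\<lambda>x. cnj (partial_derivs \<alpha> \<phi> x)) differentiable at x" for x
      unfolding differentiable_def
      using bounded_linear.has_derivative[OF bounded_linear_cnj
          smooth_has_derivative[OF smooth_partial_derivs[OF s, of \<alpha>]]] by blast
    then show ?thesis
      by (simp add: differentiable_on_def)
  qed
  then have "smooth (\<lambda>x. cnj (\<phi> x))"
    by (simp add: smooth_def pd)
  then show "(\<lambda>x. cnj (\<phi> x)) \<in> test_functions"
    using \<phi> by (simp add: test_functions_def)
  show "laplacian (\<lambda>x. cnj (\<phi> x)) = (\<lambda>x. cnj (laplacian \<phi> x))"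
    by (simp add: laplacian_def[abs_def] pd del: partial_derivs_Cons)
qed

text \<open>
  The eigenvalue equation tested with conjugates of test functions: the weak derivatives of
  the test function become classical ones.
\<close>

lemma eigenfunction_weak_equation:
  assumes eigen: "(\<psi>, \<lambda>x. \<mu> * \<psi> x) \<in> schroedinger_operator V"
    and [measurable]: "V' \<in> borel_measurable borel" "\<psi>' \<in> borel_measurable borel" "u \<in> borel_measurable borel"
    and V: "AE x in lborel. V x = V' x" and \<psi>: "AE x in lborel. \<psi> x = \<psi>' x"
    and u: "AE x in lborel. weak_laplacian \<psi> x = u x"
    and \<phi>: "\<phi> \<in> test_functions"
  shows "(\<integral>x. u x * laplacian \<phi> x \<partial>lborel) + (\<integral>x. (V' x * \<psi>' x) * \<phi> x \<partial>lborel) =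
    \<mu> * (\<integral>x. \<psi>' x * \<phi> x \<partial>lborel)"
proof -
  have [measurable]: "\<phi> \<in> borel_measurable borel" "laplacian \<phi> \<in> borel_measurable borel"
    using \<phi> by (simp_all add: test_function_borel test_function_laplacian)
  let ?\<eta> = "\<lambda>x. cnj (\<phi> x)"
  have \<eta>: "?\<eta> \<in> sobolev_H2" "AE x in lborel. weak_laplacian ?\<eta> x = cnj (laplacian \<phi> x)"
    using test_function_sobolev_H2[OF test_function_cnj(1)[OF \<phi>]] test_function_cnj(2)[OF \<phi>] by simp_all
  have "schroedinger_form V ?\<eta> \<psi> = (\<integral>x. cnj (?\<eta> x) * (\<mu> * \<psi> x) \<partial>lebesgue)"
    using eigen \<eta>(1) by (simp add: schroedinger_operator_def)
  moreover have "(\<integral>x. cnj (?\<eta> x) * (\<mu> * \<psi> x) \<partial>lebesgue) = (\<integral>x. \<mu> * (\<psi>' x * \<phi> x) \<partial>lborel)"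
    by (rule integral_lebesgue_eq_lborel) (measurable, use \<psi> in eventually_elim, simp)
  moreover have "(\<integral>x. cnj (weak_laplacian ?\<eta> x) * weak_laplacian \<psi> x \<partial>lebesgue) =
      (\<integral>x. u x * laplacian \<phi> x \<partial>lborel)"
    by (rule integral_lebesgue_eq_lborel) (measurable, use \<eta>(2) u in eventually_elim, simp)
  moreover have "(\<integral>x. V x * cnj (?\<eta> x) * \<psi> x \<partial>lebesgue) = (\<integral>x. (V' x * \<psi>' x) * \<phi> x \<partial>lborel)"
    by (rule integral_lebesgue_eq_lborel) (measurable, use V \<psi> in eventually_elim, simp)
  ultimately show ?thesis
    by (simp add: schroedinger_form_def)
qed

section \<open>Kernel estimates\<close>

text \<open>
  The hypothesis forces \<open>b = \<plusminus> i a\<close>, so that the phases of the two exponentials differ by exactly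
  \<open>Re a + Re b\<close>. Either this angle has nonnegative cosine, or it exceeds \<open>\<pi> / 2\<close> and both
  exponentials together are already small.
\<close>

lemma norm_exp_diff_le_sqrt2:
  fixes a b :: complex
  assumes "Re a \<ge> 0" "Re b \<ge> 0" "b\<^sup>2 = - a\<^sup>2"
  shows "norm (exp (- a) - exp (- b)) \<le> sqrt 2"
proof -
  define s t where "s = Re a" and "t = Re b"
  have st: "s \<ge> 0" "t \<ge> 0"
    using assms by (simp_all add: s_def t_def)
  have "(b - \<i> * a) * (b + \<i> * a) = 0"
    using assms(3) by (simp add: algebra_simps power2_eq_square)
  then have "b = \<i> * a \<or> b = - (\<i> * a)"
    by (auto simp: eq_neg_iff_add_eq_0)
  then have "Im a - Im b = s + t \<or> Im a - Im b = - (s + t)"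
    by (auto simp: s_def t_def)
  then have cos: "cos (Im a - Im b) = cos (s + t)"
    by (metis cos_minus)
  define x y where "x = exp (- s)" and "y = exp (- t)"
  have xy: "0 < x" "x \<le> 1" "0 < y" "y \<le> 1"
    using st by (simp_all add: x_def y_def)
  have "(norm (exp (- a) - exp (- b)))\<^sup>2 =
      (x * cos (Im a) - y * cos (Im b))\<^sup>2 + (x * sin (Im a) - y * sin (Im b))\<^sup>2"
    unfolding cmod_power2 by (simp add: Re_exp Im_exp x_def y_def s_def t_def power2_eq_square algebra_simps)
  also have "\<dots> = x\<^sup>2 * ((sin (Im a))\<^sup>2 + (cos (Im a))\<^sup>2) + y\<^sup>2 * ((sin (Im b))\<^sup>2 + (cos (Im b))\<^sup>2)
      - 2 * (x * y) * cos (Im a - Im b)"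
    unfolding cos_diff by algebra
  also have "\<dots> = x\<^sup>2 + y\<^sup>2 - 2 * (x * y) * cos (s + t)"
    by (simp add: cos)
  also have "\<dots> \<le> 2"
  proof (cases "s + t \<le> pi / 2")
    case True
    with st have "cos (s + t) \<ge> 0"
      by (intro cos_ge_zero) auto
    with xy have "2 * (x * y) * cos (s + t) \<ge> 0"
      by simp
    moreover have "x\<^sup>2 \<le> 1" "y\<^sup>2 \<le> 1"
      using xy by (simp_all add: power_le_one)
    ultimately show ?thesis
      by linarith
  next
    case False
    have "5 / 2 \<le> exp (3 / 2 :: real)"
      using exp_ge_add_one_self[of "3 / 2"] by simp
    also have "exp (3 / 2) \<le> exp (s + t)"
      using False pi_gt3 by simp
    finally have "inverse (exp (s + t)) \<le> inverse (5 / 2)"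
      by (intro le_imp_inverse_le) auto
    then have small: "x * y \<le> 2 / 5"
      by (simp add: x_def y_def exp_minus[symmetric] exp_add[symmetric] add.commute)
    have "0 \<le> (1 - x) * (1 - y)"
      using xy by simp
    then have sum: "x + y \<le> 7 / 5"
      using small by (simp add: algebra_simps)
    have "- (2 * (x * y) * cos (s + t)) \<le> 2 * (x * y)"
      using xy mult_left_mono[of "- cos (s + t)" 1 "2 * (x * y)"] by simp
    then have "x\<^sup>2 + y\<^sup>2 - 2 * (x * y) * cos (s + t) \<le> (x + y)\<^sup>2"
      by (simp add: power2_sum)
    also have "\<dots> \<le> (7 / 5)\<^sup>2"
      using sum xy by (intro power_mono) auto
    finally show ?thesis
      by (simp add: power2_eq_square)
  qed
  finally show ?thesis
    by (rule real_le_rsqrt)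
qed

lemma norm_yukawa_diff_le:
  assumes "Re w \<ge> 0" "Re z \<ge> 0" "z\<^sup>2 = - w\<^sup>2" "r \<ge> 0"
  shows "norm (yukawa w r - yukawa z r) \<le> sqrt 2 / (4 * pi) * (1 / r)"
proof -
  have "norm (exp (- (w * of_real r)) - exp (- (z * of_real r))) \<le> sqrt 2"
    using assms by (intro norm_exp_diff_le_sqrt2) (simp_all add: power_mult_distrib)
  then have "norm (exp (- (w * of_real r)) - exp (- (z * of_real r))) / (4 * pi * r) \<le> sqrt 2 / (4 * pi * r)"
    using assms(4) by (intro divide_right_mono) auto
  moreover have "norm (yukawa w r - yukawa z r) =
      norm (exp (- (w * of_real r)) - exp (- (z * of_real r))) / (4 * pi * r)"
    using assms(4) by (simp add: yukawa_def norm_divide norm_mult flip: diff_divide_distrib)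
  ultimately show ?thesis
    by simp
qed

definition coulomb :: "real^3 \<Rightarrow> real^3 \<Rightarrow> ennreal" where
  "coulomb x y = ennreal (1 / norm (x - y))"

lemma coulomb_commute: "coulomb x y = coulomb y x"
  by (simp add: coulomb_def norm_minus_commute)

lemma measurable_coulomb [measurable]:
  "f \<in> M \<rightarrow>\<^sub>M borel \<Longrightarrow> g \<in> M \<rightarrow>\<^sub>M borel \<Longrightarrow> (\<lambda>x. coulomb (f x) (g x)) \<in> borel_measurable M"
  unfolding coulomb_def by measurable

lemma norm_yukawa_le_coulomb:
  assumes "Re w \<ge> 0"
  shows "ennreal (norm (yukawa w (norm (x - y)))) \<le> coulomb x y"
proof (cases "x = y")
  case False
  then have "norm (yukawa w (norm (x - y))) \<le> 1 / (4 * pi * norm (x - y))"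
    using assms by (intro norm_yukawa_le) auto
  also have "\<dots> \<le> 1 / (1 * norm (x - y))"
    using False pi_gt3 by (intro divide_left_mono mult_right_mono) auto
  finally show ?thesis
    by (simp add: coulomb_def ennreal_leI)
qed (simp add: yukawa_def)

definition yukawa_mass :: ennreal where
  "yukawa_mass = (\<integral>\<^sup>+x. ennreal (norm (yukawa 1 (norm (x :: real^3)))) \<partial>lborel)"

lemma yukawa_mass_finite: "yukawa_mass < \<infinity>"
proof -
  have "yukawa_mass = (\<integral>\<^sup>+r. ennreal (4 * pi * r\<^sup>2) * indicator {0..} r * ennreal (norm (yukawa 1 r)) \<partial>lborel)"
    unfolding yukawa_mass_def by (rule nn_integral_radial) measurable
  also have "\<dots> = (\<integral>\<^sup>+r. ennreal (r * exp (- r)) * indicator {0..} r \<partial>lborel)"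
  proof (rule nn_integral_cong)
    fix r :: real
    show "ennreal (4 * pi * r\<^sup>2) * indicator {0..} r * ennreal (norm (yukawa 1 r)) =
        ennreal (r * exp (- r)) * indicator {0..} r"
    proof (cases "r > 0")
      case True
      then have "norm (yukawa 1 r) = exp (- r) / (4 * pi * r)"
        by (simp add: yukawa_def norm_divide norm_mult)
      with True have "4 * pi * r\<^sup>2 * norm (yukawa 1 r) = r * exp (- r)"
        by (simp add: power2_eq_square)
      with True show ?thesis
        by (simp flip: ennreal_mult)
    qed (auto simp: indicator_def)
  qed
  also have "\<dots> = ennreal (0 - (- (poly [:1, 1:] 0 * exp (- 0))))"
  proof (rule nn_integral_FTC_atLeast)
    show "((\<lambda>r. - (poly [:1, 1:] r * exp (- r))) has_real_derivative r * exp (- r)) (at r)" for r :: real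
      by (auto intro!: derivative_eq_intros simp: algebra_simps)
    show "((\<lambda>r::real. - (poly [:1, 1:] r * exp (- r))) \<longlongrightarrow> 0) at_top"
      using tendsto_minus[OF poly_times_exp_minus_tendsto_0[of "[:1, 1:]"]] by simp
  qed auto
  finally show ?thesis
    by simp
qed

text \<open>
  Any point has distance at least \<open>|x - y| / 2\<close> from \<open>x\<close> or from \<open>y\<close>, so one of the two
  factors is bounded by \<open>1 / |x - y|\<close> and the other one is integrated.
\<close>

lemma yukawa_convolution_le:
  assumes "x \<noteq> y"
  shows "(\<integral>\<^sup>+s. ennreal (norm (yukawa 1 (norm (s - x)))) * ennreal (norm (yukawa 1 (norm (s - y)))) \<partial>lborel)
    \<le> 2 * yukawa_mass * coulomb x y"
proof -
  let ?Y = "\<lambda>x s. ennreal (norm (yukawa 1 (norm (s - x :: real^3))))"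
  have far: "?Y z s \<le> coulomb x y" if "norm (s - z) \<ge> norm (x - y) / 2" for z s
  proof -
    have "norm (yukawa 1 (norm (s - z))) \<le> 1 / (4 * pi * (norm (x - y) / 2))"
      using that assms by (intro norm_yukawa_le) auto
    also have "\<dots> \<le> 1 / (1 * norm (x - y))"
      using assms pi_gt3 by (intro divide_left_mono) (auto intro: mult_right_mono)
    finally show ?thesis
      by (simp add: coulomb_def ennreal_leI)
  qed
  have "?Y x s * ?Y y s \<le> coulomb x y * (?Y x s + ?Y y s)" for s
  proof (cases "norm (s - x) \<ge> norm (x - y) / 2")
    case True
    then have "?Y x s * ?Y y s \<le> coulomb x y * ?Y y s"
      by (intro mult_right_mono far) auto
    also have "\<dots> \<le> coulomb x y * (?Y x s + ?Y y s)"
      by (intro mult_left_mono) auto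
    finally show ?thesis .
  next
    case False
    have "norm (x - y) \<le> norm (s - x) + norm (s - y)"
      using norm_triangle_ineq4[of "s - y" "s - x"] by simp
    with False have "norm (s - y) \<ge> norm (x - y) / 2"
      by linarith
    then have "?Y x s * ?Y y s \<le> ?Y x s * coulomb x y"
      by (intro mult_left_mono far) auto
    also have "\<dots> \<le> coulomb x y * (?Y x s + ?Y y s)"
      by (subst mult.commute, intro mult_left_mono) auto
    finally show ?thesis .
  qed
  moreover have mass: "(\<integral>\<^sup>+s. ?Y z s \<partial>lborel) = yukawa_mass" for z
    unfolding yukawa_mass_def
    by (rule nn_integral_lborel_shift[of "\<lambda>x. ennreal (norm (yukawa 1 (norm x)))"]) measurable
  ultimately have "(\<integral>\<^sup>+s. ?Y x s * ?Y y s \<partial>lborel) \<le> (\<integral>\<^sup>+s. coulomb x y * (?Y x s + ?Y y s) \<partial>lborel)"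
    by (intro nn_integral_mono)
  also have "\<dots> = coulomb x y * ((\<integral>\<^sup>+s. ?Y x s \<partial>lborel) + (\<integral>\<^sup>+s. ?Y y s \<partial>lborel))"
    by (subst nn_integral_cmult, measurable) (subst nn_integral_add, measurable)
  also have "\<dots> = 2 * yukawa_mass * coulomb x y"
    unfolding mass mult_2[symmetric] by (simp only: mult_ac)
  finally show ?thesis .
qed

section \<open>The Rollnik form\<close>

definition rollnik_form :: "(real^3 \<Rightarrow> ennreal) \<Rightarrow> ennreal" where
  "rollnik_form g = (\<integral>\<^sup>+x. \<integral>\<^sup>+y. g x * g y * coulomb x y \<partial>lborel \<partial>lborel)"

definition rollnik_square :: "(real^3 \<Rightarrow> ennreal) \<Rightarrow> ennreal" where
  "rollnik_square v = (\<integral>\<^sup>+x. \<integral>\<^sup>+y. v x * v y * (coulomb x y)\<^sup>2 \<partial>lborel \<partial>lborel)"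

text \<open>Cauchy-Schwarz with respect to the product measure with density \<open>v x * v y\<close>.\<close>

lemma rollnik_form_le:
  assumes [measurable]: "v \<in> borel_measurable borel" "g \<in> borel_measurable borel"
  shows "(rollnik_form (\<lambda>x. v x * g x))\<^sup>2 \<le> rollnik_square v * (\<integral>\<^sup>+x. v x * (g x)\<^sup>2 \<partial>lborel)\<^sup>2"
proof -
  define P where "P = (lborel \<Otimes>\<^sub>M lborel :: ((real^3) \<times> (real^3)) measure)"
  define M where "M = density P (\<lambda>z. v (fst z) * v (snd z))"
  have int_M: "(\<integral>\<^sup>+z. h (fst z) (snd z) \<partial>M) = (\<integral>\<^sup>+x. \<integral>\<^sup>+y. v x * v y * h x y \<partial>lborel \<partial>lborel)"
    if h [measurable]: "(\<lambda>z. h (fst z) (snd z)) \<in> borel_measurable (lborel \<Otimes>\<^sub>M lborel)" for h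
  proof -
    have m: "(\<lambda>z. v (fst z) * v (snd z)) \<in> borel_measurable (lborel \<Otimes>\<^sub>M lborel)"
      by measurable
    have "(\<integral>\<^sup>+z. h (fst z) (snd z) \<partial>M) = (\<integral>\<^sup>+z. v (fst z) * v (snd z) * h (fst z) (snd z) \<partial>P)"
      unfolding M_def P_def by (rule nn_integral_density[OF m h])
    also have "\<dots> = (\<integral>\<^sup>+x. \<integral>\<^sup>+y. v x * v y * h x y \<partial>lborel \<partial>lborel)"
      using lborel.nn_integral_fst[OF borel_measurable_times_ennreal[OF m h], symmetric]
      unfolding P_def by simp
    finally show ?thesis .
  qed
  have "(\<integral>\<^sup>+z. coulomb (fst z) (snd z) * (g (fst z) * g (snd z)) \<partial>M)\<^sup>2 \<le>
      (\<integral>\<^sup>+z. (coulomb (fst z) (snd z))\<^sup>2 \<partial>M) * (\<integral>\<^sup>+z. (g (fst z) * g (snd z))\<^sup>2 \<partial>M)"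
    unfolding M_def P_def by (rule Cauchy_Schwarz_nn_integral) measurable
  also have "(\<integral>\<^sup>+z. coulomb (fst z) (snd z) * (g (fst z) * g (snd z)) \<partial>M) = rollnik_form (\<lambda>x. v x * g x)"
    unfolding rollnik_form_def by (subst int_M) (auto intro!: nn_integral_cong simp: mult_ac)
  also have "(\<integral>\<^sup>+z. (coulomb (fst z) (snd z))\<^sup>2 \<partial>M) = rollnik_square v"
    unfolding rollnik_square_def by (subst int_M) auto
  also have "(\<integral>\<^sup>+z. (g (fst z) * g (snd z))\<^sup>2 \<partial>M) = (\<integral>\<^sup>+x. v x * (g x)\<^sup>2 \<partial>lborel)\<^sup>2"
  proof -
    have "(\<integral>\<^sup>+z. (g (fst z) * g (snd z))\<^sup>2 \<partial>M) =
        (\<integral>\<^sup>+x. \<integral>\<^sup>+y. (v x * (g x)\<^sup>2) * (v y * (g y)\<^sup>2) \<partial>lborel \<partial>lborel)"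
      by (subst int_M) (auto intro!: nn_integral_cong simp: power_mult_distrib mult_ac)
    also have "\<dots> = (\<integral>\<^sup>+x. v x * (g x)\<^sup>2 * (\<integral>\<^sup>+y. v y * (g y)\<^sup>2 \<partial>lborel) \<partial>lborel)"
      by (intro nn_integral_cong nn_integral_cmult) measurable
    also have "\<dots> = (\<integral>\<^sup>+x. v x * (g x)\<^sup>2 \<partial>lborel)\<^sup>2"
      by (subst nn_integral_multc) (auto simp: power2_eq_square)
    finally show ?thesis .
  qed
  finally show ?thesis .
qed

text \<open>
  The adjoint of the Yukawa convolution, applied to \<open>g\<close>: its square integral is the form of the
  convolution square of the kernel, which is dominated by the Coulomb kernel.
\<close>

lemma yukawa_potential_square_le:
  assumes [measurable]: "g \<in> borel_measurable borel"
  shows "(\<integral>\<^sup>+s. (\<integral>\<^sup>+x. g x * ennreal (norm (yukawa 1 (norm (s - x)))) \<partial>lborel)\<^sup>2 \<partial>lborel)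
    \<le> 2 * yukawa_mass * rollnik_form g"
proof -
  let ?Y = "\<lambda>x s. ennreal (norm (yukawa 1 (norm (s - x :: real^3))))"
  have "(\<integral>\<^sup>+s. (\<integral>\<^sup>+x. g x * ?Y x s \<partial>lborel)\<^sup>2 \<partial>lborel) =
      (\<integral>\<^sup>+s. \<integral>\<^sup>+x. \<integral>\<^sup>+y. (g x * ?Y x s) * (g y * ?Y y s) \<partial>lborel \<partial>lborel \<partial>lborel)"
  proof (rule nn_integral_cong)
    fix s
    have "(\<integral>\<^sup>+x. g x * ?Y x s \<partial>lborel)\<^sup>2 = (\<integral>\<^sup>+x. (g x * ?Y x s) * (\<integral>\<^sup>+y. g y * ?Y y s \<partial>lborel) \<partial>lborel)"
      by (subst nn_integral_multc) (auto simp: power2_eq_square)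
    also have "\<dots> = (\<integral>\<^sup>+x. \<integral>\<^sup>+y. (g x * ?Y x s) * (g y * ?Y y s) \<partial>lborel \<partial>lborel)"
      by (intro nn_integral_cong nn_integral_cmult[symmetric]) measurable
    finally show "(\<integral>\<^sup>+x. g x * ?Y x s \<partial>lborel)\<^sup>2 = \<dots>" .
  qed
  also have "\<dots> = (\<integral>\<^sup>+x. \<integral>\<^sup>+s. \<integral>\<^sup>+y. (g x * ?Y x s) * (g y * ?Y y s) \<partial>lborel \<partial>lborel \<partial>lborel)"
    by (rule lborel_pair.Fubini') measurable
  also have "\<dots> = (\<integral>\<^sup>+x. \<integral>\<^sup>+y. \<integral>\<^sup>+s. (g x * ?Y x s) * (g y * ?Y y s) \<partial>lborel \<partial>lborel \<partial>lborel)"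
    by (intro nn_integral_cong lborel_pair.Fubini') measurable
  also have "\<dots> \<le> (\<integral>\<^sup>+x. \<integral>\<^sup>+y. 2 * yukawa_mass * (g x * g y * coulomb x y) \<partial>lborel \<partial>lborel)"
  proof (rule nn_integral_mono, rule nn_integral_mono_AE)
    fix x :: "real^3"
    have "AE y in lborel. y \<noteq> x"
      by (rule AE_lborel_singleton)
    then show "AE y in lborel. (\<integral>\<^sup>+s. (g x * ?Y x s) * (g y * ?Y y s) \<partial>lborel) \<le>
        2 * yukawa_mass * (g x * g y * coulomb x y)"
    proof eventually_elim
      case (elim y)
      have "(\<integral>\<^sup>+s. (g x * ?Y x s) * (g y * ?Y y s) \<partial>lborel) = (\<integral>\<^sup>+s. (g x * g y) * (?Y x s * ?Y y s) \<partial>lborel)"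
        by (intro nn_integral_cong) (simp add: mult_ac)
      also have "\<dots> = g x * g y * (\<integral>\<^sup>+s. ?Y x s * ?Y y s \<partial>lborel)"
        by (rule nn_integral_cmult) measurable
      also have "\<dots> \<le> g x * g y * (2 * yukawa_mass * coulomb x y)"
        using elim by (intro mult_left_mono yukawa_convolution_le) auto
      finally show ?case
        by (simp add: mult_ac)
    qed
  qed
  also have "\<dots> = (\<integral>\<^sup>+x. 2 * yukawa_mass * (\<integral>\<^sup>+y. g x * g y * coulomb x y \<partial>lborel) \<partial>lborel)"
    by (intro nn_integral_cong nn_integral_cmult) measurable
  also have "\<dots> = 2 * yukawa_mass * rollnik_form g"
    unfolding rollnik_form_def by (rule nn_integral_cmult) measurable
  finally show ?thesis .
qed

text \<open>
  With \<open>I = \<integral> v g\<^sup>2\<close> the estimates combine to \<open>I\<^sup>4 \<le> D I\<^sup>2\<close>, which bounds \<open>I\<close> as soon as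
  \<open>I\<close> is finite; hence the truncation.
\<close>

lemma weighted_square_finite:
  assumes [measurable]: "v \<in> borel_measurable borel" "p \<in> borel_measurable borel" "F \<in> borel_measurable borel"
    and v_loc: "\<And>R. (\<integral>\<^sup>+x. v x * indicator (cball 0 R) x \<partial>lborel) < \<infinity>"
    and rollnik: "rollnik_square v < \<infinity>"
    and F: "(\<integral>\<^sup>+s. (F s)\<^sup>2 \<partial>lborel) < \<infinity>"
    and p_le: "AE x in lborel. p x \<le> (\<integral>\<^sup>+s. F s * ennreal (norm (yukawa 1 (norm (s - x)))) \<partial>lborel)"
    and p_fin: "\<And>x. p x < \<infinity>"
  shows "(\<integral>\<^sup>+x. v x * (p x)\<^sup>2 \<partial>lborel) < \<infinity>"
proof -
  let ?Y = "\<lambda>x s. ennreal (norm (yukawa 1 (norm (s - x :: real^3))))"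
  define q where "q n x = min (p x) (of_nat n) * indicator (cball 0 (real n)) x" for n x
  have [measurable]: "q n \<in> borel_measurable borel" for n
    unfolding q_def by measurable
  have q_le: "q n x \<le> p x" for n x
    by (simp add: q_def indicator_def)
  define I where "I n = (\<integral>\<^sup>+x. v x * (q n x)\<^sup>2 \<partial>lborel)" for n
  define D where "D = (\<integral>\<^sup>+s. (F s)\<^sup>2 \<partial>lborel)\<^sup>2 * ((2 * yukawa_mass)\<^sup>2 * rollnik_square v)"
  have D_fin: "D < \<infinity>"
    using F rollnik yukawa_mass_finite
    by (simp add: D_def ennreal_mult_less_top power_less_top_ennreal)
  have I_fin: "I n < \<infinity>" for n
  proof -
    have "I n \<le> (\<integral>\<^sup>+x. (of_nat n)\<^sup>2 * (v x * indicator (cball 0 (real n)) x) \<partial>lborel)"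
      unfolding I_def
    proof (rule nn_integral_mono)
      fix x
      have "(min (p x) (of_nat n))\<^sup>2 \<le> (of_nat n)\<^sup>2"
        by (intro power_mono) auto
      then show "v x * (q n x)\<^sup>2 \<le> (of_nat n)\<^sup>2 * (v x * indicator (cball 0 (real n)) x)"
        by (auto simp: q_def indicator_def mult.commute intro!: mult_left_mono)
    qed
    also have "\<dots> = (of_nat n)\<^sup>2 * (\<integral>\<^sup>+x. v x * indicator (cball 0 (real n)) x \<partial>lborel)"
      by (rule nn_integral_cmult) measurable
    also have "\<dots> < \<infinity>"
      using v_loc[of "real n"]
      by (simp add: ennreal_mult_less_top power_less_top_ennreal of_nat_less_top)
    finally show ?thesis .
  qed
  have I_le: "(I n)\<^sup>2 * (I n)\<^sup>2 \<le> D * (I n)\<^sup>2" for n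
  proof -
    let ?T = "\<lambda>s. \<integral>\<^sup>+x. (v x * q n x) * ?Y x s \<partial>lborel"
    have "I n \<le> (\<integral>\<^sup>+x. (v x * q n x) * (\<integral>\<^sup>+s. F s * ?Y x s \<partial>lborel) \<partial>lborel)"
      unfolding I_def
    proof (rule nn_integral_mono_AE)
      show "AE x in lborel. v x * (q n x)\<^sup>2 \<le> (v x * q n x) * (\<integral>\<^sup>+s. F s * ?Y x s \<partial>lborel)"
        using p_le
      proof eventually_elim
        case (elim x)
        have "v x * (q n x)\<^sup>2 = (v x * q n x) * q n x"
          by (simp add: power2_eq_square mult.assoc)
        also have "\<dots> \<le> (v x * q n x) * (\<integral>\<^sup>+s. F s * ?Y x s \<partial>lborel)"
          by (intro mult_left_mono order_trans[OF q_le elim]) auto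
        finally show ?case .
      qed
    qed
    also have "\<dots> = (\<integral>\<^sup>+x. \<integral>\<^sup>+s. F s * ((v x * q n x) * ?Y x s) \<partial>lborel \<partial>lborel)"
      by (subst nn_integral_cmult[symmetric], measurable) (simp add: mult_ac)
    also have "\<dots> = (\<integral>\<^sup>+s. \<integral>\<^sup>+x. F s * ((v x * q n x) * ?Y x s) \<partial>lborel \<partial>lborel)"
      by (rule lborel_pair.Fubini') measurable
    also have "\<dots> = (\<integral>\<^sup>+s. F s * ?T s \<partial>lborel)"
      by (intro nn_integral_cong nn_integral_cmult) measurable
    finally have "(I n)\<^sup>2 \<le> (\<integral>\<^sup>+s. F s * ?T s \<partial>lborel)\<^sup>2"
      by (intro power_mono) auto
    also have "\<dots> \<le> (\<integral>\<^sup>+s. (F s)\<^sup>2 \<partial>lborel) * (\<integral>\<^sup>+s. (?T s)\<^sup>2 \<partial>lborel)"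
      by (rule Cauchy_Schwarz_nn_integral) measurable
    also have "\<dots> \<le> (\<integral>\<^sup>+s. (F s)\<^sup>2 \<partial>lborel) * (2 * yukawa_mass * rollnik_form (\<lambda>x. v x * q n x))"
      by (intro mult_left_mono yukawa_potential_square_le) auto
    finally have "((I n)\<^sup>2)\<^sup>2 \<le>
        ((\<integral>\<^sup>+s. (F s)\<^sup>2 \<partial>lborel) * (2 * yukawa_mass * rollnik_form (\<lambda>x. v x * q n x)))\<^sup>2"
      by (intro power_mono) auto
    also have "\<dots> = (\<integral>\<^sup>+s. (F s)\<^sup>2 \<partial>lborel)\<^sup>2 * ((2 * yukawa_mass)\<^sup>2 * (rollnik_form (\<lambda>x. v x * q n x))\<^sup>2)"
      by (simp add: power_mult_distrib)
    also have "\<dots> \<le> (\<integral>\<^sup>+s. (F s)\<^sup>2 \<partial>lborel)\<^sup>2 * ((2 * yukawa_mass)\<^sup>2 * (rollnik_square v * (I n)\<^sup>2))"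
      unfolding I_def by (intro mult_left_mono rollnik_form_le) auto
    finally show ?thesis
      by (simp add: D_def power2_eq_square[of "(I n)\<^sup>2"] mult.assoc)
  qed
  have I_bound: "I n \<le> 1 + D" for n
  proof -
    obtain i d where i: "I n = ennreal i" "i \<ge> 0" and d: "D = ennreal d" "d \<ge> 0"
      using I_fin[of n] D_fin by (metis ennreal_cases infinity_ennreal_def less_irrefl)
    from I_le[of n] have "i\<^sup>2 * i\<^sup>2 \<le> d * i\<^sup>2"
      using i d by (simp add: ennreal_power flip: ennreal_mult)
    then have "i = 0 \<or> i\<^sup>2 \<le> d"
      using mult_le_cancel_right_pos[of "i\<^sup>2" "i\<^sup>2" d] by (cases "i = 0") auto
    moreover have "2 * i \<le> 1 + i\<^sup>2"
      using zero_le_power2[of "i - 1"] by (simp add: power2_diff)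
    ultimately have "i \<le> 1 + d"
      using i(2) d(2) by (cases "i \<le> 1") auto
    then show ?thesis
      using i d by (simp add: ennreal_leI flip: ennreal_1 ennreal_plus)
  qed
  have "(\<lambda>n. I n) \<longlonglongrightarrow> (\<integral>\<^sup>+x. v x * (p x)\<^sup>2 \<partial>lborel)"
    unfolding I_def
  proof (rule nn_integral_LIMSEQ)
    have "q m x \<le> q n x" if "m \<le> n" for m n x
    proof -
      have "min (p x) (of_nat m) \<le> min (p x) (of_nat n)"
        using of_nat_mono[OF that, where ?'a = ennreal] by (intro min.mono) auto
      with that show ?thesis
        by (auto simp: q_def indicator_def)
    qed
    then show "incseq (\<lambda>n x. v x * (q n x)\<^sup>2)"
      by (auto simp: incseq_def le_fun_def intro!: mult_left_mono power_mono)
    show "(\<lambda>n. v x * (q n x)\<^sup>2) \<longlonglongrightarrow> v x * (p x)\<^sup>2" for x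
    proof (rule tendsto_eventually)
      obtain r where r: "p x = ennreal r" "r \<ge> 0"
        using p_fin[of x] by (metis ennreal_cases infinity_ennreal_def less_irrefl)
      obtain k :: nat where k: "real k \<ge> max (norm x) r"
        using real_arch_simple by blast
      have "q n x = p x" if "n \<ge> k" for n
      proof -
        have "real n \<ge> norm x" "real n \<ge> r"
          using that k by auto
        then show ?thesis
          using r by (simp add: q_def min_def ennreal_of_nat_eq_real_of_nat)
      qed
      then show "\<forall>\<^sub>F n in sequentially. v x * (q n x)\<^sup>2 = v x * (p x)\<^sup>2"
        unfolding eventually_sequentially by (intro exI[of _ k]) simp
    qed
  qed measurable
  then have "(\<integral>\<^sup>+x. v x * (p x)\<^sup>2 \<partial>lborel) \<le> 1 + D"
    by (rule LIMSEQ_le_const2) (use I_bound in blast)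
  also have "\<dots> < \<infinity>"
    using D_fin by simp
  finally show ?thesis .
qed

section \<open>The eigenvalue bound\<close>

text \<open>
  The representation theorem speaks only of points where the convolution converges absolutely;
  elsewhere the bound on the right is infinite.
\<close>

lemma norm_le_of_representation:
  fixes F K :: "real^3 \<Rightarrow> complex"
  assumes [measurable]: "F \<in> borel_measurable borel" "K \<in> borel_measurable borel"
    and "integrable lborel (\<lambda>x. F x * K x) \<Longrightarrow> c = (\<integral>x. F x * K x \<partial>lborel)"
  shows "ennreal (norm c) \<le> (\<integral>\<^sup>+x. ennreal (norm (F x)) * ennreal (norm (K x)) \<partial>lborel)"
proof (cases "integrable lborel (\<lambda>x. F x * K x)")
  case True
  with assms(3) integral_norm_bound_ennreal[OF True] show ?thesis
    by (simp add: norm_mult ennreal_mult)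
next
  case False
  then have "(\<integral>\<^sup>+x. ennreal (norm (F x * K x)) \<partial>lborel) = \<infinity>"
    unfolding integrable_iff_bounded by (simp add: less_top[symmetric])
  then show ?thesis
    by (simp add: norm_mult ennreal_mult)
qed

text \<open>
  Writing \<open>\<psi> = \<psi> - \<Delta>\<psi>\<close> convolved with the Yukawa kernel shows that \<open>|V| |\<psi>|\<^sup>2\<close> is
  integrable for all of \<open>H\<^sup>2\<close>.
\<close>

lemma sobolev_weighted_square_finite:
  fixes \<psi> u :: "real^3 \<Rightarrow> complex"
  assumes \<psi>: "square_summable \<psi>" and u: "square_summable u"
    and lap: "\<And>\<phi>. \<phi> \<in> test_functions \<Longrightarrow> (\<integral>x. \<psi> x * laplacian \<phi> x \<partial>lborel) = (\<integral>x. u x * \<phi> x \<partial>lborel)"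
    and [measurable]: "v \<in> borel_measurable borel"
    and v_loc: "\<And>R. (\<integral>\<^sup>+x. v x * indicator (cball 0 R) x \<partial>lborel) < \<infinity>"
    and rollnik: "rollnik_square v < \<infinity>"
  shows "(\<integral>\<^sup>+x. v x * (ennreal (norm (\<psi> x)))\<^sup>2 \<partial>lborel) < \<infinity>"
proof -
  have [measurable]: "\<psi> \<in> borel_measurable borel" "u \<in> borel_measurable borel"
    using \<psi> u by (simp_all add: square_summable_def)
  define F where "F x = \<psi> x + (-1) * u x" for x
  have F: "square_summable F"
    unfolding F_def by (intro square_summable_add square_summable_cmult \<psi> u)
  have [measurable]: "F \<in> borel_measurable borel"
    using F by (simp add: square_summable_def)
  have "AE y in lborel. integrable lborel (\<lambda>x. F x * yukawa 1 (norm (x - y))) \<longrightarrow>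
      \<psi> y = (\<integral>x. F x * yukawa 1 (norm (x - y)) \<partial>lborel)"
  proof (rule helmholtz_representation[OF \<psi>])
    fix \<phi> :: "real^3 \<Rightarrow> complex" assume \<phi>: "\<phi> \<in> test_functions"
    have "(\<integral>x. \<psi> x * (1\<^sup>2 * \<phi> x - laplacian \<phi> x) \<partial>lborel) =
        (\<integral>x. \<psi> x * \<phi> x \<partial>lborel) - (\<integral>x. \<psi> x * laplacian \<phi> x \<partial>lborel)"
      using integrable_mult_test_function[OF square_summable_imp_locally_summable[OF \<psi>] \<phi>]
        integrable_mult_laplacian[OF square_summable_imp_locally_summable[OF \<psi>] \<phi>]
      by (simp add: right_diff_distrib)
    also have "\<dots> = (\<integral>x. F x * \<phi> x \<partial>lborel)"
      unfolding lap[OF \<phi>] F_def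
      using integrable_mult_test_function[OF square_summable_imp_locally_summable[OF \<psi>] \<phi>]
        integrable_mult_test_function[OF square_summable_imp_locally_summable[OF u] \<phi>]
      by (simp add: left_diff_distrib)
    finally show "(\<integral>x. \<psi> x * (1\<^sup>2 * \<phi> x - laplacian \<phi> x) \<partial>lborel) = (\<integral>x. F x * \<phi> x \<partial>lborel)" .
  qed simp_all
  then have "AE y in lborel. ennreal (norm (\<psi> y)) \<le>
      (\<integral>\<^sup>+x. ennreal (norm (F x)) * ennreal (norm (yukawa 1 (norm (x - y)))) \<partial>lborel)"
  proof eventually_elim
    case (elim y)
    show ?case
      by (rule norm_le_of_representation) (measurable, use elim in blast)
  qed
  then show ?thesis
  proof (rule weighted_square_finite[rotated 6])
    show "(\<integral>\<^sup>+s. (ennreal (norm (F s)))\<^sup>2 \<partial>lborel) < \<infinity>"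
      using F by (simp add: square_summable_def ennreal_power)
  qed (use v_loc rollnik in \<open>simp_all add: infinity_ennreal_def\<close>)
qed

text \<open>
  Factoring \<open>\<Delta>\<^sup>2 - \<kappa>\<^sup>2 = (\<Delta> - \<kappa>) (\<Delta> + \<kappa>)\<close>, both \<open>\<Delta>\<psi> \<plusminus> \<kappa>\<psi>\<close> solve a Helmholtz equation with
  right-hand side \<open>V \<psi>\<close>; their difference is \<open>2 \<kappa> \<psi>\<close>.
\<close>

lemma eigenfunction_pointwise_bound:
  fixes \<psi> u F :: "real^3 \<Rightarrow> complex"
  assumes \<psi>: "square_summable \<psi>" and u: "square_summable u" and "\<kappa> \<noteq> 0"
    and lap: "\<And>\<phi>. \<phi> \<in> test_functions \<Longrightarrow> (\<integral>x. \<psi> x * laplacian \<phi> x \<partial>lborel) = (\<integral>x. u x * \<phi> x \<partial>lborel)"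
    and [measurable]: "F \<in> borel_measurable borel"
    and eigen: "\<And>\<phi>. \<phi> \<in> test_functions \<Longrightarrow> (\<integral>x. u x * laplacian \<phi> x \<partial>lborel) + (\<integral>x. F x * \<phi> x \<partial>lborel) =
      \<kappa>\<^sup>2 * (\<integral>x. \<psi> x * \<phi> x \<partial>lborel)"
  shows "AE y in lborel. ennreal (norm (\<psi> y)) \<le>
    ennreal (sqrt 2 / (8 * pi * norm \<kappa>)) * (\<integral>\<^sup>+x. ennreal (norm (F x)) * coulomb x y \<partial>lborel)"
proof -
  have [measurable]: "\<psi> \<in> borel_measurable borel" "u \<in> borel_measurable borel"
    using \<psi> u by (simp_all add: square_summable_def)
  have rep: "AE y in lborel. integrable lborel (\<lambda>x. F x * yukawa (csqrt k) (norm (x - y))) \<longrightarrow>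
      u y + k * \<psi> y = (\<integral>x. F x * yukawa (csqrt k) (norm (x - y)) \<partial>lborel)" if k: "k\<^sup>2 = \<kappa>\<^sup>2" for k
  proof (rule helmholtz_representation)
    show "square_summable (\<lambda>x. u x + k * \<psi> x)"
      by (intro square_summable_add square_summable_cmult \<psi> u)
    show "0 \<le> Re (csqrt k)"
      by (rule Re_csqrt)
    fix \<phi> :: "real^3 \<Rightarrow> complex" assume \<phi>: "\<phi> \<in> test_functions"
    have int: "integrable lborel (\<lambda>x. \<psi> x * \<phi> x)" "integrable lborel (\<lambda>x. \<psi> x * laplacian \<phi> x)"
      "integrable lborel (\<lambda>x. u x * \<phi> x)" "integrable lborel (\<lambda>x. u x * laplacian \<phi> x)"
      using square_summable_imp_locally_summable \<psi> u \<phi>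
      by (blast intro: integrable_mult_test_function integrable_mult_laplacian)+
    have "(\<integral>x. (u x + k * \<psi> x) * ((csqrt k)\<^sup>2 * \<phi> x - laplacian \<phi> x) \<partial>lborel) =
        (\<integral>x. k * (u x * \<phi> x) + k\<^sup>2 * (\<psi> x * \<phi> x) - u x * laplacian \<phi> x - k * (\<psi> x * laplacian \<phi> x) \<partial>lborel)"
      by (intro Bochner_Integration.integral_cong) (simp_all add: algebra_simps power2_eq_square[of k])
    also have "\<dots> = k * (\<integral>x. u x * \<phi> x \<partial>lborel) + k\<^sup>2 * (\<integral>x. \<psi> x * \<phi> x \<partial>lborel) -
        (\<integral>x. u x * laplacian \<phi> x \<partial>lborel) - k * (\<integral>x. \<psi> x * laplacian \<phi> x \<partial>lborel)"
      using int by simp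
    also have "\<dots> = (\<integral>x. F x * \<phi> x \<partial>lborel)"
      using eigen[OF \<phi>] by (simp add: k lap[OF \<phi>] algebra_simps)
    finally show "(\<integral>x. (u x + k * \<psi> x) * ((csqrt k)\<^sup>2 * \<phi> x - laplacian \<phi> x) \<partial>lborel) =
        (\<integral>x. F x * \<phi> x \<partial>lborel)" .
  qed measurable
  \<comment> \<open>The principal square roots have nonnegative real part, also for \<open>\<kappa>\<close> on the real axis.\<close>
  define w z where "w = csqrt \<kappa>" and "z = csqrt (- \<kappa>)"
  have wz: "Re w \<ge> 0" "Re z \<ge> 0" "z\<^sup>2 = - w\<^sup>2"
    by (simp_all add: w_def z_def Re_csqrt del: csqrt.simps)
  from rep[of \<kappa>, OF refl] rep[of "- \<kappa>", OF power2_minus] show ?thesis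
  proof eventually_elim
    case (elim y)
    let ?E = "\<integral>\<^sup>+x. ennreal (norm (F x)) * coulomb x y \<partial>lborel"
    show ?case
    proof (cases "?E < \<infinity>")
      case True
      have int: "integrable lborel (\<lambda>x. F x * yukawa k (norm (x - y)))" if "Re k \<ge> 0" for k
        unfolding integrable_iff_bounded
      proof
        have "(\<integral>\<^sup>+x. ennreal (norm (F x * yukawa k (norm (x - y)))) \<partial>lborel) \<le> ?E"
          unfolding norm_mult ennreal_mult[OF norm_ge_zero norm_ge_zero]
          by (intro nn_integral_mono mult_left_mono norm_yukawa_le_coulomb that) auto
        with True show "(\<integral>\<^sup>+x. ennreal (norm (F x * yukawa k (norm (x - y)))) \<partial>lborel) < \<infinity>"
          by (rule order_le_less_trans[rotated])
      qed measurable
      have "2 * \<kappa> * \<psi> y = (u y + \<kappa> * \<psi> y) - (u y + (- \<kappa>) * \<psi> y)"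
        by simp
      also have "\<dots> = (\<integral>x. F x * yukawa w (norm (x - y)) \<partial>lborel) - (\<integral>x. F x * yukawa z (norm (x - y)) \<partial>lborel)"
        using elim int wz(1,2) unfolding w_def z_def by simp
      also have "\<dots> = (\<integral>x. F x * (yukawa w (norm (x - y)) - yukawa z (norm (x - y))) \<partial>lborel)"
        by (simp add: right_diff_distrib int wz(1,2))
      finally have "ennreal (norm (2 * \<kappa> * \<psi> y)) \<le>
          (\<integral>\<^sup>+x. ennreal (norm (F x)) * ennreal (norm (yukawa w (norm (x - y)) - yukawa z (norm (x - y)))) \<partial>lborel)"
        by (intro norm_le_of_representation) measurable
      also have "\<dots> \<le> (\<integral>\<^sup>+x. ennreal (sqrt 2 / (4 * pi)) * (ennreal (norm (F x)) * coulomb x y) \<partial>lborel)"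
      proof (rule nn_integral_mono)
        fix x
        have "ennreal (norm (yukawa w (norm (x - y)) - yukawa z (norm (x - y)))) \<le>
            ennreal (sqrt 2 / (4 * pi) * (1 / norm (x - y)))"
          by (intro ennreal_leI norm_yukawa_diff_le wz) simp
        also have "\<dots> = ennreal (sqrt 2 / (4 * pi)) * coulomb x y"
          unfolding coulomb_def by (rule ennreal_mult) simp_all
        finally have "ennreal (norm (F x)) * ennreal (norm (yukawa w (norm (x - y)) - yukawa z (norm (x - y)))) \<le>
            ennreal (norm (F x)) * (ennreal (sqrt 2 / (4 * pi)) * coulomb x y)"
          by (rule mult_left_mono) simp
        then show "ennreal (norm (F x)) * ennreal (norm (yukawa w (norm (x - y)) - yukawa z (norm (x - y)))) \<le>
            ennreal (sqrt 2 / (4 * pi)) * (ennreal (norm (F x)) * coulomb x y)"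
          by (simp only: mult_ac)
      qed
      also have "\<dots> = ennreal (sqrt 2 / (4 * pi)) * ?E"
        by (rule nn_integral_cmult) measurable
      finally have le: "ennreal (norm (2 * \<kappa> * \<psi> y)) \<le> ennreal (sqrt 2 / (4 * pi)) * ?E" .
      have "ennreal (norm (\<psi> y)) = ennreal (1 / (2 * norm \<kappa>)) * ennreal (norm (2 * \<kappa> * \<psi> y))"
        using \<open>\<kappa> \<noteq> 0\<close> by (simp add: norm_mult flip: ennreal_mult)
      also have "\<dots> \<le> ennreal (1 / (2 * norm \<kappa>)) * (ennreal (sqrt 2 / (4 * pi)) * ?E)"
        by (rule mult_left_mono[OF le]) simp
      also have "\<dots> = ennreal (sqrt 2 / (8 * pi * norm \<kappa>)) * ?E"
      proof -
        have "ennreal (1 / (2 * norm \<kappa>)) * ennreal (sqrt 2 / (4 * pi)) =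
            ennreal (1 / (2 * norm \<kappa>) * (sqrt 2 / (4 * pi)))"
          by (rule ennreal_mult[symmetric]) simp_all
        also have "1 / (2 * norm \<kappa>) * (sqrt 2 / (4 * pi)) = sqrt 2 / (8 * pi * norm \<kappa>)"
          by simp
        finally show ?thesis
          by (simp only: mult.assoc[symmetric])
      qed
      finally show ?thesis .
    next
      case False
      then have "?E = \<infinity>"
        by (simp add: less_top[symmetric])
      then show ?thesis
        using \<open>\<kappa> \<noteq> 0\<close> by (simp add: ennreal_mult_top)
    qed
  qed
qed

theorem theorem2:
  fixes V :: "real^3 \<Rightarrow> complex"
  assumes "V \<in> rollnik_class"
  shows "point_spectrum (schroedinger_operator V)
           \<subseteq> {\<mu>. norm \<mu> \<le> 1 / 2 * ((rollnik_norm V)\<^sup>2 / (4 * pi)\<^sup>2)}"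
proof (intro subsetI CollectI)
  fix \<mu> assume "\<mu> \<in> point_spectrum (schroedinger_operator V)"
  then obtain \<psi>0 where eigen: "(\<psi>0, \<lambda>x. \<mu> * \<psi>0 x) \<in> schroedinger_operator V"
    and nonzero: "\<not> (AE x in lebesgue. \<psi>0 x = 0)"
    by (auto simp: point_spectrum_def)
  show "norm \<mu> \<le> 1 / 2 * ((rollnik_norm V)\<^sup>2 / (4 * pi)\<^sup>2)"
  proof (cases "\<mu> = 0")
    case False
    have V: "locally_integrable V" "rollnik_integral V < \<infinity>"
      using assms by (simp_all add: rollnik_class_def)
    obtain V' where V': "V' \<in> borel_measurable borel" "AE x in lborel. V x = V' x"
      using borel_representative[OF locally_integrable_measurable[OF V(1)]] .
    have "\<psi>0 \<in> sobolev_H2"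
      using eigen by (simp add: schroedinger_operator_def)
    then obtain \<psi> u where \<psi>: "square_summable \<psi>" and u: "square_summable u"
      and AE: "AE x in lborel. \<psi>0 x = \<psi> x" "AE x in lborel. weak_laplacian \<psi>0 x = u x"
      and lap: "\<And>\<phi>. \<phi> \<in> test_functions \<Longrightarrow> (\<integral>x. \<psi> x * laplacian \<phi> x \<partial>lborel) = (\<integral>x. u x * \<phi> x \<partial>lborel)"
      by (rule sobolev_H2_representatives) blast
    have [measurable]: "\<psi> \<in> borel_measurable borel" "u \<in> borel_measurable borel" "V' \<in> borel_measurable borel"
      using \<psi> u V'(1) by (simp_all add: square_summable_def)
    define v p where "v x = ennreal (norm (V' x))" and "p x = ennreal (norm (\<psi> x))" for x
    have [measurable]: "v \<in> borel_measurable borel" "p \<in> borel_measurable borel"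
      unfolding v_def p_def by measurable
    have v_loc: "(\<integral>\<^sup>+x. v x * indicator (cball 0 R) x \<partial>lborel) < \<infinity>" for R
      using locally_integrable_representative[OF V(1) V'] by (simp add: locally_summable_def v_def)
    define Q where "Q = (rollnik_norm V)\<^sup>2"
    have "rollnik_integral V = (\<integral>\<^sup>+x. \<integral>\<^sup>+y. ennreal (norm (V x) * norm (V y) / (norm (x - y))\<^sup>2) \<partial>lborel \<partial>lborel)"
      by (simp add: rollnik_integral_def nn_integral_completion)
    also have "\<dots> = (\<integral>\<^sup>+x. \<integral>\<^sup>+y. v x * v y * (coulomb x y)\<^sup>2 \<partial>lborel \<partial>lborel)"
    proof (rule nn_integral_cong_AE)
      show "AE x in lborel. (\<integral>\<^sup>+y. ennreal (norm (V x) * norm (V y) / (norm (x - y))\<^sup>2) \<partial>lborel) =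
          (\<integral>\<^sup>+y. v x * v y * (coulomb x y)\<^sup>2 \<partial>lborel)"
        using V'(2)
      proof eventually_elim
        case (elim x)
        show ?case
        proof (rule nn_integral_cong_AE)
          show "AE y in lborel. ennreal (norm (V x) * norm (V y) / (norm (x - y))\<^sup>2) =
              v x * v y * (coulomb x y)\<^sup>2"
            using V'(2) by eventually_elim
              (simp add: elim v_def coulomb_def ennreal_power power_one_over flip: ennreal_mult)
        qed
      qed
    qed
    finally have Q_eq: "rollnik_square v = rollnik_integral V"
      by (simp add: rollnik_square_def)
    have Q: "rollnik_square v = ennreal Q" "Q \<ge> 0"
      using V(2) by (simp_all add: Q_eq Q_def rollnik_norm_def less_top)
    define \<kappa> where "\<kappa> = csqrt \<mu>"
    have \<kappa>: "\<kappa>\<^sup>2 = \<mu>" "\<kappa> \<noteq> 0"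
      using False by (simp_all add: \<kappa>_def del: csqrt.simps)
    \<comment> \<open>The constant of the pointwise bound: \<open>\<surd>2 / (4 \<pi>)\<close> from the kernel, divided by \<open>2 |\<kappa>|\<close>.\<close>
    define c where "c = sqrt 2 / (8 * pi * norm \<kappa>)"
    have c: "c > 0"
      using \<kappa>(2) by (simp add: c_def)
    define E where "E y = (\<integral>\<^sup>+x. (v x * p x) * coulomb x y \<partial>lborel)" for y
    have [measurable]: "E \<in> borel_measurable borel"
      unfolding E_def by measurable
    have "AE y in lborel. ennreal (norm (\<psi> y)) \<le>
        ennreal c * (\<integral>\<^sup>+x. ennreal (norm (V' x * \<psi> x)) * coulomb x y \<partial>lborel)"
      unfolding c_def
    proof (rule eigenfunction_pointwise_bound[OF \<psi> u \<kappa>(2) lap])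
      fix \<phi> :: "real^3 \<Rightarrow> complex" assume "\<phi> \<in> test_functions"
      from eigenfunction_weak_equation[OF eigen _ _ _ V'(2) AE this]
      show "(\<integral>x. u x * laplacian \<phi> x \<partial>lborel) + (\<integral>x. V' x * \<psi> x * \<phi> x \<partial>lborel) =
          \<kappa>\<^sup>2 * (\<integral>x. \<psi> x * \<phi> x \<partial>lborel)"
        by (simp add: \<kappa>(1))
    qed measurable
    then have bound: "AE y in lborel. p y \<le> ennreal c * E y"
      by (simp add: p_def v_def E_def norm_mult ennreal_mult)
    define I where "I = (\<integral>\<^sup>+x. v x * (p x)\<^sup>2 \<partial>lborel)"
    have "I < \<infinity>"
      unfolding I_def p_def
      by (rule sobolev_weighted_square_finite[OF \<psi> u lap _ v_loc]) (use Q in simp_all)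
    then obtain i where i: "I = ennreal i" "i \<ge> 0"
      by (metis ennreal_cases infinity_ennreal_def less_irrefl)
    have "I \<noteq> 0"
    proof
      assume "I = 0"
      then have "AE x in lborel. v x * (p x)\<^sup>2 = 0"
        unfolding I_def by (subst (asm) nn_integral_0_iff_AE) auto
      then have vp: "AE x in lborel. v x * p x = 0"
        by eventually_elim auto
      have "E y = 0" for y
        unfolding E_def using vp by (subst nn_integral_0_iff_AE) (auto elim: eventually_mono)
      with bound have "AE y in lborel. p y = 0"
        by simp
      with AE(1) have "AE x in lborel. \<psi>0 x = 0"
        by eventually_elim (simp add: p_def)
      with nonzero show False
        using AE_completion by blast
    qed
    with i have i_pos: "i > 0"
      by auto
    \<comment> \<open>Weighting the pointwise bound by \<open>|V \<psi>|\<close> closes the estimate for \<open>I\<close>.\<close>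
    have "I \<le> (\<integral>\<^sup>+y. (v y * p y) * (ennreal c * E y) \<partial>lborel)"
      unfolding I_def
    proof (rule nn_integral_mono_AE)
      show "AE y in lborel. v y * (p y)\<^sup>2 \<le> (v y * p y) * (ennreal c * E y)"
        using bound by eventually_elim
          (simp only: power2_eq_square mult.assoc[symmetric, of "v _" "p _" "p _"], rule mult_left_mono, auto)
    qed
    also have "\<dots> = ennreal c * rollnik_form (\<lambda>x. v x * p x)"
    proof -
      have "(\<integral>\<^sup>+y. (v y * p y) * (ennreal c * E y) \<partial>lborel) = (\<integral>\<^sup>+y. ennreal c * ((v y * p y) * E y) \<partial>lborel)"
        by (intro nn_integral_cong) (simp only: mult_ac)
      also have "\<dots> = ennreal c * (\<integral>\<^sup>+y. (v y * p y) * E y \<partial>lborel)"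
        by (rule nn_integral_cmult) measurable
      also have "(\<integral>\<^sup>+y. (v y * p y) * E y \<partial>lborel) =
          (\<integral>\<^sup>+y. \<integral>\<^sup>+x. (v y * p y) * ((v x * p x) * coulomb x y) \<partial>lborel \<partial>lborel)"
        unfolding E_def by (intro nn_integral_cong nn_integral_cmult[symmetric]) measurable
      also have "\<dots> = rollnik_form (\<lambda>x. v x * p x)"
        unfolding rollnik_form_def
        by (intro nn_integral_cong) (simp add: coulomb_commute mult_ac)
      finally show ?thesis .
    qed
    finally have "I\<^sup>2 \<le> (ennreal c)\<^sup>2 * (rollnik_form (\<lambda>x. v x * p x))\<^sup>2"
      unfolding power_mult_distrib[symmetric] by (intro power_mono) auto
    also have "\<dots> \<le> (ennreal c)\<^sup>2 * (rollnik_square v * I\<^sup>2)"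
      unfolding I_def by (intro mult_left_mono rollnik_form_le) auto
    finally have "i\<^sup>2 \<le> c\<^sup>2 * (Q * i\<^sup>2)"
      using i Q c by (simp add: ennreal_power flip: ennreal_mult)
    then have "1 * i\<^sup>2 \<le> (c\<^sup>2 * Q) * i\<^sup>2"
      by (simp add: mult.assoc)
    then have "1 \<le> c\<^sup>2 * Q"
      using i_pos by (simp only: mult_le_cancel_right_pos zero_less_power)
    moreover have "(norm \<kappa>)\<^sup>2 = norm \<mu>"
      by (simp add: \<kappa>(1) flip: norm_power)
    then have "c\<^sup>2 = 1 / (32 * pi\<^sup>2 * norm \<mu>)"
      by (simp add: c_def power_divide power_mult_distrib)
    ultimately have "norm \<mu> \<le> Q / (32 * pi\<^sup>2)"
      using False by (simp add: field_simps)
    then show ?thesis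
      by (simp add: Q_def power_mult_distrib)
  qed simp
qed

end
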